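(* Let $\Sigma$ be a monoidal signature and $\mathcal{R}$ a rewriting system on $\mathbf{STMC}(\Sigma)+\mathbf{CComon}$. For terms $g,h:m\to n$ in $\mathbf{STMC}(\Sigma)+\mathbf{CComon}$, we have $g\Rightarrow_{\mathcal{R}}h$ if and only if $[\![\mathrm{fold}([\mathcal{I},\mathcal{C}](g))]\!]\rightsquigarrow_{[\![\mathrm{fold}([\mathcal{I},\mathcal{C}](\mathcal{R}))]\!]}[\![\mathrm{fold}([\mathcal{I},\mathcal{C}](h))]\!]$, where $\rightsquigarrow$ denotes traced comonoid DPO rewriting.
   Context: A monoidal signature $\Sigma$ is a set of generators each with an arity and coarity in $\mathbb{N}$. A hypergraph $F$ has a set $F_\star$ of vertices and sets $F_{k,l}$ of hyperedges with ordered source maps $s_i$ ($i<k$) and target maps $t_j$ ($j<l$) into $F_\star$; $\mathbf{Hyp}_\Sigma$ is the category of hypergraphs whose hyperedges in $F_{k,l}$ are labelled by generators of arity $k$ and coarity $l$, with structure-preserving morphisms. The discrete hypergraph $n$ has $n$ vertices and no hyperedges. $\mathrm{Csp}_D(\mathbf{Hyp}_\Sigma)$ is the PROP whose morphisms $m\to n$ are isomorphism classes of cospans $m\to F\leftarrow n$ in $\mathbf{Hyp}_\Sigma$, composition by pushout, tensor by disjoint union, with Frobenius structure given by discrete cospans merge $n+n\to n\leftarrow n$, unit $0\to n\leftarrow n$, copy $n\to n\leftarrow n+n$, counit $n\to n\leftarrow 0$. Terms: $\mathbf{STMC}(\Sigma)$ is the free symmetric traced monoidal PROP on $\Sigma$;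 $\mathbf{CComon}$ is the PROP of commutative comonoids (generators copy $1\to2$, discard $1\to0$ with coassociativity, counitality, cocommutativity); $\mathbf{STMC}(\Sigma)+\mathbf{CComon}$ is their coproduct, with trace $\mathrm{Tr}$. $\mathbf{SMC}(\Sigma)+\mathbf{Frob}$ is the coproduct of the free symmetric monoidal PROP on $\Sigma$ with the PROP $\mathbf{Frob}$ of special commutative Frobenius algebras (generators merge, unit, copy, counit); it is compact closed with $\mathrm{cup}_x=$ unit;copy, $\mathrm{cap}_x=$ merge;counit and canonical trace $(\mathrm{cup}_x\otimes\mathrm{id}_m);(\mathrm{id}_x\otimes h);(\mathrm{cap}_x\otimes\mathrm{id}_n)$. $\mathcal{I}:\mathbf{STMC}(\Sigma)\to\mathbf{SMC}(\Sigma)+\mathbf{Frob}$ sends generators to themselves and the trace to the canonical trace; $\mathcal{C}:\mathbf{CComon}\to\mathbf{Frob}$ is the evident embedding (copy to copy, discard to counit); $[\mathcal{I},\mathcal{C}]$ is their copairing. $[\![-]\!]:\mathbf{SMC}(\Sigma)+\mathbf{Frob}\to\mathrm{Csp}_D(\mathbf{Hyp}_\Sigma)$ sends $\phi:m\to n$ to $m\to E_\phi\leftarrow n$, $E_\phi$ having $m+n$ vertices and one hyperedge labelled $\phi$ with sources the left-interface and targets the right-interface vertices in order, and the Frobenius generators to the discrete cospans above. For $t:m\to n$ in $\mathbf{SMC}(\Sigma)+\mathbf{Frob}$, $\mathrm{fold}(t)=\mathrm{cup}_m;(\mathrm{id}_m\otimes t):0\to m+n$; $[\![\mathrm{fold}(t)]\!]$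 is a cospan $0\to F\leftarrow m+n$, identified with a hypergraph $F$ with an interface morphism $m+n\to F$. Term rewriting: a rewriting system $\mathcal{R}$ is a set of pairs $(l,r)$ of terms $l,r:i\to j$. For $g,h:m\to n$, $g\Rightarrow_{\mathcal{R}}h$ if there exist $(l,r)\in\mathcal{R}$ with $l,r:i\to j$ and a term $c:j+m\to i+n$ with $g=\mathrm{Tr}^i((l\otimes\mathrm{id}_m);c)$ and $h=\mathrm{Tr}^i((r\otimes\mathrm{id}_m);c)$. Graph rewriting: each $(l,r)\in\mathcal{R}$ with $[\![[\mathcal{I},\mathcal{C}](l)]\!]=(i\xrightarrow{a_1}L\xleftarrow{a_2}j)$ and $[\![[\mathcal{I},\mathcal{C}](r)]\!]=(i\xrightarrow{b_1}R\xleftarrow{b_2}j)$ gives the DPO rule $L\xleftarrow{[a_1,a_2]}i+j\xrightarrow{[b_1,b_2]}R$; $[\![\mathrm{fold}([\mathcal{I},\mathcal{C}](\mathcal{R}))]\!]$ is this set of rules. The in-degree of a vertex $v$ is the number of pairs $(e,j)$ with $v=t_j(e)$; a cospan $m\xrightarrow{f}F\xleftarrow{g}n$ is partial left-monogamous if $f$ is injective, every vertex in the image of $f$ has in-degree $0$ and every other vertex has in-degree $0$ or $1$. For hypergraphs $G,H$ with interfaces $m+n\to G$, $m+n\to H$, we have $G\rightsquigarrow H$ if there are a rule $L\xleftarrow{a}i+j\xrightarrow{b}R$, a morphism $L\to G$, an object $C$ with $c=[c_1,c_2]:i+j\to C$ ($c_1:i\to C$, $c_2:j\to C$), $d=[d_1,d_2]:m+n\to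 C$ ($d_1:m\to C$, $d_2:n\to C$), and morphisms $C\to G$, $C\to H$, $R\to H$, such that $L\xleftarrow{a}i+j\xrightarrow{c}C$ with $L\to G\leftarrow C$ is a pushout square, $R\xleftarrow{b}i+j\xrightarrow{c}C$ with $R\to H\leftarrow C$ is a pushout square, the interfaces of $G$ and $H$ equal $m+n\xrightarrow{d}C\to G$ and $m+n\xrightarrow{d}C\to H$, and moreover (traced left-boundary complement) $c_2$ is injective and the cospan $j+m\xrightarrow{[c_2,d_1]}C\xleftarrow{[c_1,d_2]}i+n$ is partial left-monogamous. *)

theory Defs
  imports Complex_Main "HOL-Library.Extended_Nat" "HOL-Library.Infinite_Typeclass"
begin

section \<open>Monoidal signatures\<close>

record 'g msig =
  gens :: "'g set"
  arity :: "'g \<Rightarrow> nat"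
  coarity :: "'g \<Rightarrow> nat"


section \<open>The traced PROP STMC(S) + CComon\<close>

text \<open>
  A morphism of a presented PROP is a well-typed term up to the congruence generated by the
  PROP axioms and the equations of the presentation. Composition is written in diagrammatic
  order. \<open>TTr x m n t\<close> is the trace of \<open>t : x + m \<rightarrow> x + n\<close> over its first \<open>x\<close> wires.
\<close>

datatype 'g tterm =
    TGen 'g
  | TId nat
  | TSym nat nat
  | TSeq "'g tterm" "'g tterm"  (infixl \<open>;\<^sub>T\<close> 60)
  | TTens "'g tterm" "'g tterm"  (infixl \<open>\<otimes>\<^sub>T\<close> 70)
  | TTr nat nat nat "'g tterm"
  | TCopy
  | TDiscard

inductive ttyped :: "'g msig \<Rightarrow> 'g tterm \<Rightarrow> nat \<Rightarrow> nat \<Rightarrow> bool" for S where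
  "\<phi> \<in> gens S \<Longrightarrow> ttyped S (TGen \<phi>) (arity S \<phi>) (coarity S \<phi>)"
| "ttyped S (TId n) n n"
| "ttyped S (TSym m n) (m + n) (n + m)"
| "\<lbrakk>ttyped S s l m; ttyped S t m n\<rbrakk> \<Longrightarrow> ttyped S (s ;\<^sub>T t) l n"
| "\<lbrakk>ttyped S s m n; ttyped S t m' n'\<rbrakk> \<Longrightarrow> ttyped S (s \<otimes>\<^sub>T t) (m + m') (n + n')"
| "ttyped S t (x + m) (x + n) \<Longrightarrow> ttyped S (TTr x m n t) m n"
| "ttyped S TCopy 1 2"
| "ttyped S TDiscard 1 0"

text \<open>\<open>teq S m n s t\<close>: the terms \<open>s\<close> and \<open>t\<close> denote the same morphism \<open>m \<rightarrow> n\<close>.\<close>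

inductive teq :: "'g msig \<Rightarrow> nat \<Rightarrow> nat \<Rightarrow> 'g tterm \<Rightarrow> 'g tterm \<Rightarrow> bool" for S where
  \<comment> \<open>congruence\<close>
  teq_refl: "ttyped S t m n \<Longrightarrow> teq S m n t t"
| teq_sym: "teq S m n s t \<Longrightarrow> teq S m n t s"
| teq_trans: "\<lbrakk>teq S m n s t; teq S m n t u\<rbrakk> \<Longrightarrow> teq S m n s u"
| teq_Seq: "\<lbrakk>teq S l m s s'; teq S m n t t'\<rbrakk> \<Longrightarrow> teq S l n (s ;\<^sub>T t) (s' ;\<^sub>T t')"
| teq_Tens: "\<lbrakk>teq S m n s s'; teq S m' n' t t'\<rbrakk>
    \<Longrightarrow> teq S (m + m') (n + n') (s \<otimes>\<^sub>T t) (s' \<otimes>\<^sub>T t')"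
| teq_Tr: "teq S (x + m) (x + n) t t' \<Longrightarrow> teq S m n (TTr x m n t) (TTr x m n t')"
  \<comment> \<open>category\<close>
| teq_id_left: "ttyped S t m n \<Longrightarrow> teq S m n (TId m ;\<^sub>T t) t"
| teq_id_right: "ttyped S t m n \<Longrightarrow> teq S m n (t ;\<^sub>T TId n) t"
| teq_seq_assoc: "\<lbrakk>ttyped S s k l; ttyped S t l m; ttyped S u m n\<rbrakk>
    \<Longrightarrow> teq S k n ((s ;\<^sub>T t) ;\<^sub>T u) (s ;\<^sub>T (t ;\<^sub>T u))"
  \<comment> \<open>strict monoidal structure\<close>
| teq_tens_id: "teq S (m + n) (m + n) (TId m \<otimes>\<^sub>T TId n) (TId (m + n))"
| teq_interchange: "\<lbrakk>ttyped S s l m; ttyped S t m n; ttyped S s' l' m'; ttyped S t' m' n'\<rbrakk>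
    \<Longrightarrow> teq S (l + l') (n + n')
          ((s ;\<^sub>T t) \<otimes>\<^sub>T (s' ;\<^sub>T t')) ((s \<otimes>\<^sub>T s') ;\<^sub>T (t \<otimes>\<^sub>T t'))"
| teq_tens_unit_left: "ttyped S t m n \<Longrightarrow> teq S m n (TId 0 \<otimes>\<^sub>T t) t"
| teq_tens_unit_right: "ttyped S t m n \<Longrightarrow> teq S m n (t \<otimes>\<^sub>T TId 0) t"
| teq_tens_assoc: "\<lbrakk>ttyped S s m n; ttyped S t m' n'; ttyped S u m'' n''\<rbrakk>
    \<Longrightarrow> teq S (m + m' + m'') (n + n' + n'') ((s \<otimes>\<^sub>T t) \<otimes>\<^sub>T u) (s \<otimes>\<^sub>T (t \<otimes>\<^sub>T u))"
  \<comment> \<open>symmetry\<close>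
| teq_sym_natural: "\<lbrakk>ttyped S s m n; ttyped S t m' n'\<rbrakk>
    \<Longrightarrow> teq S (m + m') (n' + n) ((s \<otimes>\<^sub>T t) ;\<^sub>T TSym n n') (TSym m m' ;\<^sub>T (t \<otimes>\<^sub>T s))"
| teq_sym_inverse: "teq S (m + n) (m + n) (TSym m n ;\<^sub>T TSym n m) (TId (m + n))"
| teq_sym_hexagon: "teq S (m + n + p) (p + m + n)
    (TSym (m + n) p) ((TId m \<otimes>\<^sub>T TSym n p) ;\<^sub>T (TSym m p \<otimes>\<^sub>T TId n))"
  \<comment> \<open>trace: tightening, sliding, vanishing, superposing, yanking\<close>
| teq_tightening: "\<lbrakk>ttyped S s m m'; ttyped S t (x + m') (x + n'); ttyped S u n' n\<rbrakk>
    \<Longrightarrow> teq S m n (TTr x m n ((TId x \<otimes>\<^sub>T s) ;\<^sub>T t ;\<^sub>T (TId x \<otimes>\<^sub>T u)))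
          (s ;\<^sub>T TTr x m' n' t ;\<^sub>T u)"
| teq_sliding: "\<lbrakk>ttyped S t (x + m) (y + n); ttyped S s y x\<rbrakk>
    \<Longrightarrow> teq S m n (TTr x m n (t ;\<^sub>T (s \<otimes>\<^sub>T TId n))) (TTr y m n ((s \<otimes>\<^sub>T TId m) ;\<^sub>T t))"
| teq_vanishing_zero: "ttyped S t m n \<Longrightarrow> teq S m n (TTr 0 m n t) t"
| teq_vanishing_plus: "ttyped S t (x + y + m) (x + y + n)
    \<Longrightarrow> teq S m n (TTr (x + y) m n t) (TTr y m n (TTr x (y + m) (y + n) t))"
| teq_superposing: "ttyped S t (x + m) (x + n)
    \<Longrightarrow> teq S (m + k) (n + k) (TTr x (m + k) (n + k) (t \<otimes>\<^sub>T TId k)) (TTr x m n t \<otimes>\<^sub>T TId k)"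
| teq_yanking: "teq S x x (TTr x x x (TSym x x)) (TId x)"
  \<comment> \<open>commutative comonoid\<close>
| teq_coassoc: "teq S 1 3 (TCopy ;\<^sub>T (TCopy \<otimes>\<^sub>T TId 1)) (TCopy ;\<^sub>T (TId 1 \<otimes>\<^sub>T TCopy))"
| teq_counit_left: "teq S 1 1 (TCopy ;\<^sub>T (TDiscard \<otimes>\<^sub>T TId 1)) (TId 1)"
| teq_counit_right: "teq S 1 1 (TCopy ;\<^sub>T (TId 1 \<otimes>\<^sub>T TDiscard)) (TId 1)"
| teq_cocomm: "teq S 1 2 (TCopy ;\<^sub>T TSym 1 1) TCopy"


section \<open>Term rewriting\<close>

definition rewriting_system :: "'g msig \<Rightarrow> ('g tterm \<times> 'g tterm) set \<Rightarrow> bool" where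
  "rewriting_system S \<R> \<longleftrightarrow> (\<forall>(l, r) \<in> \<R>. \<exists>i j. ttyped S l i j \<and> ttyped S r i j)"

definition term_rewrite ::
    "'g msig \<Rightarrow> ('g tterm \<times> 'g tterm) set \<Rightarrow> nat \<Rightarrow> nat \<Rightarrow> 'g tterm \<Rightarrow> 'g tterm \<Rightarrow> bool" where
  "term_rewrite S \<R> m n g h \<longleftrightarrow>
    (\<exists>l r i j c. (l, r) \<in> \<R> \<and> ttyped S l i j \<and> ttyped S r i j \<and> ttyped S c (j + m) (i + n) \<and>
       teq S m n g (TTr i m n ((l \<otimes>\<^sub>T TId m) ;\<^sub>T c)) \<and>
       teq S m n h (TTr i m n ((r \<otimes>\<^sub>T TId m) ;\<^sub>T c)))"


section \<open>The PROP SMC(S) + Frob\<close>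

datatype 'g fterm =
    FGen 'g
  | FId nat
  | FSym nat nat
  | FSeq "'g fterm" "'g fterm"  (infixl \<open>;\<^sub>F\<close> 60)
  | FTens "'g fterm" "'g fterm"  (infixl \<open>\<otimes>\<^sub>F\<close> 70)
  | FMerge
  | FUnit
  | FCopy
  | FCounit

inductive ftyped :: "'g msig \<Rightarrow> 'g fterm \<Rightarrow> nat \<Rightarrow> nat \<Rightarrow> bool" for S where
  "\<phi> \<in> gens S \<Longrightarrow> ftyped S (FGen \<phi>) (arity S \<phi>) (coarity S \<phi>)"
| "ftyped S (FId n) n n"
| "ftyped S (FSym m n) (m + n) (n + m)"
| "\<lbrakk>ftyped S s l m; ftyped S t m n\<rbrakk> \<Longrightarrow> ftyped S (s ;\<^sub>F t) l n"
| "\<lbrakk>ftyped S s m n; ftyped S t m' n'\<rbrakk> \<Longrightarrow> ftyped S (s \<otimes>\<^sub>F t) (m + m') (n + n')"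
| "ftyped S FMerge 2 1"
| "ftyped S FUnit 0 1"
| "ftyped S FCopy 1 2"
| "ftyped S FCounit 1 0"

inductive feq :: "'g msig \<Rightarrow> nat \<Rightarrow> nat \<Rightarrow> 'g fterm \<Rightarrow> 'g fterm \<Rightarrow> bool" for S where
  \<comment> \<open>congruence\<close>
  feq_refl: "ftyped S t m n \<Longrightarrow> feq S m n t t"
| feq_sym: "feq S m n s t \<Longrightarrow> feq S m n t s"
| feq_trans: "\<lbrakk>feq S m n s t; feq S m n t u\<rbrakk> \<Longrightarrow> feq S m n s u"
| feq_Seq: "\<lbrakk>feq S l m s s'; feq S m n t t'\<rbrakk> \<Longrightarrow> feq S l n (s ;\<^sub>F t) (s' ;\<^sub>F t')"
| feq_Tens: "\<lbrakk>feq S m n s s'; feq S m' n' t t'\<rbrakk>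
    \<Longrightarrow> feq S (m + m') (n + n') (s \<otimes>\<^sub>F t) (s' \<otimes>\<^sub>F t')"
  \<comment> \<open>category\<close>
| feq_id_left: "ftyped S t m n \<Longrightarrow> feq S m n (FId m ;\<^sub>F t) t"
| feq_id_right: "ftyped S t m n \<Longrightarrow> feq S m n (t ;\<^sub>F FId n) t"
| feq_seq_assoc: "\<lbrakk>ftyped S s k l; ftyped S t l m; ftyped S u m n\<rbrakk>
    \<Longrightarrow> feq S k n ((s ;\<^sub>F t) ;\<^sub>F u) (s ;\<^sub>F (t ;\<^sub>F u))"
  \<comment> \<open>strict monoidal structure\<close>
| feq_tens_id: "feq S (m + n) (m + n) (FId m \<otimes>\<^sub>F FId n) (FId (m + n))"
| feq_interchange: "\<lbrakk>ftyped S s l m; ftyped S t m n; ftyped S s' l' m'; ftyped S t' m' n'\<rbrakk>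
    \<Longrightarrow> feq S (l + l') (n + n')
          ((s ;\<^sub>F t) \<otimes>\<^sub>F (s' ;\<^sub>F t')) ((s \<otimes>\<^sub>F s') ;\<^sub>F (t \<otimes>\<^sub>F t'))"
| feq_tens_unit_left: "ftyped S t m n \<Longrightarrow> feq S m n (FId 0 \<otimes>\<^sub>F t) t"
| feq_tens_unit_right: "ftyped S t m n \<Longrightarrow> feq S m n (t \<otimes>\<^sub>F FId 0) t"
| feq_tens_assoc: "\<lbrakk>ftyped S s m n; ftyped S t m' n'; ftyped S u m'' n''\<rbrakk>
    \<Longrightarrow> feq S (m + m' + m'') (n + n' + n'') ((s \<otimes>\<^sub>F t) \<otimes>\<^sub>F u) (s \<otimes>\<^sub>F (t \<otimes>\<^sub>F u))"
  \<comment> \<open>symmetry\<close>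
| feq_sym_natural: "\<lbrakk>ftyped S s m n; ftyped S t m' n'\<rbrakk>
    \<Longrightarrow> feq S (m + m') (n' + n) ((s \<otimes>\<^sub>F t) ;\<^sub>F FSym n n') (FSym m m' ;\<^sub>F (t \<otimes>\<^sub>F s))"
| feq_sym_inverse: "feq S (m + n) (m + n) (FSym m n ;\<^sub>F FSym n m) (FId (m + n))"
| feq_sym_hexagon: "feq S (m + n + p) (p + m + n)
    (FSym (m + n) p) ((FId m \<otimes>\<^sub>F FSym n p) ;\<^sub>F (FSym m p \<otimes>\<^sub>F FId n))"
  \<comment> \<open>commutative monoid\<close>
| feq_assoc: "feq S 3 1 ((FMerge \<otimes>\<^sub>F FId 1) ;\<^sub>F FMerge) ((FId 1 \<otimes>\<^sub>F FMerge) ;\<^sub>F FMerge)"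
| feq_unit_left: "feq S 1 1 ((FUnit \<otimes>\<^sub>F FId 1) ;\<^sub>F FMerge) (FId 1)"
| feq_unit_right: "feq S 1 1 ((FId 1 \<otimes>\<^sub>F FUnit) ;\<^sub>F FMerge) (FId 1)"
| feq_comm: "feq S 2 1 (FSym 1 1 ;\<^sub>F FMerge) FMerge"
  \<comment> \<open>commutative comonoid\<close>
| feq_coassoc: "feq S 1 3 (FCopy ;\<^sub>F (FCopy \<otimes>\<^sub>F FId 1)) (FCopy ;\<^sub>F (FId 1 \<otimes>\<^sub>F FCopy))"
| feq_counit_left: "feq S 1 1 (FCopy ;\<^sub>F (FCounit \<otimes>\<^sub>F FId 1)) (FId 1)"
| feq_counit_right: "feq S 1 1 (FCopy ;\<^sub>F (FId 1 \<otimes>\<^sub>F FCounit)) (FId 1)"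
| feq_cocomm: "feq S 1 2 (FCopy ;\<^sub>F FSym 1 1) FCopy"
  \<comment> \<open>Frobenius and special laws\<close>
| feq_frobenius_left: "feq S 2 2 ((FCopy \<otimes>\<^sub>F FId 1) ;\<^sub>F (FId 1 \<otimes>\<^sub>F FMerge)) (FMerge ;\<^sub>F FCopy)"
| feq_frobenius_right: "feq S 2 2 ((FId 1 \<otimes>\<^sub>F FCopy) ;\<^sub>F (FMerge \<otimes>\<^sub>F FId 1)) (FMerge ;\<^sub>F FCopy)"
| feq_special: "feq S 1 1 (FCopy ;\<^sub>F FMerge) (FId 1)"

definition fmorphism :: "'g msig \<Rightarrow> nat \<Rightarrow> nat \<Rightarrow> 'g fterm \<Rightarrow> 'g fterm set" where
  "fmorphism S m n t = {t'. feq S m n t t'}"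

text \<open>The Frobenius structure on the object \<open>x\<close>, built from that on the object \<open>1\<close>.\<close>

primrec merges :: "nat \<Rightarrow> 'g fterm" where
  "merges 0 = FId 0"
| "merges (Suc x) = (FId x \<otimes>\<^sub>F FSym 1 x \<otimes>\<^sub>F FId 1) ;\<^sub>F (merges x \<otimes>\<^sub>F FMerge)"

primrec units :: "nat \<Rightarrow> 'g fterm" where
  "units 0 = FId 0"
| "units (Suc x) = units x \<otimes>\<^sub>F FUnit"

primrec copies :: "nat \<Rightarrow> 'g fterm" where
  "copies 0 = FId 0"
| "copies (Suc x) = (copies x \<otimes>\<^sub>F FCopy) ;\<^sub>F (FId x \<otimes>\<^sub>F FSym x 1 \<otimes>\<^sub>F FId 1)"

primrec counits :: "nat \<Rightarrow> 'g fterm" where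
  "counits 0 = FId 0"
| "counits (Suc x) = counits x \<otimes>\<^sub>F FCounit"

definition cup :: "nat \<Rightarrow> 'g fterm" where
  "cup x = units x ;\<^sub>F copies x"

definition cap :: "nat \<Rightarrow> 'g fterm" where
  "cap x = merges x ;\<^sub>F counits x"

definition canonical_trace :: "nat \<Rightarrow> nat \<Rightarrow> nat \<Rightarrow> 'g fterm \<Rightarrow> 'g fterm" where
  "canonical_trace x m n h = (cup x \<otimes>\<^sub>F FId m) ;\<^sub>F (FId x \<otimes>\<^sub>F h) ;\<^sub>F (cap x \<otimes>\<^sub>F FId n)"

text \<open>The copairing of the functors \<open>\<I>\<close> and \<open>\<C>\<close>, on terms.\<close>

primrec IC :: "'g tterm \<Rightarrow> 'g fterm" where
  "IC (TGen \<phi>) = FGen \<phi>"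
| "IC (TId n) = FId n"
| "IC (TSym m n) = FSym m n"
| "IC (s ;\<^sub>T t) = IC s ;\<^sub>F IC t"
| "IC (s \<otimes>\<^sub>T t) = IC s \<otimes>\<^sub>F IC t"
| "IC (TTr x m n t) = canonical_trace x m n (IC t)"
| "IC TCopy = FCopy"
| "IC TDiscard = FCounit"

text \<open>For \<open>t : m \<rightarrow> n\<close>, this is a term \<open>0 \<rightarrow> m + n\<close>.\<close>

definition fold_term :: "nat \<Rightarrow> 'g fterm \<Rightarrow> 'g fterm" where
  "fold_term m t = cup m ;\<^sub>F (FId m \<otimes>\<^sub>F t)"


section \<open>Labelled hypergraphs\<close>

text \<open>
  Vertices and hyperedges are drawn from an arbitrary type \<open>'u\<close>, required to be infinite in the
  main statement so that it contains a copy of every finite hypergraph and is closed under the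
  pushouts below. The components \<open>F\<^bsub>k,l\<^esub>\<close> are the hyperedges with a source list of
  length \<open>k\<close> and a target list of length \<open>l\<close>; the \<open>i\<close>-th source map sends \<open>e\<close> to
  \<open>src F e ! i\<close>. The values of \<open>lab\<close>, \<open>src\<close> and \<open>tgt\<close> outside \<open>edges\<close> are irrelevant.
\<close>

record ('g, 'u) hgraph =
  verts :: "'u set"
  edges :: "'u set"
  lab :: "'u \<Rightarrow> 'g"
  src :: "'u \<Rightarrow> 'u list"
  tgt :: "'u \<Rightarrow> 'u list"

definition hypergraph :: "'g msig \<Rightarrow> ('g, 'u) hgraph \<Rightarrow> bool" where
  "hypergraph S F \<longleftrightarrow> (\<forall>e \<in> edges F.
     lab F e \<in> gens S \<and>
     length (src F e) = arity S (lab F e) \<and> set (src F e) \<subseteq> verts F \<and>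
     length (tgt F e) = coarity S (lab F e) \<and> set (tgt F e) \<subseteq> verts F)"

type_synonym 'u hmap = "('u \<Rightarrow> 'u) \<times> ('u \<Rightarrow> 'u)"

definition hmor :: "('g, 'u) hgraph \<Rightarrow> ('g, 'u) hgraph \<Rightarrow> 'u hmap \<Rightarrow> bool" where
  "hmor F G h \<longleftrightarrow>
     fst h ` verts F \<subseteq> verts G \<and> snd h ` edges F \<subseteq> edges G \<and>
     (\<forall>e \<in> edges F. lab G (snd h e) = lab F e \<and>
        src G (snd h e) = map (fst h) (src F e) \<and> tgt G (snd h e) = map (fst h) (tgt F e))"

definition hcomp :: "'u hmap \<Rightarrow> 'u hmap \<Rightarrow> 'u hmap" where
  "hcomp k h = (fst k \<circ> fst h, snd k \<circ> snd h)"

definition heq_on :: "('g, 'u) hgraph \<Rightarrow> 'u hmap \<Rightarrow> 'u hmap \<Rightarrow> bool" where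
  "heq_on F h k \<longleftrightarrow> (\<forall>v \<in> verts F. fst h v = fst k v) \<and> (\<forall>e \<in> edges F. snd h e = snd k e)"

text \<open>
  A morphism from the discrete hypergraph \<open>n\<close> to \<open>F\<close> is the list of length \<open>n\<close> of the images of
  the \<open>n\<close> vertices. Thus the copairing of \<open>a\<^sub>1 : i \<rightarrow> F\<close> and \<open>a\<^sub>2 : j \<rightarrow> F\<close> is \<open>a\<^sub>1 @ a\<^sub>2\<close>, and
  postcomposition with \<open>h\<close> is \<open>map (fst h)\<close>.
\<close>

definition discrete_mor :: "nat \<Rightarrow> ('g, 'u) hgraph \<Rightarrow> 'u list \<Rightarrow> bool" where
  "discrete_mor n F a \<longleftrightarrow> length a = n \<and> set a \<subseteq> verts F"

text \<open>
  \<open>is_pushout S n a c L C G p q\<close>: for \<open>a : n \<rightarrow> L\<close> and \<open>c : n \<rightarrow> C\<close>, the square completed by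
  \<open>p : L \<rightarrow> G\<close> and \<open>q : C \<rightarrow> G\<close> is a pushout.
\<close>

definition is_pushout :: "'g msig \<Rightarrow> nat \<Rightarrow> 'u list \<Rightarrow> 'u list \<Rightarrow> ('g, 'u) hgraph \<Rightarrow> ('g, 'u) hgraph \<Rightarrow>
    ('g, 'u) hgraph \<Rightarrow> 'u hmap \<Rightarrow> 'u hmap \<Rightarrow> bool" where
  "is_pushout S n a c L C G p q \<longleftrightarrow>
     hypergraph S L \<and> hypergraph S C \<and> hypergraph S G \<and>
     discrete_mor n L a \<and> discrete_mor n C c \<and> hmor L G p \<and> hmor C G q \<and>
     map (fst p) a = map (fst q) c \<and>
     (\<forall>(K :: ('g, 'u) hgraph) p' q'.
        hypergraph S K \<and> hmor L K p' \<and> hmor C K q' \<and> map (fst p') a = map (fst q') c \<longrightarrow>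
        (\<exists>k. hmor G K k \<and> heq_on L (hcomp k p) p' \<and> heq_on C (hcomp k q) q' \<and>
           (\<forall>k'. hmor G K k' \<and> heq_on L (hcomp k' p) p' \<and> heq_on C (hcomp k' q) q'
              \<longrightarrow> heq_on G k' k)))"

definition is_disjoint_union :: "('g, 'u) hgraph \<Rightarrow> ('g, 'u) hgraph \<Rightarrow> ('g, 'u) hgraph \<Rightarrow>
    'u hmap \<Rightarrow> 'u hmap \<Rightarrow> bool" where
  "is_disjoint_union F F' H p p' \<longleftrightarrow> hmor F H p \<and> hmor F' H p' \<and>
     bij_betw (case_sum (fst p) (fst p')) (verts F <+> verts F') (verts H) \<and>
     bij_betw (case_sum (snd p) (snd p')) (edges F <+> edges F') (edges H)"


section \<open>Cospans with discrete feet\<close>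

text \<open>
  \<open>(F, f, g)\<close> stands for the cospan \<open>m \<rightarrow> F \<leftarrow> n\<close> with legs \<open>f\<close> and \<open>g\<close>. A morphism of the PROP of
  cospans is an isomorphism class of these; all sets of cospans below are such classes, since
  any distinct vertices, any pushout and any disjoint union are allowed.
\<close>

type_synonym ('g, 'u) cospan = "('g, 'u) hgraph \<times> 'u list \<times> 'u list"

definition discrete_on :: "('g, 'u) hgraph \<Rightarrow> 'u list \<Rightarrow> bool" where
  "discrete_on F vs \<longleftrightarrow> distinct vs \<and> verts F = set vs \<and> edges F = {}"

definition csp_gen :: "'g msig \<Rightarrow> 'g \<Rightarrow> ('g, 'u) cospan set" where
  "csp_gen S \<phi> = {(F, f, g). hypergraph S F \<and> distinct (f @ g) \<and> verts F = set (f @ g) \<and>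
     (\<exists>e. edges F = {e} \<and> lab F e = \<phi> \<and> src F e = f \<and> tgt F e = g)}"

definition csp_seq :: "'g msig \<Rightarrow> ('g, 'u) cospan set \<Rightarrow> ('g, 'u) cospan set \<Rightarrow> ('g, 'u) cospan set"
where
  "csp_seq S A B = {(H, map (fst p) f, map (fst p') g') | H p p' F f g F' f' g'.
     (F, f, g) \<in> A \<and> (F', f', g') \<in> B \<and> is_pushout S (length g) g f' F F' H p p'}"

definition csp_tens :: "'g msig \<Rightarrow> ('g, 'u) cospan set \<Rightarrow> ('g, 'u) cospan set \<Rightarrow> ('g, 'u) cospan set"
where
  "csp_tens S A B =
    {(H, map (fst p) f @ map (fst p') f', map (fst p) g @ map (fst p') g') | H p p' F f g F' f' g'.
     (F, f, g) \<in> A \<and> (F', f', g') \<in> B \<and> hypergraph S H \<and> is_disjoint_union F F' H p p'}"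

primrec interp :: "'g msig \<Rightarrow> 'g fterm \<Rightarrow> ('g, 'u) cospan set" where
  "interp S (FGen \<phi>) = csp_gen S \<phi>"
| "interp S (FId n) = {(F, vs, vs) | F vs. length vs = n \<and> discrete_on F vs}"
| "interp S (FSym m n) =
     {(F, vs @ ws, ws @ vs) | F vs ws. length vs = m \<and> length ws = n \<and> discrete_on F (vs @ ws)}"
| "interp S (s ;\<^sub>F t) = csp_seq S (interp S s) (interp S t)"
| "interp S (s \<otimes>\<^sub>F t) = csp_tens S (interp S s) (interp S t)"
| "interp S FMerge = {(F, [v, v], [v]) | F v. discrete_on F [v]}"
| "interp S FUnit = {(F, [], [v]) | F v. discrete_on F [v]}"
| "interp S FCopy = {(F, [v], [v, v]) | F v. discrete_on F [v]}"
| "interp S FCounit = {(F, [v], []) | F v. discrete_on F [v]}"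

text \<open>
  The interpretation of a morphism of SMC(S) + Frob. As \<open>interp\<close> is invariant under \<open>feq\<close>, the
  union is just the value of \<open>interp\<close> at any representative.
\<close>

definition sem :: "'g msig \<Rightarrow> 'g fterm set \<Rightarrow> ('g, 'u) cospan set" where
  "sem S X = (\<Union>t \<in> X. interp S t)"


section \<open>Partial left-monogamy\<close>

text \<open>Counted in \<open>enat\<close>, since \<open>card\<close> would assign in-degree \<open>0\<close> to an infinite set.\<close>

definition in_degree :: "('g, 'u) hgraph \<Rightarrow> 'u \<Rightarrow> enat" where
  "in_degree F v =
     (let A = {(e, j). e \<in> edges F \<and> j < length (tgt F e) \<and> v = tgt F e ! j}
      in if finite A then enat (card A) else \<infinity>)"

fun partial_left_monogamous :: "('g, 'u) cospan \<Rightarrow> bool" where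
  "partial_left_monogamous (F, f, g) \<longleftrightarrow> distinct f \<and>
     (\<forall>v \<in> verts F. if v \<in> set f then in_degree F v = 0 else in_degree F v \<in> {0, 1})"


section \<open>Traced comonoid DPO rewriting\<close>

text \<open>\<open>(i, j, L, a, b, R)\<close> stands for the rule \<open>L \<leftarrow> i + j \<rightarrow> R\<close> with legs \<open>a\<close> and \<open>b\<close>.\<close>

type_synonym ('g, 'u) dpo_rule =
  "nat \<times> nat \<times> ('g, 'u) hgraph \<times> 'u list \<times> 'u list \<times> ('g, 'u) hgraph"

definition dpo_rules ::
    "'g msig \<Rightarrow> ('g tterm \<times> 'g tterm) set \<Rightarrow> ('g, 'u) dpo_rule set" where
  "dpo_rules S \<R> = {(i, j, L, a\<^sub>1 @ a\<^sub>2, b\<^sub>1 @ b\<^sub>2, R) | i j L a\<^sub>1 a\<^sub>2 b\<^sub>1 b\<^sub>2 R.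
     \<exists>l r. (l, r) \<in> \<R> \<and> ttyped S l i j \<and> ttyped S r i j \<and>
       (L, a\<^sub>1, a\<^sub>2) \<in> sem S (fmorphism S i j (IC l)) \<and>
       (R, b\<^sub>1, b\<^sub>2) \<in> sem S (fmorphism S i j (IC r))}"

text \<open>\<open>(G, x)\<close> is a hypergraph with interface \<open>x : m + n \<rightarrow> G\<close>.\<close>

type_synonym ('g, 'u) ihgraph = "('g, 'u) hgraph \<times> 'u list"

fun dpo_step :: "'g msig \<Rightarrow> ('g, 'u) dpo_rule set \<Rightarrow> nat \<Rightarrow> nat \<Rightarrow>
    ('g, 'u) ihgraph \<Rightarrow> ('g, 'u) ihgraph \<Rightarrow> bool" where
  "dpo_step S Rs m n (G, x) (H, y) \<longleftrightarrow>
     (\<exists>i j L a b R. (i, j, L, a, b, R) \<in> Rs \<and>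
       (\<exists>C c\<^sub>1 c\<^sub>2 d\<^sub>1 d\<^sub>2 p q p' q'.
          discrete_mor i C c\<^sub>1 \<and> discrete_mor j C c\<^sub>2 \<and>
          discrete_mor m C d\<^sub>1 \<and> discrete_mor n C d\<^sub>2 \<and>
          is_pushout S (i + j) a (c\<^sub>1 @ c\<^sub>2) L C G p q \<and>
          is_pushout S (i + j) b (c\<^sub>1 @ c\<^sub>2) R C H p' q' \<and>
          x = map (fst q) (d\<^sub>1 @ d\<^sub>2) \<and> y = map (fst q') (d\<^sub>1 @ d\<^sub>2) \<and>
          distinct c\<^sub>2 \<and> partial_left_monogamous (C, c\<^sub>2 @ d\<^sub>1, c\<^sub>1 @ d\<^sub>2)))"

text \<open>
  For \<open>t : m \<rightarrow> n\<close>, the interpretation of its folding, a cospan \<open>0 \<rightarrow> F \<leftarrow> m + n\<close>, read as a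
  hypergraph with interface (an isomorphism class thereof).
\<close>

definition folded :: "'g msig \<Rightarrow> nat \<Rightarrow> nat \<Rightarrow> 'g fterm \<Rightarrow> ('g, 'u) ihgraph set" where
  "folded S m n t = {(F, x). (F, [], x) \<in> sem S (fmorphism S 0 (m + n) (fold_term m t))}"

text \<open>
  The rewriting relation is invariant under isomorphism on both sides, so on isomorphism classes
  it is tested on representatives.
\<close>

definition dpo_rewrite :: "'g msig \<Rightarrow> ('g, 'u) dpo_rule set \<Rightarrow> nat \<Rightarrow> nat \<Rightarrow>
    ('g, 'u) ihgraph set \<Rightarrow> ('g, 'u) ihgraph set \<Rightarrow> bool" where
  "dpo_rewrite S Rs m n \<G> \<H> \<longleftrightarrow> (\<exists>G \<in> \<G>. \<exists>H \<in> \<H>. dpo_step S Rs m n G H)"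

end

theory Submission
  imports Defs "HOL-Library.Multiset" "HOL-Library.FuncSet"
begin

text \<open>
  Soundness of the graph interpretation is obtained by counting: a finite test hypergraph \<open>K\<close> turns
  a term \<open>m \<rightarrow> n\<close> into a matrix of natural numbers indexed by \<open>m\<close>- and \<open>n\<close>-tuples of vertices, with
  matrix product as composition, Kronecker product as tensor and partial trace as trace, so that
  every axiom becomes an identity of finite sums. The universal property of pushouts says that the
  entries count homomorphisms from the interpreting cospan into \<open>K\<close>, and by Lovasz's theorem these
  numbers determine a finite cospan up to isomorphism.

  Conversely, every traced comonoid term equals a trace of a row of generators followed by a wiring
  made of copies, discards and symmetries, where \<open>Tr\<^sup>1(copy) : 0 \<rightarrow> 1\<close> counts as one more generator.
  Such a normal form is the same thing as a partial left-monogamous cospan with an enumeration of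
  its hyperedges and of its vertices that are neither inputs nor targets; permuting the enumeration
  is an instance of sliding. Hence partial left-monogamous cospans are exactly the interpretations
  of traced terms, and isomorphic ones come from equal terms. A traced left-boundary complement
  is therefore a context \<open>c\<close>, and the pushout along it interprets \<open>Tr\<^sup>i((l \<otimes> id\<^sub>m) ; c)\<close>.
\<close>

section \<open>The quotient of traced terms\<close>

text \<open>The obstacle is that cospans are given only up to isomorphism: checking the PROP and
  trace axioms on them directly would mean building comparison isomorphisms of iterated pushouts.
  Matrix entries are plain numbers, and only the universal property of a pushout enters them; the
  same device makes \<open>sem\<close> independent of the representative. Lovasz's theorem needs
  finite hypergraphs, whereas a rewriting step may offer any complement \<open>C\<close>; its
  finiteness is recovered from that of \<open>G\<close>. A closed loop does not disappear:
  \<open>Tr\<^sup>1(copy)\<close> followed by discarding counts the vertices of the test hypergraph,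
  so it is not the empty diagram, and a vertex without producer needs a block of its own. No axiom
  lets generators commute with copying, hence the cartesian calculus of projections is confined to
  wirings. The legs \<open>c\<^sub>2, d\<^sub>1\<close> and \<open>c\<^sub>1, d\<^sub>2\<close> are
  ordered as the ends of the context \<open>c : j + m \<rightarrow> i + n\<close>, whose first
  inputs leave the rule side and whose first outputs re-enter it through the trace.\<close>

lemma ttyped_iff [simp]:
  "ttyped S (TGen \<phi>) m n \<longleftrightarrow> \<phi> \<in> gens S \<and> m = arity S \<phi> \<and> n = coarity S \<phi>"
  "ttyped S (TId k) m n \<longleftrightarrow> m = k \<and> n = k"
  "ttyped S (TSym i j) m n \<longleftrightarrow> m = i + j \<and> n = j + i"
  "ttyped S (s ;\<^sub>T t) m n \<longleftrightarrow> (\<exists>k. ttyped S s m k \<and> ttyped S t k n)"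
  "ttyped S (s \<otimes>\<^sub>T t) m n \<longleftrightarrow>
     (\<exists>i j i' j'. ttyped S s i j \<and> ttyped S t i' j' \<and> m = i + i' \<and> n = j + j')"
  "ttyped S (TTr x i j t) m n \<longleftrightarrow> m = i \<and> n = j \<and> ttyped S t (x + m) (x + n)"
  "ttyped S TCopy m n \<longleftrightarrow> m = 1 \<and> n = 2"
  "ttyped S TDiscard m n \<longleftrightarrow> m = 1 \<and> n = 0"
  by ((subst ttyped.simps, force)+)

lemma teq_typed: "teq S m n s t \<Longrightarrow> ttyped S s m n \<and> ttyped S t m n"
proof (induction rule: teq.induct)
qed (simp_all, (metis add.assoc add.commute add.left_commute)+)

text \<open>
  Source, target and the set of all equal terms: \<open>teq\<close> becomes equality of the logic.
\<close>

type_synonym 'g mor = "nat \<times> nat \<times> 'g tterm set"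

abbreviation dom :: "'g mor \<Rightarrow> nat" where "dom f \<equiv> fst f"
abbreviation cod :: "'g mor \<Rightarrow> nat" where "cod f \<equiv> fst (snd f)"

locale signature =
  fixes S :: "'g msig"
begin

definition cls :: "nat \<Rightarrow> nat \<Rightarrow> 'g tterm \<Rightarrow> 'g mor" where
  "cls m n t = (m, n, {t'. teq S m n t t'})"

text \<open>Operations act on chosen representatives; the congruence rules of \<open>teq\<close>
  make the choice irrelevant, which is the content of \<open>cls_comp\<close>,
  \<open>cls_tens\<close> and \<open>cls_Tr\<close>.\<close>

definition rep :: "'g mor \<Rightarrow> 'g tterm" where
  "rep f = (SOME t. t \<in> snd (snd f))"

definition arr :: "'g mor \<Rightarrow> bool" where
  "arr f \<longleftrightarrow> (\<exists>m n t. ttyped S t m n \<and> f = cls m n t)"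

definition comp :: "'g mor \<Rightarrow> 'g mor \<Rightarrow> 'g mor" (infixl "\<cdot>" 60) where
  "f \<cdot> g = cls (dom f) (cod g) (rep f ;\<^sub>T rep g)"

definition tens :: "'g mor \<Rightarrow> 'g mor \<Rightarrow> 'g mor" (infixl "\<otimes>" 70) where
  "f \<otimes> g = cls (dom f + dom g) (cod f + cod g) (rep f \<otimes>\<^sub>T rep g)"

definition Idn :: "nat \<Rightarrow> 'g mor" where "Idn n = cls n n (TId n)"
definition Sym :: "nat \<Rightarrow> nat \<Rightarrow> 'g mor" where "Sym m n = cls (m + n) (n + m) (TSym m n)"
text \<open>The widths are recovered by truncated subtraction, so the value is meaningful for
  \<open>x \<le> dom f\<close> and \<open>x \<le> cod f\<close>, the conditions in
  \<open>arr_simps\<close>.\<close>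

definition Tr :: "nat \<Rightarrow> 'g mor \<Rightarrow> 'g mor" where
  "Tr x f = cls (dom f - x) (cod f - x) (TTr x (dom f - x) (cod f - x) (rep f))"
definition Copy :: "'g mor" where "Copy = cls 1 2 TCopy"
definition Disc :: "'g mor" where "Disc = cls 1 0 TDiscard"
definition Gen :: "'g \<Rightarrow> 'g mor" where "Gen \<phi> = cls (arity S \<phi>) (coarity S \<phi>) (TGen \<phi>)"

lemma dom_cls [simp]: "dom (cls m n t) = m" and cod_cls [simp]: "cod (cls m n t) = n"
  by (simp_all add: cls_def)

lemma arr_cls: "ttyped S t m n \<Longrightarrow> arr (cls m n t)"
  by (auto simp: arr_def)

lemma cls_eqI: "teq S m n s t \<Longrightarrow> cls m n s = cls m n t"
  by (auto simp: cls_def intro: teq_trans teq_sym)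

lemma cls_eqD: "cls m n s = cls m n t \<Longrightarrow> ttyped S t m n \<Longrightarrow> teq S m n s t"
  by (auto simp: cls_def intro: teq_refl)

lemma rep_cls: "ttyped S t m n \<Longrightarrow> teq S m n t (rep (cls m n t))"
  unfolding rep_def cls_def by (simp, rule someI, rule teq_refl)

lemma rep_typed: "arr f \<Longrightarrow> ttyped S (rep f) (dom f) (cod f)"
  unfolding arr_def using rep_cls teq_typed by fastforce

lemma cls_rep: "arr f \<Longrightarrow> f = cls (dom f) (cod f) (rep f)"
  by (auto simp: arr_def intro!: cls_eqI rep_cls)

lemma arr_cases:
  assumes "arr f" obtains t where "ttyped S t (dom f) (cod f)" "f = cls (dom f) (cod f) t"
  using assms rep_typed cls_rep by blast

lemma cls_comp: "ttyped S s l m \<Longrightarrow> ttyped S t m n \<Longrightarrow> cls l m s \<cdot> cls m n t = cls l n (s ;\<^sub>T t)"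
  unfolding comp_def by (auto intro!: cls_eqI teq_Seq rep_cls intro: teq_sym)

lemma cls_tens: "ttyped S s m n \<Longrightarrow> ttyped S t m' n' \<Longrightarrow>
    cls m n s \<otimes> cls m' n' t = cls (m + m') (n + n') (s \<otimes>\<^sub>T t)"
  unfolding tens_def by (auto intro!: cls_eqI teq_Tens rep_cls intro: teq_sym)

lemma cls_Tr: "ttyped S t (x + m) (x + n) \<Longrightarrow> Tr x (cls (x + m) (x + n) t) = cls m n (TTr x m n t)"
  unfolding Tr_def by (auto intro!: cls_eqI teq_Tr rep_cls intro: teq_sym)

text \<open>Free of \<open>arr\<close> hypotheses, since \<open>cls\<close> stores both ends
  explicitly. The simplifier can therefore settle the width conditions of later equations by
  arithmetic.\<close>

lemma dom_simps [simp]: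
  "dom (f \<cdot> g) = dom f" "dom (f \<otimes> g) = dom f + dom g" "dom (Idn n) = n" "dom (Sym m n) = m + n"
  "dom (Tr x f) = dom f - x" "dom Copy = Suc 0" "dom Disc = Suc 0" "dom (Gen \<phi>) = arity S \<phi>"
  by (simp_all add: comp_def tens_def Idn_def Sym_def Tr_def Copy_def Disc_def Gen_def)

lemma cod_simps [simp]:
  "cod (f \<cdot> g) = cod g" "cod (f \<otimes> g) = cod f + cod g" "cod (Idn n) = n" "cod (Sym m n) = n + m"
  "cod (Tr x f) = cod f - x" "cod Copy = 2" "cod Disc = 0" "cod (Gen \<phi>) = coarity S \<phi>"
  by (simp_all add: comp_def tens_def Idn_def Sym_def Tr_def Copy_def Disc_def Gen_def)

lemma arr_simps [simp]:
  "arr f \<Longrightarrow> arr g \<Longrightarrow> cod f = dom g \<Longrightarrow> arr (f \<cdot> g)"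
  "arr f \<Longrightarrow> arr g \<Longrightarrow> arr (f \<otimes> g)"
  "arr (Idn n)" "arr (Sym m n)"
  "arr f \<Longrightarrow> x \<le> dom f \<Longrightarrow> x \<le> cod f \<Longrightarrow> arr (Tr x f)"
  "arr Copy" "arr Disc"
  "\<phi> \<in> gens S \<Longrightarrow> arr (Gen \<phi>)"
  unfolding comp_def tens_def Idn_def Sym_def Tr_def Copy_def Disc_def Gen_def
  by (auto intro!: arr_cls dest: rep_typed) (metis rep_typed)+

lemma arrE:
  assumes "arr f" "dom f = m" "cod f = n"
  obtains t where "ttyped S t m n" "f = cls m n t"
  using assms arr_cases by metis

text \<open>Pattern for the whole list of axioms: morphisms are replaced by classes of terms, the
  operations are evaluated on classes, and one constructor of \<open>teq\<close> identifies the
  results. As a simplification rule it nests composites to the right.\<close>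

lemma comp_assoc [simp]:
  assumes "arr f" "arr g" "arr h" "cod f = dom g" "cod g = dom h"
  shows "f \<cdot> g \<cdot> h = f \<cdot> (g \<cdot> h)"
proof -
  obtain s where s: "ttyped S s (dom f) (dom g)" "f = cls (dom f) (dom g) s" using assms by (auto elim: arrE)
  obtain t where t: "ttyped S t (dom g) (dom h)" "g = cls (dom g) (dom h) t" using assms by (auto elim: arrE)
  obtain u where u: "ttyped S u (dom h) (cod h)" "h = cls (dom h) (cod h) u" using assms by (auto elim: arrE)
  have st: "ttyped S (s ;\<^sub>T t) (dom f) (dom h)" and tu: "ttyped S (t ;\<^sub>T u) (dom g) (cod h)"
    using s(1) t(1) u(1) by auto
  show ?thesis
    by (subst (1 2) s(2), subst (1 2) t(2), subst (1 2) u(2))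
      (simp only: cls_comp[OF s(1) t(1)] cls_comp[OF t(1) u(1)] cls_comp[OF st u(1)] cls_comp[OF s(1) tu]
        cls_eqI[OF teq_seq_assoc[OF s(1) t(1) u(1)]])
qed

lemma comp_Idn_left [simp]: assumes "arr f" "m = dom f" shows "Idn m \<cdot> f = f"
proof -
  obtain t where t: "ttyped S t m (cod f)" "f = cls m (cod f) t" using assms by (auto elim: arrE)
  have i: "ttyped S (TId m) m m" by simp
  show ?thesis unfolding Idn_def by (subst (1 2) t(2))
     (simp only: cls_comp[OF i t(1)] cls_eqI[OF teq_id_left[OF t(1)]])
qed

lemma comp_Idn_right [simp]: assumes "arr f" "n = cod f" shows "f \<cdot> Idn n = f"
proof -
  obtain t where t: "ttyped S t (dom f) n" "f = cls (dom f) n t" using assms by (auto elim: arrE)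
  have i: "ttyped S (TId n) n n" by simp
  show ?thesis unfolding Idn_def by (subst (1 2) t(2))
     (simp only: cls_comp[OF t(1) i] cls_eqI[OF teq_id_right[OF t(1)]])
qed

lemma tens_Idn [simp]: "Idn m \<otimes> Idn n = Idn (m + n)"
proof -
  have i: "ttyped S (TId k) k k" for k by simp
  show ?thesis unfolding Idn_def by (simp only: cls_tens[OF i i] cls_eqI[OF teq_tens_id])
qed

lemma tens_Idn0 [simp]:
  assumes "arr f" shows "Idn 0 \<otimes> f = f" "f \<otimes> Idn 0 = f"
proof -
  obtain t where t: "ttyped S t (dom f) (cod f)" "f = cls (dom f) (cod f) t" using assms by (auto elim: arrE)
  have i: "ttyped S (TId 0) 0 0" by simp
  show "Idn 0 \<otimes> f = f" unfolding Idn_def by (subst (1 2) t(2))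
     (simp only: cls_tens[OF i t(1)] cls_eqI[OF teq_tens_unit_left[OF t(1)]] add_0)
  show "f \<otimes> Idn 0 = f" unfolding Idn_def by (subst (1 2) t(2))
     (simp only: cls_tens[OF t(1) i] cls_eqI[OF teq_tens_unit_right[OF t(1)]] add_0_right)
qed

lemma tens_assoc [simp]: assumes "arr f" "arr g" "arr h" shows "f \<otimes> g \<otimes> h = f \<otimes> (g \<otimes> h)"
proof -
  obtain s where s: "ttyped S s (dom f) (cod f)" "f = cls (dom f) (cod f) s" using assms by (auto elim: arrE)
  obtain t where t: "ttyped S t (dom g) (cod g)" "g = cls (dom g) (cod g) t" using assms by (auto elim: arrE)
  obtain u where u: "ttyped S u (dom h) (cod h)" "h = cls (dom h) (cod h) u" using assms by (auto elim: arrE)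
  have st: "ttyped S (s \<otimes>\<^sub>T t) (dom f + dom g) (cod f + cod g)" and tu: "ttyped S (t \<otimes>\<^sub>T u) (dom g + dom h) (cod g + cod h)"
    using s(1) t(1) u(1) by (blast intro: ttyped.intros)+
  show ?thesis
    by (subst (1 2) s(2), subst (1 2) t(2), subst (1 2) u(2))
      (simp only: cls_tens[OF s(1) t(1)] cls_tens[OF t(1) u(1)] cls_tens[OF st u(1)] cls_tens[OF s(1) tu]
        cls_eqI[OF teq_tens_assoc[OF s(1) t(1) u(1)]] add.assoc[symmetric])
qed

lemma tens_comp [simp]:
  assumes "arr f" "arr g" "arr f'" "arr g'" "cod f = dom g" "cod f' = dom g'"
  shows "(f \<otimes> f') \<cdot> (g \<otimes> g') = (f \<cdot> g) \<otimes> (f' \<cdot> g')"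
proof -
  obtain s where s: "ttyped S s (dom f) (dom g)" "f = cls (dom f) (dom g) s" using assms by (auto elim: arrE)
  obtain t where t: "ttyped S t (dom g) (cod g)" "g = cls (dom g) (cod g) t" using assms by (auto elim: arrE)
  obtain s' where s': "ttyped S s' (dom f') (dom g')" "f' = cls (dom f') (dom g') s'" using assms by (auto elim: arrE)
  obtain t' where t': "ttyped S t' (dom g') (cod g')" "g' = cls (dom g') (cod g') t'" using assms by (auto elim: arrE)
  have 1: "ttyped S (s \<otimes>\<^sub>T s') (dom f + dom f') (dom g + dom g')" "ttyped S (t \<otimes>\<^sub>T t') (dom g + dom g') (cod g + cod g')"
    "ttyped S (s ;\<^sub>T t) (dom f) (cod g)" "ttyped S (s' ;\<^sub>T t') (dom f') (cod g')"
    using s(1) t(1) s'(1) t'(1) by (blast intro: ttyped.intros)+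
  show ?thesis
    by (subst (1 2) s(2), subst (1 2) t(2), subst (1 2) s'(2), subst (1 2) t'(2))
      (simp only: cls_tens[OF s(1) s'(1)] cls_tens[OF t(1) t'(1)] cls_comp[OF s(1) t(1)] cls_comp[OF s'(1) t'(1)]
       cls_comp[OF 1(1,2)] cls_tens[OF 1(3,4)] cls_eqI[OF teq_interchange[OF s(1) t(1) s'(1) t'(1)]])
qed

text \<open>The widths are variables tied by equations, so that the rule also unifies with numerals
  and sums that are not literally a \<open>dom\<close> or \<open>cod\<close>.\<close>

lemma Sym_nat:
  assumes "arr f" "arr g" "n = cod f" "n' = cod g" "m = dom f" "m' = dom g"
  shows "(f \<otimes> g) \<cdot> Sym n n' = Sym m m' \<cdot> (g \<otimes> f)"
proof -
  obtain s where s: "ttyped S s m n" "f = cls m n s" using arrE[of f m n] assms(1,3,5) by blast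
  obtain t where t: "ttyped S t m' n'" "g = cls m' n' t" using arrE[of g m' n'] assms(2,4,6) by blast
  have 1: "ttyped S (TSym i j) (i + j) (j + i)" for i j by simp
  show ?thesis unfolding Sym_def s(2) t(2)
    by (simp only: cls_tens[OF s(1) t(1)] cls_tens[OF t(1) s(1)]
      cls_comp[OF ttyped.intros(5)[OF s(1) t(1)] 1] cls_comp[OF 1 ttyped.intros(5)[OF t(1) s(1)]]
      cls_eqI[OF teq_sym_natural[OF s(1) t(1)]])
qed

lemma Sym_inv [simp]: "Sym m n \<cdot> Sym n m = Idn (m + n)"
  unfolding Sym_def Idn_def
  by (simp only: cls_comp[OF ttyped.intros(3) ttyped.intros(3)] cls_eqI[OF teq_sym_inverse])

lemma Sym_hex1: "Sym (m + n) p = (Idn m \<otimes> Sym n p) \<cdot> (Sym m p \<otimes> Idn n)"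
proof -
  have 1: "ttyped S (TId m \<otimes>\<^sub>T TSym n p) (m + n + p) (m + p + n)"
    unfolding add.assoc[of m] by (intro ttyped.intros)
  have 2: "ttyped S (TSym m p \<otimes>\<^sub>T TId n) (m + p + n) (p + m + n)"
    by (intro ttyped.intros)
  have 3: "Idn m \<otimes> Sym n p = cls (m + n + p) (m + p + n) (TId m \<otimes>\<^sub>T TSym n p)"
    unfolding Sym_def Idn_def by (simp only: cls_tens[OF ttyped.intros(2) ttyped.intros(3)] add.assoc)
  have 4: "Sym m p \<otimes> Idn n = cls (m + p + n) (p + m + n) (TSym m p \<otimes>\<^sub>T TId n)"
    unfolding Sym_def Idn_def by (simp only: cls_tens[OF ttyped.intros(3) ttyped.intros(2)] add.assoc)
  show ?thesis unfolding 3 4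
    by (simp only: cls_comp[OF 1 2] cls_eqI[OF teq_sym_hexagon, symmetric]) (simp add: Sym_def add.assoc)
qed

lemma Tr_tight:
  assumes "arr f" "arr g" "arr h" "dom g = x + cod f" "cod g = x + dom h"
  shows "Tr x ((Idn x \<otimes> f) \<cdot> g \<cdot> (Idn x \<otimes> h)) = f \<cdot> Tr x g \<cdot> h"
proof -
  obtain s where s: "ttyped S s (dom f) (cod f)" "f = cls (dom f) (cod f) s" using assms by (blast elim: arrE)
  obtain t where t: "ttyped S t (x + cod f) (x + dom h)" "g = cls (x + cod f) (x + dom h) t"
    using arrE[OF assms(2,4,5)] by blast
  obtain u where u: "ttyped S u (dom h) (cod h)" "h = cls (dom h) (cod h) u" using assms by (blast elim: arrE)
  have 1: "ttyped S (TId x \<otimes>\<^sub>T s) (x + dom f) (x + cod f)" "ttyped S (TId x \<otimes>\<^sub>T u) (x + dom h) (x + cod h)"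
    using s(1) u(1) by (auto intro: ttyped.intros)
  note 2 = ttyped.intros(4)[OF 1(1) t(1)] ttyped.intros(6)[OF t(1)]
  note 3 = ttyped.intros(4)[OF 2(1) 1(2)] ttyped.intros(4)[OF s(1) 2(2)]
  show ?thesis unfolding Idn_def
    by (subst (1 2) s(2), subst (1 2) t(2), subst (1 2) u(2))
     (simp only: cls_tens[OF ttyped.intros(2) s(1)] cls_tens[OF ttyped.intros(2) u(1)] cls_comp[OF 1(1) t(1)]
        cls_comp[OF 2(1) 1(2)] cls_Tr[OF t(1)] cls_comp[OF s(1) 2(2)] cls_comp[OF 3(2) u(1)] cls_Tr[OF 3(1)]
        cls_eqI[OF teq_tightening[OF s(1) t(1) u(1)]])
qed

lemma Tr_slide:
  assumes "arr f" "arr g" "dom f = cod g + m" "cod f = dom g + n" "x = cod g" "y = dom g"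
  shows "Tr x (f \<cdot> (g \<otimes> Idn n)) = Tr y ((g \<otimes> Idn m) \<cdot> f)"
proof -
  obtain s where s: "ttyped S s y x" "g = cls y x s" using arrE[of g y x] assms(2,5,6) by blast
  obtain t where t: "ttyped S t (x + m) (y + n)" "f = cls (x + m) (y + n) t"
    using arrE[of f "x + m" "y + n"] assms by blast
  note 1 = ttyped.intros(5)[OF s(1) ttyped.intros(2)]
  note 2 = ttyped.intros(4)[OF t(1) 1] ttyped.intros(4)[OF 1 t(1)]
  show ?thesis unfolding Idn_def unfolding s(2) t(2)
    by (simp only: cls_tens[OF s(1) ttyped.intros(2)] cls_comp[OF t(1) 1] cls_comp[OF 1 t(1)]
       cls_Tr[OF 2(1)] cls_Tr[OF 2(2)] cls_eqI[OF teq_sliding[OF t(1) s(1)]])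
qed

lemma Tr_0 [simp]: assumes "arr f" shows "Tr 0 f = f"
proof -
  obtain t where t: "ttyped S t (dom f) (cod f)" "f = cls (dom f) (cod f) t" using assms by (blast elim: arrE)
  have t': "ttyped S t (0 + dom f) (0 + cod f)" using t(1) by simp
  show ?thesis
    by (subst (1 2) t(2)) (simp only: cls_Tr[OF t', simplified] cls_eqI[OF teq_vanishing_zero[OF t(1)]])
qed

lemma Tr_Tr:
  assumes "arr f" "x + y \<le> dom f" "x + y \<le> cod f"
  shows "Tr y (Tr x f) = Tr (x + y) f"
proof -
  obtain m n where mn: "dom f = x + y + m" "cod f = x + y + n"
    using assms by (metis le_Suc_ex)
  obtain t where t: "ttyped S t (x + y + m) (x + y + n)" "f = cls (x + y + m) (x + y + n) t"
    using arrE[OF assms(1) mn] by blast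
  have t': "ttyped S t (x + (y + m)) (x + (y + n))" using t by (simp add: add.assoc)
  show ?thesis unfolding t(2)
    by (simp only: cls_Tr[OF t(1)] cls_eqI[OF teq_vanishing_plus[OF t(1)]])
      (simp only: add.assoc cls_Tr[OF t'] cls_Tr[OF ttyped.intros(6)[OF t']])
qed

lemma Tr_super:
  assumes "arr f" "x \<le> dom f" "x \<le> cod f"
  shows "Tr x (f \<otimes> Idn k) = Tr x f \<otimes> Idn k"
proof -
  obtain m n where mn: "dom f = x + m" "cod f = x + n"
    using assms by (metis le_Suc_ex)
  obtain t where t: "ttyped S t (x + m) (x + n)" "f = cls (x + m) (x + n) t"
    using arrE[OF assms(1) mn] by blast
  have t': "ttyped S (t \<otimes>\<^sub>T TId k) (x + (m + k)) (x + (n + k))"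
    using ttyped.intros(5)[OF t(1) ttyped.intros(2)[of S k]] by (simp only: add.assoc)
  show ?thesis unfolding Idn_def unfolding t(2)
    by (simp only: cls_Tr[OF t(1)] cls_tens[OF ttyped.intros(6)[OF t(1)] ttyped.intros(2)]
         cls_eqI[OF teq_superposing[OF t(1)], symmetric] cls_tens[OF t(1) ttyped.intros(2)])
      (simp only: add.assoc cls_Tr[OF t'])
qed

lemma Tr_yank: "Tr x (Sym x x) = Idn x"
  unfolding Idn_def Sym_def
  by (simp only: cls_Tr[OF ttyped.intros(3)] cls_eqI[OF teq_yanking])

lemma Copy_assoc: "Copy \<cdot> (Copy \<otimes> Idn 1) = Copy \<cdot> (Idn 1 \<otimes> Copy)"
proof -
  have e: "Suc (Suc 0) = (2::nat)" "Suc 2 = (3::nat)" by simp_all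
  have t: "ttyped S (TCopy \<otimes>\<^sub>T TId 1) 2 3" "ttyped S (TId 1 \<otimes>\<^sub>T TCopy) 2 3"
    using ttyped.intros(5)[OF ttyped.intros(7) ttyped.intros(2)[of S 1]]
      ttyped.intros(5)[OF ttyped.intros(2)[of S 1] ttyped.intros(7)] by (simp_all add: e del: ttyped_iff)
  have c: "Copy \<otimes> Idn 1 = cls 2 3 (TCopy \<otimes>\<^sub>T TId 1)" "Idn 1 \<otimes> Copy = cls 2 3 (TId 1 \<otimes>\<^sub>T TCopy)"
    unfolding Copy_def Idn_def
    using cls_tens[OF ttyped.intros(7) ttyped.intros(2)[of S 1]]
      cls_tens[OF ttyped.intros(2)[of S 1] ttyped.intros(7)] by (simp_all add: e)
  show ?thesis
    unfolding c unfolding Copy_def Idn_def cls_comp[OF ttyped.intros(7) t(1)] cls_comp[OF ttyped.intros(7) t(2)]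
    by (rule cls_eqI[OF teq_coassoc])
qed

lemma Copy_counit: "Copy \<cdot> (Disc \<otimes> Idn 1) = Idn 1" "Copy \<cdot> (Idn 1 \<otimes> Disc) = Idn 1"
proof -
  have e: "Suc (Suc 0) = (2::nat)" by simp_all
  have t: "ttyped S (TDiscard \<otimes>\<^sub>T TId 1) 2 1" "ttyped S (TId 1 \<otimes>\<^sub>T TDiscard) 2 1"
    using ttyped.intros(5)[OF ttyped.intros(8) ttyped.intros(2)[of S 1]]
      ttyped.intros(5)[OF ttyped.intros(2)[of S 1] ttyped.intros(8)] by (simp_all add: e del: ttyped_iff)
  have c: "Disc \<otimes> Idn 1 = cls 2 1 (TDiscard \<otimes>\<^sub>T TId 1)" "Idn 1 \<otimes> Disc = cls 2 1 (TId 1 \<otimes>\<^sub>T TDiscard)"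
    unfolding Disc_def Idn_def
    using cls_tens[OF ttyped.intros(8) ttyped.intros(2)[of S 1]]
      cls_tens[OF ttyped.intros(2)[of S 1] ttyped.intros(8)] by (simp_all add: e)
  show "Copy \<cdot> (Disc \<otimes> Idn 1) = Idn 1" "Copy \<cdot> (Idn 1 \<otimes> Disc) = Idn 1"
    unfolding c unfolding Copy_def Idn_def cls_comp[OF ttyped.intros(7) t(1)] cls_comp[OF ttyped.intros(7) t(2)]
    by (rule cls_eqI teq_counit_left teq_counit_right)+
qed

lemma Copy_comm: "Copy \<cdot> Sym 1 1 = Copy"
proof -
  have "ttyped S (TSym 1 1) 2 2" "Sym 1 1 = cls 2 2 (TSym 1 1)"
    by (simp_all add: Sym_def numeral_2_eq_2)
  then show ?thesis
    unfolding Copy_def using cls_comp[OF ttyped.intros(7)] cls_eqI[OF teq_cocomm] by simp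
qed

text \<open>The hexagon with two empty blocks makes \<open>Sym 0 n\<close> idempotent; being
  invertible, it is the identity.\<close>

lemma Sym_0 [simp]: "Sym 0 n = Idn n" "Sym n 0 = Idn n"
proof -
  have "Sym 0 n = Sym 0 n \<cdot> Sym 0 n" using Sym_hex1[of 0 0 n] by simp
  then have "Sym 0 n \<cdot> Sym n 0 = Sym 0 n \<cdot> Sym 0 n \<cdot> Sym n 0" by simp
  then show *: "Sym 0 n = Idn n" by simp
  then show "Sym n 0 = Idn n" using Sym_inv[of 0 n] by simp
qed

lemma tens_Idn_left [simp]: "arr f \<Longrightarrow> Idn a \<otimes> (Idn b \<otimes> f) = Idn (a + b) \<otimes> f"
  by (simp flip: tens_assoc)

text \<open>The right side, composed with \<open>Sym (m + n) p\<close>, cancels to an identity by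
  the other hexagon, so it must be the inverse symmetry.\<close>

lemma Sym_hex2: "Sym p (m + n) = (Sym p m \<otimes> Idn n) \<cdot> (Idn m \<otimes> Sym p n)"
proof -
  let ?h = "(Sym p m \<otimes> Idn n) \<cdot> (Idn m \<otimes> Sym p n)"
  have 1: "(Idn m \<otimes> Sym p n) \<cdot> (Idn m \<otimes> Sym n p) = Idn (m + p + n)" by (simp add: add.assoc)
  have "?h \<cdot> Sym (m + n) p = (Sym p m \<otimes> Idn n) \<cdot> (((Idn m \<otimes> Sym p n) \<cdot> (Idn m \<otimes> Sym n p)) \<cdot> (Sym m p \<otimes> Idn n))"
    by (simp add: Sym_hex1[of m n p] add_ac del: tens_comp)
  also have "\<dots> = Idn (p + m + n)" unfolding 1 by (simp add: add_ac)
  finally have "?h \<cdot> Sym (m + n) p = Idn (p + m + n)" .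
  then have "?h \<cdot> (Sym (m + n) p \<cdot> Sym p (m + n)) = Sym p (m + n)"
    by (subst comp_assoc[symmetric]) (simp_all add: add_ac)
  then show ?thesis by (simp add: add_ac)
qed

end

section \<open>Wirings of copies, discards and symmetries\<close>

context signature begin

section \<open>Copying and discarding on several wires\<close>

primrec dsc :: "nat \<Rightarrow> 'g mor" where
  "dsc 0 = Idn 0"
| "dsc (Suc n) = Disc \<otimes> dsc n"

text \<open>The outputs are two full copies in sequence: after copying wire by wire, the symmetry
  carries the second copy of the first wire behind the first copies of the others.\<close>

primrec cpy :: "nat \<Rightarrow> 'g mor" where
  "cpy 0 = Idn 0"
| "cpy (Suc n) = (Copy \<otimes> cpy n) \<cdot> (Idn 1 \<otimes> (Sym 1 n \<otimes> Idn n))"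

lemma dsc_simps [simp]: "arr (dsc n)" "dom (dsc n) = n" "cod (dsc n) = 0"
  by (induct n) simp_all

lemma cpy_simps [simp]: "cod (cpy n) = n + n" "dom (cpy n) = n" "arr (cpy n)"
proof -
  show "cod (cpy n) = n + n" "dom (cpy n) = n" for n by (induct n) simp_all
  then show "arr (cpy n)" by (induct n) simp_all
qed

lemma dsc_add: "dsc (m + n) = dsc m \<otimes> dsc n"
  by (induct m) simp_all

lemma whisker_right: "arr f \<Longrightarrow> arr g \<Longrightarrow> cod f = dom g \<Longrightarrow> (f \<cdot> g) \<otimes> Idn k = (f \<otimes> Idn k) \<cdot> (g \<otimes> Idn k)"
  and whisker_left: "arr f \<Longrightarrow> arr g \<Longrightarrow> cod f = dom g \<Longrightarrow> Idn k \<otimes> (f \<cdot> g) = (Idn k \<otimes> f) \<cdot> (Idn k \<otimes> g)"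
  by simp_all

text \<open>Whiskered hexagon: the trailing factor \<open>f\<close> lets it rewrite inside
  right-nested tensors.\<close>

lemma Sym_hex2w: "Sym p (m + n) \<otimes> f = (Sym p m \<otimes> Idn (n + dom f)) \<cdot> (Idn m \<otimes> (Sym p n \<otimes> f))" if "arr f"
proof -
  have "Sym p (m + n) \<otimes> f = ((Sym p m \<otimes> Idn n) \<cdot> (Idn m \<otimes> Sym p n)) \<otimes> (Idn (dom f) \<cdot> f)"
    using that by (simp add: Sym_hex2)
  also have "\<dots> = (Sym p m \<otimes> Idn n \<otimes> Idn (dom f)) \<cdot> (Idn m \<otimes> Sym p n \<otimes> f)"
    using that by (subst tens_comp) simp_all
  finally show ?thesis using that by simp
qed

text \<open>Induction on \<open>m\<close> leaves the same copying layer on both sides, so only two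
  permutations have to be compared; the two hexagons do that.\<close>

lemma cpy_add: "cpy (m + n) = (cpy m \<otimes> cpy n) \<cdot> (Idn m \<otimes> (Sym m n \<otimes> Idn n))"
proof (induct m)
  case (Suc m)
  let ?P = "Copy \<otimes> (cpy m \<otimes> cpy n)"
  \<comment> \<open>\<open>?Q1\<close> arises from the left side, \<open>?Q2\<close> from the right
    side; \<open>?R\<close> is their common form, in which two of the exchanges are performed in
    parallel.\<close>
  let ?Q1 = "(Idn (1 + m) \<otimes> Sym m n) \<cdot> (Sym 1 (m + n) \<otimes> Idn m)"
  let ?Q2 = "(Sym 1 m \<otimes> Idn (m + n)) \<cdot> (Idn m \<otimes> Sym (1 + m) n)"
  let ?R = "(Sym 1 m \<otimes> Sym m n) \<cdot> (Idn m \<otimes> (Sym 1 n \<otimes> Idn m))"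
  have 1: "?Q1 = ?R"
  proof -
    have "?Q1 = (Idn (1 + m) \<otimes> Sym m n) \<cdot> ((Sym 1 m \<otimes> Idn (n + m)) \<cdot> (Idn m \<otimes> (Sym 1 n \<otimes> Idn m)))"
      by (simp add: Sym_hex2w)
    also have "\<dots> = ((Idn (1 + m) \<otimes> Sym m n) \<cdot> (Sym 1 m \<otimes> Idn (n + m))) \<cdot> (Idn m \<otimes> (Sym 1 n \<otimes> Idn m))"
      by (subst comp_assoc) simp_all
    also have "(Idn (1 + m) \<otimes> Sym m n) \<cdot> (Sym 1 m \<otimes> Idn (n + m)) = Sym 1 m \<otimes> Sym m n"
      by simp
    finally show ?thesis .
  qed
  have 2: "?Q2 = ?R"
  proof -
    have "Idn m \<otimes> Sym (1 + m) n = (Idn (m + 1) \<otimes> Sym m n) \<cdot> (Idn m \<otimes> (Sym 1 n \<otimes> Idn m))"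
      by (subst Sym_hex1) (simp add: whisker_left del: tens_comp)
    then have "?Q2 = ((Sym 1 m \<otimes> Idn (m + n)) \<cdot> (Idn (m + 1) \<otimes> Sym m n)) \<cdot> (Idn m \<otimes> (Sym 1 n \<otimes> Idn m))"
      by (subst comp_assoc) simp_all
    also have "(Sym 1 m \<otimes> Idn (m + n)) \<cdot> (Idn (m + 1) \<otimes> Sym m n) = Sym 1 m \<otimes> Sym m n"
      by simp
    finally show ?thesis .
  qed
  have "Copy \<otimes> cpy (m + n) = ?P \<cdot> (Idn 2 \<otimes> (Idn m \<otimes> (Sym m n \<otimes> Idn n)))"
    unfolding Suc by (subst (2) tens_comp) simp_all
  then have "Copy \<otimes> cpy (m + n) = ?P \<cdot> (Idn (2 + m) \<otimes> (Sym m n \<otimes> Idn n))"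
    by (subst (asm) tens_Idn_left) simp_all
  then have "cpy (Suc m + n) = (?P \<cdot> (Idn (2 + m) \<otimes> (Sym m n \<otimes> Idn n))) \<cdot> (Idn 1 \<otimes> (Sym 1 (m + n) \<otimes> Idn (m + n)))"
    by simp
  also have "\<dots> = ?P \<cdot> ((Idn (2 + m) \<otimes> (Sym m n \<otimes> Idn n)) \<cdot> (Idn 1 \<otimes> (Sym 1 (m + n) \<otimes> Idn (m + n))))"
    by (subst comp_assoc) simp_all
  also have "(Idn (2 + m) \<otimes> (Sym m n \<otimes> Idn n)) \<cdot> (Idn 1 \<otimes> (Sym 1 (m + n) \<otimes> Idn (m + n))) = Idn 1 \<otimes> (?Q1 \<otimes> Idn n)"
    by (simp add: whisker_left whisker_right del: tens_comp)
  finally have L: "cpy (Suc m + n) = ?P \<cdot> (Idn 1 \<otimes> (?Q1 \<otimes> Idn n))" .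
  have "(cpy (Suc m) \<otimes> cpy n) \<cdot> (Idn (Suc m) \<otimes> (Sym (Suc m) n \<otimes> Idn n)) =
     (((Copy \<otimes> cpy m) \<otimes> cpy n) \<cdot> ((Idn 1 \<otimes> (Sym 1 m \<otimes> Idn m)) \<otimes> Idn (n + n))) \<cdot> (Idn (Suc m) \<otimes> (Sym (Suc m) n \<otimes> Idn n))"
    by (subst tens_comp) simp_all
  also have "\<dots> = ?P \<cdot> ((Idn 1 \<otimes> (Sym 1 m \<otimes> Idn (m + n + n))) \<cdot> (Idn (Suc m) \<otimes> (Sym (Suc m) n \<otimes> Idn n)))"
    by (simp del: tens_comp add: add.assoc)
  also have "(Idn 1 \<otimes> (Sym 1 m \<otimes> Idn (m + n + n))) \<cdot> (Idn (Suc m) \<otimes> (Sym (Suc m) n \<otimes> Idn n)) = Idn 1 \<otimes> (?Q2 \<otimes> Idn n)"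
    by (simp add: whisker_left whisker_right del: tens_comp)
  finally show ?case using L 1 2 by simp
qed simp

text \<open>The pairing of a cartesian category, although the ambient category is not cartesian:
  \<open>Cart_comp_pair\<close> moves precomposition inside for morphisms that commute with
  copying.\<close>

definition pair :: "'g mor \<Rightarrow> 'g mor \<Rightarrow> 'g mor" where
  "pair f g = cpy (dom f) \<cdot> (f \<otimes> g)"

lemma pair_simps [simp]:
  "dom (pair f g) = dom f" "cod (pair f g) = cod f + cod g"
  "arr f \<Longrightarrow> arr g \<Longrightarrow> dom f = dom g \<Longrightarrow> arr (pair f g)"
  by (simp_all add: pair_def)

text \<open>
  The morphisms that commute with copying and discarding. A wiring into \<open>n\<close> is such a morphism, and
  is determined by its composites with the \<open>n\<close> projections.
\<close>

definition Cart :: "'g mor \<Rightarrow> bool" where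
  "Cart h \<longleftrightarrow> arr h \<and> h \<cdot> cpy (cod h) = cpy (dom h) \<cdot> (h \<otimes> h) \<and> h \<cdot> dsc (cod h) = dsc (dom h)"

lemma Cart_arr [simp]: "Cart h \<Longrightarrow> arr h"
  by (simp add: Cart_def)

text \<open>Middle exchange: naturality of the symmetry, applied to the two inner factors
  only.\<close>

lemma tens_Sym_mid:
  assumes "arr f" "arr f'" "arr g" "arr g'"
    "k = cod f" "k' = cod f'" "l = cod g" "l' = cod g'"
  shows "(f \<otimes> (f' \<otimes> (g \<otimes> g'))) \<cdot> (Idn k \<otimes> (Sym k' l \<otimes> Idn l')) =
    (Idn (dom f) \<otimes> (Sym (dom f') (dom g) \<otimes> Idn (dom g'))) \<cdot> (f \<otimes> (g \<otimes> (f' \<otimes> g')))"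
proof -
  have "(f \<otimes> (f' \<otimes> (g \<otimes> g'))) \<cdot> (Idn k \<otimes> (Sym k' l \<otimes> Idn l')) = f \<otimes> (((f' \<otimes> g) \<cdot> Sym k' l) \<otimes> g')"
    using assms by (subst (2) tens_assoc[symmetric]) (simp_all del: tens_assoc)
  also have "\<dots> = f \<otimes> ((Sym (dom f') (dom g) \<cdot> (g \<otimes> f')) \<otimes> g')"
    using assms by (subst Sym_nat[where m = "dom f'" and m' = "dom g"]) simp_all
  also have "\<dots> = (Idn (dom f) \<otimes> (Sym (dom f') (dom g) \<otimes> Idn (dom g'))) \<cdot> (f \<otimes> ((g \<otimes> f') \<otimes> g'))"
    using assms by (simp del: tens_assoc)
  finally show ?thesis using assms by simp
qed

lemma Cart_comp: assumes "Cart f" "Cart g" "cod f = dom g" shows "Cart (f \<cdot> g)"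
proof -
  have 1: "f \<cdot> cpy (dom g) = cpy (dom f) \<cdot> (f \<otimes> f)" "g \<cdot> cpy (cod g) = cpy (dom g) \<cdot> (g \<otimes> g)"
    "f \<cdot> dsc (dom g) = dsc (dom f)" "g \<cdot> dsc (cod g) = dsc (dom g)" "arr f" "arr g"
    using assms by (auto simp: Cart_def)
  have "f \<cdot> g \<cdot> cpy (cod g) = f \<cdot> cpy (dom g) \<cdot> (g \<otimes> g)"
    using 1(2,5,6) assms(3) by simp
  also have "f \<cdot> cpy (dom g) = cpy (dom f) \<cdot> (f \<otimes> f)" by fact
  also have "\<dots> \<cdot> (g \<otimes> g) = cpy (dom f) \<cdot> ((f \<cdot> g) \<otimes> (f \<cdot> g))" using 1 assms by simp
  finally show ?thesis using 1 assms by (simp add: Cart_def)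
qed

text \<open>\<open>cpy_add\<close> splits the copying into two blocks, which \<open>f\<close> and
  \<open>g\<close> pass separately; \<open>tens_Sym_mid\<close> then moves them through the exchange
  in the middle.\<close>

lemma Cart_tens: assumes "Cart f" "Cart g" shows "Cart (f \<otimes> g)"
proof -
  have 1: "f \<cdot> cpy (cod f) = cpy (dom f) \<cdot> (f \<otimes> f)" "g \<cdot> cpy (cod g) = cpy (dom g) \<cdot> (g \<otimes> g)"
    "f \<cdot> dsc (cod f) = dsc (dom f)" "g \<cdot> dsc (cod g) = dsc (dom g)" "arr f" "arr g"
    using assms by (auto simp: Cart_def)
  have "(f \<otimes> g) \<cdot> cpy (cod f + cod g) = (f \<otimes> g) \<cdot> (cpy (cod f) \<otimes> cpy (cod g)) \<cdot> (Idn (cod f) \<otimes> (Sym (cod f) (cod g) \<otimes> Idn (cod g)))"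
    using 1(5,6) by (simp add: cpy_add del: tens_comp)
  also have "\<dots> = ((cpy (dom f) \<otimes> cpy (dom g)) \<cdot> (f \<otimes> (f \<otimes> (g \<otimes> g)))) \<cdot> (Idn (cod f) \<otimes> (Sym (cod f) (cod g) \<otimes> Idn (cod g)))"
  proof -
    have "(f \<otimes> g) \<cdot> (cpy (cod f) \<otimes> cpy (cod g)) = (cpy (dom f) \<otimes> cpy (dom g)) \<cdot> ((f \<otimes> f) \<otimes> (g \<otimes> g))"
      using 1 by (simp del: tens_assoc)
    moreover have "(f \<otimes> f) \<otimes> (g \<otimes> g) = f \<otimes> (f \<otimes> (g \<otimes> g))" using 1 by simp
    ultimately show ?thesis by simp
  qed
  also have "\<dots> = (cpy (dom f) \<otimes> cpy (dom g)) \<cdot> ((f \<otimes> (f \<otimes> (g \<otimes> g))) \<cdot> (Idn (cod f) \<otimes> (Sym (cod f) (cod g) \<otimes> Idn (cod g))))"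
    using 1 by (simp del: tens_comp)
  also have "\<dots> = (cpy (dom f) \<otimes> cpy (dom g)) \<cdot> (Idn (dom f) \<otimes> (Sym (dom f) (dom g) \<otimes> Idn (dom g)) \<cdot> (f \<otimes> (g \<otimes> (f \<otimes> g))))"
    using 1 by (subst tens_Sym_mid) simp_all
  also have "\<dots> = cpy (dom f + dom g) \<cdot> ((f \<otimes> g) \<otimes> (f \<otimes> g))"
    using 1 by (simp add: cpy_add del: tens_comp)
  finally have 2: "(f \<otimes> g) \<cdot> cpy (cod f + cod g) = cpy (dom f + dom g) \<cdot> ((f \<otimes> g) \<otimes> (f \<otimes> g))" .
  have 3: "(f \<otimes> g) \<cdot> dsc (cod f + cod g) = dsc (dom f + dom g)"
    using 1 by (simp add: dsc_add)
  show ?thesis unfolding Cart_def using 2 3 1(5,6) by (simp only: dom_simps cod_simps arr_simps simp_thms)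
qed

lemma Cart_Idn [simp]: "Cart (Idn n)"
  by (simp add: Cart_def)

lemma cpy_1 [simp]: "cpy (Suc 0) = Copy"
  by simp

lemma dsc_1 [simp]: "dsc (Suc 0) = Disc"
  by simp

lemma Copy_Disc_Disc: "Copy \<cdot> (Disc \<otimes> Disc) = Disc"
proof -
  have "Copy \<cdot> (Disc \<otimes> Disc) = Copy \<cdot> ((Disc \<otimes> Idn 1) \<cdot> (Idn 0 \<otimes> Disc))"
    by (subst tens_comp) simp_all
  also have "\<dots> = Copy \<cdot> (Disc \<otimes> Idn 1) \<cdot> (Idn 0 \<otimes> Disc)"
    by (rule comp_assoc[symmetric]) simp_all
  also have "Copy \<cdot> (Disc \<otimes> Idn 1) = Idn 1" by (rule Copy_counit)
  finally show ?thesis by simp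
qed

lemma Cart_Disc [simp]: "Cart Disc"
  by (simp add: Cart_def Copy_Disc_Disc)

text \<open>Coassociativity rearranges the four-fold copy so that the two inner outputs come from
  one \<open>Copy\<close>; cocommutativity then absorbs the exchange contained in
  \<open>cpy 2\<close>.\<close>

lemma Cart_Copy [simp]: "Cart Copy"
proof -
  have "cpy 2 = (cpy 1 \<otimes> cpy 1) \<cdot> (Idn 1 \<otimes> (Sym 1 1 \<otimes> Idn 1))"
    using cpy_add[of 1 1] by (simp only: one_add_one)
  then have 1: "cpy 2 = (Copy \<otimes> Copy) \<cdot> (Idn 1 \<otimes> (Sym 1 1 \<otimes> Idn 1))" by (simp del: cpy.simps)
  have "Copy \<cdot> (Copy \<otimes> Copy) = Copy \<cdot> (Copy \<otimes> Idn 1) \<cdot> (Idn 2 \<otimes> Copy)"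
    by simp
  also have "\<dots> = Copy \<cdot> (Idn 1 \<otimes> Copy) \<cdot> (Idn 1 \<otimes> (Idn 1 \<otimes> Copy))"
    unfolding Copy_assoc by (simp add: numeral_2_eq_2 del: tens_comp)
  also have "\<dots> = Copy \<cdot> (Idn 1 \<otimes> (Copy \<cdot> (Idn 1 \<otimes> Copy)))"
    by (simp del: tens_Idn_left)
  also have "\<dots> = Copy \<cdot> (Idn 1 \<otimes> (Copy \<cdot> (Copy \<otimes> Idn 1)))"
    by (simp only: Copy_assoc)
  finally have 2: "Copy \<cdot> (Copy \<otimes> Copy) = Copy \<cdot> (Idn 1 \<otimes> (Copy \<cdot> (Copy \<otimes> Idn 1)))" .
  have "Copy \<cdot> cpy 2 = Copy \<cdot> (Copy \<otimes> Copy) \<cdot> (Idn 1 \<otimes> (Sym 1 1 \<otimes> Idn 1))"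
    unfolding 1 by (simp del: tens_comp)
  also have "\<dots> = Copy \<cdot> (Idn 1 \<otimes> (Copy \<cdot> ((Copy \<cdot> Sym 1 1) \<otimes> Idn 1)))"
    unfolding 2 by simp
  also have "\<dots> = Copy \<cdot> (Copy \<otimes> Copy)"
    unfolding 2 Copy_comm ..
  finally have 3: "Copy \<cdot> cpy 2 = Copy \<cdot> (Copy \<otimes> Copy)" .
  have "dsc 2 = Disc \<otimes> Disc" by (simp add: numeral_2_eq_2)
  then show ?thesis unfolding Cart_def using 3 by (simp add: Copy_Disc_Disc)
qed

text \<open>Both hexagons expand the block symmetry into four exchanges; the last,
  \<open>?D\<close>, cancels against \<open>?E\<close>, and \<open>?B\<close> and \<open>?C\<close>
  merge into a tensor.\<close>

lemma Sym_mid: "Sym (m + m) (n + n) \<cdot> (Idn n \<otimes> (Sym n m \<otimes> Idn m)) =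
   (Idn m \<otimes> (Sym m n \<otimes> Idn n)) \<cdot> (Sym m n \<otimes> Sym m n)"
proof -
  let ?A = "Idn m \<otimes> (Sym m n \<otimes> Idn n)" and ?B = "Idn (m + n) \<otimes> Sym m n" and ?C = "Sym m n \<otimes> Idn (n + m)"
    and ?D = "Idn n \<otimes> (Sym m n \<otimes> Idn m)" and ?E = "Idn n \<otimes> (Sym n m \<otimes> Idn m)"
  have "Sym (m + m) (n + n) = ?A \<cdot> (?B \<cdot> (?C \<cdot> ?D))"
    by (subst Sym_hex1, subst (1 2) Sym_hex2) (simp add: whisker_left whisker_right add.assoc del: tens_comp)
  then have "Sym (m + m) (n + n) \<cdot> ?E = ?A \<cdot> (?B \<cdot> (?C \<cdot> (?D \<cdot> ?E)))"
    by (simp add: add_ac del: tens_comp)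
  also have "?D \<cdot> ?E = Idn (n + m + n + m)" by (simp add: add_ac)
  also have "?C \<cdot> Idn (n + m + n + m) = ?C" by (simp add: add_ac)
  also have "?B \<cdot> ?C = Sym m n \<otimes> Sym m n" by (simp add: add_ac)
  finally show ?thesis .
qed

lemma Cart_Sym [simp]: "Cart (Sym m n)"
proof -
  have "Sym m n \<cdot> cpy (n + m) = (Sym m n \<cdot> (cpy n \<otimes> cpy m)) \<cdot> (Idn n \<otimes> (Sym n m \<otimes> Idn m))"
    by (simp add: cpy_add)
  also have "\<dots> = ((cpy m \<otimes> cpy n) \<cdot> Sym (m + m) (n + n)) \<cdot> (Idn n \<otimes> (Sym n m \<otimes> Idn m))"
    by (subst Sym_nat[where m = m and m' = n]) simp_all
  also have "\<dots> = (cpy m \<otimes> cpy n) \<cdot> (Sym (m + m) (n + n) \<cdot> (Idn n \<otimes> (Sym n m \<otimes> Idn m)))"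
    by (simp add: add_ac)
  also have "\<dots> = cpy (m + n) \<cdot> (Sym m n \<otimes> Sym m n)"
    unfolding Sym_mid by (simp add: cpy_add add_ac del: tens_comp)
  finally have 1: "Sym m n \<cdot> cpy (n + m) = cpy (m + n) \<cdot> (Sym m n \<otimes> Sym m n)" .
  have "Sym m n \<cdot> (dsc n \<otimes> dsc m) = (dsc m \<otimes> dsc n) \<cdot> Sym 0 0"
    by (subst Sym_nat[where m = m and m' = n]) simp_all
  then have 2: "Sym m n \<cdot> dsc (n + m) = dsc (m + n)" by (simp add: dsc_add)
  show ?thesis unfolding Cart_def using 1 2 by (simp only: dom_simps cod_simps arr_simps simp_thms)
qed

lemma Cart_dsc [simp]: "Cart (dsc n)"
  by (induct n) (simp_all add: Cart_tens)

lemma Cart_cpy [simp]: "Cart (cpy n)"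
  by (induct n) (auto intro!: Cart_tens Cart_comp)

lemma Cart_pair: "Cart f \<Longrightarrow> Cart g \<Longrightarrow> dom f = dom g \<Longrightarrow> Cart (pair f g)"
  by (auto simp: pair_def intro!: Cart_tens Cart_comp)

lemma Cart_comp_pair:
  assumes "Cart h" "arr f" "arr g" "dom f = cod h" "dom g = cod h"
  shows "h \<cdot> pair f g = pair (h \<cdot> f) (h \<cdot> g)"
proof -
  have "h \<cdot> pair f g = h \<cdot> cpy (cod h) \<cdot> (f \<otimes> g)"
    unfolding pair_def using assms by simp
  also have "h \<cdot> cpy (cod h) = cpy (dom h) \<cdot> (h \<otimes> h)" using assms by (simp add: Cart_def)
  finally show ?thesis unfolding pair_def using assms by simp
qed

lemma Cart_comp_dsc: "Cart h \<Longrightarrow> n = cod h \<Longrightarrow> h \<cdot> dsc n = dsc (dom h)"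
  by (simp add: Cart_def)

lemma pair_comp:
  assumes "arr f" "arr g" "arr h" "arr k" "dom f = dom g" "dom h = cod f" "dom k = cod g"
  shows "pair f g \<cdot> (h \<otimes> k) = pair (f \<cdot> h) (g \<cdot> k)"
  using assms by (simp add: pair_def)

lemma pair_tens:
  assumes "arr f" "arr f'" "arr g" "arr g'" "dom f = dom f'" "dom g = dom g'"
  shows "pair (f \<otimes> g) (f' \<otimes> g') = (pair f f' \<otimes> pair g g') \<cdot> (Idn (cod f) \<otimes> (Sym (cod f') (cod g) \<otimes> Idn (cod g')))"
proof -
  have "pair (f \<otimes> g) (f' \<otimes> g') = (cpy (dom f) \<otimes> cpy (dom g)) \<cdot> (Idn (dom f) \<otimes> (Sym (dom f') (dom g) \<otimes> Idn (dom g')) \<cdot> (f \<otimes> (g \<otimes> (f' \<otimes> g'))))"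
    using assms by (simp add: pair_def cpy_add del: tens_comp)
  also have "\<dots> = (cpy (dom f) \<otimes> cpy (dom g)) \<cdot> ((f \<otimes> (f' \<otimes> (g \<otimes> g'))) \<cdot> (Idn (cod f) \<otimes> (Sym (cod f') (cod g) \<otimes> Idn (cod g'))))"
    using assms by (subst tens_Sym_mid[where f = f and f' = f' and g = g]) simp_all
  also have "\<dots> = ((cpy (dom f) \<otimes> cpy (dom g)) \<cdot> ((f \<otimes> f') \<otimes> (g \<otimes> g'))) \<cdot> (Idn (cod f) \<otimes> (Sym (cod f') (cod g) \<otimes> Idn (cod g')))"
    using assms by (simp del: tens_comp)
  also have "(cpy (dom f) \<otimes> cpy (dom g)) \<cdot> ((f \<otimes> f') \<otimes> (g \<otimes> g')) = pair f f' \<otimes> pair g g'"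
    using assms by (simp add: pair_def del: tens_assoc)
  finally show ?thesis .
qed

text \<open>The counit laws, extended from one wire to \<open>n\<close> by splitting off a wire with
  \<open>pair_tens\<close>.\<close>

lemma pair_Idn_dsc: "pair (Idn n) (dsc n) = Idn n" "pair (dsc n) (Idn n) = Idn n"
proof (induct n)
  case 0 { case 1 then show ?case by (simp add: pair_def) next case 2 then show ?case by (simp add: pair_def) }
next
  case (Suc n)
  have p: "pair (Idn 1) Disc = Idn 1" "pair Disc (Idn 1) = Idn 1"
    using Copy_counit by (simp_all add: pair_def)
  { case 1
    have "pair (Idn 1 \<otimes> Idn n) (Disc \<otimes> dsc n) = Idn 1 \<otimes> Idn n"
      by (subst pair_tens) (simp_all add: p[simplified] Suc)
    then show ?case by simp
  next
    case 2
    have "pair (Disc \<otimes> dsc n) (Idn 1 \<otimes> Idn n) = Idn 1 \<otimes> Idn n"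
      by (subst pair_tens) (simp_all add: p[simplified] Suc)
    then show ?case by simp }
qed

lemma pair_dsc: assumes "arr f" "n = dom f" shows "pair f (dsc n) = f" "pair (dsc n) f = f"
proof -
  have "pair f (dsc n) = pair (Idn n) (dsc n) \<cdot> (f \<otimes> Idn 0)" using assms by (subst pair_comp) simp_all
  then show "pair f (dsc n) = f" unfolding pair_Idn_dsc using assms by simp
  have "pair (dsc n) f = pair (dsc n) (Idn n) \<cdot> (Idn 0 \<otimes> f)" using assms by (subst pair_comp) simp_all
  then show "pair (dsc n) f = f" unfolding pair_Idn_dsc using assms by simp
qed

section \<open>Projections and wirings given by index lists\<close>

definition proj :: "nat \<Rightarrow> nat \<Rightarrow> 'g mor" where
  "proj m k = dsc k \<otimes> (Idn 1 \<otimes> dsc (m - Suc k))"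

lemma proj_simps [simp]: "k < m \<Longrightarrow> dom (proj m k) = m" "cod (proj m k) = 1" "Cart (proj m k)"
  by (simp_all add: proj_def Cart_tens)

lemma proj_add1: "k < m \<Longrightarrow> proj (m + n) k = proj m k \<otimes> dsc n"
  by (simp add: proj_def flip: dsc_add)

lemma proj_add2: "proj (m + n) (m + k) = dsc m \<otimes> proj n k"
  by (simp add: proj_def dsc_add)

lemma proj_Disc: "k < m \<Longrightarrow> proj m k \<cdot> Disc = dsc m"
  using Cart_comp_dsc[of "proj m k" 1] by simp

text \<open>The wiring tabulated by \<open>ks\<close>: output \<open>j\<close> carries input
  \<open>ks ! j\<close>. Iterated pairing makes its projections computable, so wirings can be
  handled as functions between finite index sets.\<close>

primrec W :: "nat \<Rightarrow> nat list \<Rightarrow> 'g mor" where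
  "W m [] = dsc m"
| "W m (k # ks) = pair (proj m k) (W m ks)"

lemma W_simps [simp]:
  "\<forall>k \<in> set ks. k < m \<Longrightarrow> dom (W m ks) = m" "cod (W m ks) = length ks" "\<forall>k \<in> set ks. k < m \<Longrightarrow> Cart (W m ks)"
proof -
  show *: "\<forall>k \<in> set ks. k < m \<Longrightarrow> dom (W m ks) = m" by (induct ks) simp_all
  show "cod (W m ks) = length ks" by (induct ks) simp_all
  show "\<forall>k \<in> set ks. k < m \<Longrightarrow> Cart (W m ks)"
  proof (induct ks)
    case (Cons a ks) then show ?case using W.simps by (cases ks) (auto intro!: Cart_pair)
  qed simp
qed

lemma W_proj: "\<forall>k \<in> set ks. k < m \<Longrightarrow> j < length ks \<Longrightarrow> n = length ks \<Longrightarrow> W m ks \<cdot> proj n j = proj m (ks ! j)"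
proof (induct ks arbitrary: j n)
  case (Cons k ks)
  have d: "dom (W m ks) = m" "Cart (W m ks)" using Cons.prems by auto
  show ?case
  proof (cases j)
    case 0
    then have "proj n j = Idn 1 \<otimes> dsc (length ks)" using Cons.prems by (simp add: proj_def)
    then have "W m (k # ks) \<cdot> proj n j = pair (proj m k \<cdot> Idn 1) (W m ks \<cdot> dsc (length ks))"
      using d Cons.prems by (simp add: pair_comp)
    then show ?thesis using d Cons.prems 0 by (simp add: Cart_comp_dsc pair_dsc)
  next
    case (Suc i)
    then have "proj n j = Disc \<otimes> proj (length ks) i" using Cons.prems proj_add2[of 1 "length ks" i] by simp
    then have "W m (k # ks) \<cdot> proj n j = pair (proj m k \<cdot> Disc) (W m ks \<cdot> proj (length ks) i)"
      using d Cons.prems Suc by (simp add: pair_comp)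
    moreover have "ks ! i < m" using Cons.prems Suc by simp
    ultimately show ?thesis using d Cons.prems Suc Cons.hyps[of i] by (simp add: Cart_comp_dsc proj_Disc pair_dsc)
  qed
qed simp

text \<open>A morphism compatible with copying passes into each component of the iterated pairing,
  so it suffices to know it after the projections listed in \<open>us\<close>.\<close>

lemma Cart_comp_W:
  assumes "Cart h" "cod h = n" "\<forall>u \<in> set us. u < n \<and> \<kappa> u < dom h \<and> h \<cdot> proj n u = proj (dom h) (\<kappa> u)"
  shows "h \<cdot> W n us = W (dom h) (map \<kappa> us)"
  using assms
proof (induct us)
  case (Cons u us)
  then show ?case by (simp add: Cart_comp_pair)
qed (simp add: Cart_comp_dsc)

lemma W_comp:
  assumes "\<forall>k \<in> set ks. k < m" "\<forall>u \<in> set us. u < n" "n = length ks"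
  shows "W m ks \<cdot> W n us = W m (map ((!) ks) us)"
  using Cart_comp_W[of "W m ks" n us "(!) ks"] assms W_proj[OF assms(1) _ assms(3)] by simp

lemma W_shift: "\<forall>k \<in> set ks. k < n \<Longrightarrow> dsc m \<otimes> W n ks = W (m + n) (map ((+) m) ks)"
proof (induct ks)
  case (Cons k ks)
  then have "dsc m \<otimes> W n (k # ks) = pair (dsc m \<otimes> proj n k) (dsc m \<otimes> W n ks)"
    by (subst pair_tens) (simp_all add: pair_dsc)
  then show ?case using Cons by (simp add: proj_add2)
qed (simp add: dsc_add)

lemma W_tens:
  assumes "\<forall>k \<in> set ks. k < m" "\<forall>k \<in> set ks'. k < m'"
  shows "W m ks \<otimes> W m' ks' = W (m + m') (ks @ map ((+) m) ks')"
  using assms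
proof (induct ks)
  case (Cons k ks)
  then have "W m (k # ks) \<otimes> W m' ks' = pair (proj m k \<otimes> dsc m') (W m ks \<otimes> W m' ks')"
    by (subst pair_tens) (simp_all add: pair_dsc)
  then show ?case using Cons by (simp add: proj_add1)
qed (simp add: W_shift)

lemma W_upt: "W n [0..<n] = Idn n"
proof (induct n)
  case (Suc n)
  have "W (Suc n) [0..<Suc n] = pair (proj (1 + n) 0) (W (1 + n) (map ((+) 1) [0..<n]))"
  proof -
    have "[0..<Suc n] = 0 # map Suc [0..<n]" by (simp add: upt_conv_Cons map_Suc_upt del: upt_Suc)
    also have "map Suc [0..<n] = map ((+) 1) [0..<n]" by (rule map_cong) simp_all
    finally show ?thesis by (simp only: W.simps) simp
  qed
  also have "\<dots> = pair (Idn 1 \<otimes> dsc n) (dsc 1 \<otimes> Idn n)"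
    using Suc W_shift[of "[0..<n]" n 1] by (simp add: proj_def)
  also have "\<dots> = Idn 1 \<otimes> Idn n"
    by (subst pair_tens) (simp_all add: pair_dsc pair_dsc(1)[of "Idn 1" 1, simplified])
  finally show ?case by simp
qed simp

text \<open>Projections determine a morphism compatible with copying, because the identity is itself
  the wiring of all projections (\<open>W_upt\<close>).\<close>

lemma Cart_eq_W:
  assumes "Cart h" "length ks = cod h" "\<forall>u < cod h. ks ! u < dom h \<and> h \<cdot> proj (cod h) u = proj (dom h) (ks ! u)"
  shows "h = W (dom h) ks"
proof -
  have "h = h \<cdot> W (cod h) [0..<cod h]" using assms by (simp add: W_upt)
  also have "\<dots> = W (dom h) (map ((!) ks) [0..<cod h])"
    using assms by (intro Cart_comp_W) auto
  also have "map ((!) ks) [0..<cod h] = ks" using assms map_nth by metis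
  finally show ?thesis .
qed

text \<open>Naturality of the symmetry against a projection tensored with a discard computes each
  component; the two cases are the two blocks.\<close>

lemma W_Sym: "Sym m n = W (m + n) ([m..<m + n] @ [0..<m])"
proof -
  have 1: "Sym m n \<cdot> proj (n + m) u = proj (m + n) (m + u)" if "u < n" for u
    using that Sym_nat[of "dsc m" "proj n u" 0 1 m n] by (simp add: proj_add1 proj_add2)
  have 2: "Sym m n \<cdot> proj (n + m) (n + u) = proj (m + n) u" if "u < m" for u
    using that Sym_nat[of "proj m u" "dsc n" 1 0 m n] by (simp add: proj_add1 proj_add2)
  show ?thesis
  proof (rule Cart_eq_W[of "Sym m n", simplified])
    show "length ([m..<m + n] @ [0..<m]) = n + m" by simp
    show "\<forall>u<n + m. ([m..<m + n] @ [0..<m]) ! u < m + n \<and>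
          Sym m n \<cdot> proj (n + m) u = proj (m + n) (([m..<m + n] @ [0..<m]) ! u)"
    proof (intro allI impI)
      fix u assume u: "u < n + m"
      show "([m..<m + n] @ [0..<m]) ! u < m + n \<and>
          Sym m n \<cdot> proj (n + m) u = proj (m + n) (([m..<m + n] @ [0..<m]) ! u)"
      proof (cases "u < n")
        case True then show ?thesis using 1[of u] by (simp add: nth_append)
      next
        case False then show ?thesis using u 2[of "u - n"] by (simp add: nth_append)
      qed
    qed
  qed
qed

lemma W_Copy: "Copy = W 1 [0, 0]"
  using pair_Idn_dsc[of 1] by (simp add: proj_def pair_dsc) (simp add: pair_def)

lemma W_Disc: "Disc = W 1 []"
  by simp

end

section \<open>Wirings between named wires\<close>

definition pos :: "'v list \<Rightarrow> 'v \<Rightarrow> nat" where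
  "pos X y = (LEAST i. X ! i = y)"

text \<open>Simultaneous substitution of the entries of \<open>Y\<close> for the names in
  \<open>Z\<close>. The two types may differ, so the same function serves as renaming of wires and
  as valuation of wires by vertices.\<close>

definition sub :: "'v list \<Rightarrow> 'w list \<Rightarrow> 'v \<Rightarrow> 'w" where
  "sub Z Y v = Y ! pos Z v"

lemma pos_less [simp]: "y \<in> set X \<Longrightarrow> pos X y < length X"
  and nth_pos [simp]: "y \<in> set X \<Longrightarrow> X ! pos X y = y"
proof -
  assume "y \<in> set X"
  then obtain i where i: "i < length X" "X ! i = y" by (auto simp: in_set_conv_nth)
  show "X ! pos X y = y" unfolding pos_def by (rule LeastI[of _ i]) (rule i)
  show "pos X y < length X" unfolding pos_def using Least_le[of "\<lambda>i. X ! i = y" i] i by simp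
qed

lemma pos_nth [simp]: "distinct X \<Longrightarrow> i < length X \<Longrightarrow> pos X (X ! i) = i"
  by (metis nth_eq_iff_index_eq nth_mem nth_pos pos_less)

lemma pos_append1: "y \<in> set X \<Longrightarrow> pos (X @ X') y = pos X y"
proof -
  assume y: "y \<in> set X"
  have "i \<ge> pos X y" if "(X @ X') ! i = y" for i
  proof (cases "i < length X")
    case True
    then have "X ! i = y" using that by (simp add: nth_append)
    then show ?thesis unfolding pos_def by (rule Least_le)
  qed (use pos_less[OF y] in simp)
  moreover have "(X @ X') ! pos X y = y" using y by (simp add: nth_append)
  ultimately show ?thesis unfolding pos_def[of "X @ X'"] by (intro Least_equality) auto
qed

lemma pos_append2: "y \<in> set X' \<Longrightarrow> y \<notin> set X \<Longrightarrow> pos (X @ X') y = length X + pos X' y"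
proof -
  assume y: "y \<in> set X'" "y \<notin> set X"
  have "i \<ge> length X + pos X' y" if "(X @ X') ! i = y" for i
  proof (cases "i < length X")
    case True
    then have "X ! i = y" using that by (simp add: nth_append)
    then show ?thesis using y True by auto
  next
    case False
    then have "X' ! (i - length X) = y" using that by (simp add: nth_append)
    then have "pos X' y \<le> i - length X" unfolding pos_def by (rule Least_le)
    then show ?thesis using False by simp
  qed
  moreover have "(X @ X') ! (length X + pos X' y) = y" using y by (simp add: nth_append)
  ultimately show ?thesis unfolding pos_def[of "X @ X'"] by (intro Least_equality) auto
qed

lemma pos_map: "inj_on h (set X) \<Longrightarrow> y \<in> set X \<Longrightarrow> pos (map h X) (h y) = pos X y"
proof -
  assume h: "inj_on h (set X)" and y: "y \<in> set X"
  let ?p = "pos (map h X) (h y)"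
  have 1: "?p < length X" using pos_less[of "h y" "map h X"] y by simp
  have "h (X ! ?p) = h y" using nth_map[OF 1, of h] nth_pos[of "h y" "map h X"] y by (metis image_eqI list.set_map)
  then have "X ! ?p = y" using h y 1 by (meson inj_on_def nth_mem)
  then have "pos X y \<le> ?p" unfolding pos_def[of X] by (rule Least_le)
  moreover have "?p \<le> pos X y" unfolding pos_def[of "map h X"] by (rule Least_le) (use y in simp)
  ultimately show ?thesis by simp
qed

lemma map_pos_self: "distinct X \<Longrightarrow> map (pos X) X = [0..<length X]"
  by (rule nth_equalityI) auto

lemma map_sub_self: "distinct Z \<Longrightarrow> length Z = length Y \<Longrightarrow> map (sub Z Y) Z = Y"
  by (rule nth_equalityI) (auto simp: sub_def)

lemma sub_self: "y \<in> set X \<Longrightarrow> sub X X y = y"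
  by (simp add: sub_def)

lemma sub_append1: "v \<in> set Z \<Longrightarrow> length Z = length Y \<Longrightarrow> sub (Z @ Z') (Y @ Y') v = sub Z Y v"
  using pos_less[of v Z] by (simp add: sub_def pos_append1 nth_append)

lemma sub_append2: "v \<in> set Z' \<Longrightarrow> v \<notin> set Z \<Longrightarrow> length Z = length Y \<Longrightarrow> sub (Z @ Z') (Y @ Y') v = sub Z' Y' v"
  by (simp add: sub_def pos_append2 nth_append)

lemma sub_in: "v \<in> set Z \<Longrightarrow> length Z = length Y \<Longrightarrow> sub Z Y v \<in> set Y"
  by (metis nth_mem pos_less sub_def)

lemma sub_Cons: "v = a \<or> v \<in> set X \<Longrightarrow> sub (a # X) (b # X) v = (if v = a then b else v)"
proof -
  have "sub [a] [b] a = b" using pos_nth[of "[a]" 0] by (simp add: sub_def)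
  then show "v = a \<or> v \<in> set X \<Longrightarrow> ?thesis"
    using sub_append1[of v "[a]" "[b]" X X] sub_append2[of v X "[a]" "[b]" X] by (auto simp: sub_self)
qed

context signature begin

lemma W_post_left:
  assumes "\<forall>k \<in> set (ks1 @ ks2). k < m" "\<forall>u \<in> set us. u < length ks2" "n = length ks1" "n' = length ks2"
  shows "W m (ks1 @ ks2) \<cdot> (Idn n \<otimes> W n' us) = W m (ks1 @ map ((!) ks2) us)"
proof -
  have "Idn n \<otimes> W n' us = W (n + n') ([0..<n] @ map ((+) n) us)"
    unfolding W_upt[symmetric] by (rule W_tens) (use assms in auto)
  moreover have "W m (ks1 @ ks2) \<cdot> W (n + n') ([0..<n] @ map ((+) n) us) =
     W m (map ((!) (ks1 @ ks2)) ([0..<n] @ map ((+) n) us))"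
    by (rule W_comp) (use assms in auto)
  moreover have "map ((!) (ks1 @ ks2)) ([0..<n] @ map ((+) n) us) = ks1 @ map ((!) ks2) us"
    using assms by (auto intro!: nth_equalityI simp: nth_append)
  ultimately show ?thesis by (simp only:)
qed

text \<open>
  Naming the input wires by the distinct list \<open>X\<close>, the \<open>i\<close>-th output of \<open>wire X Y\<close> is the wire named
  \<open>Y ! i\<close>; names spare the index arithmetic when wirings are composed.
\<close>

definition wire :: "'v list \<Rightarrow> 'v list \<Rightarrow> 'g mor" where
  "wire X Y = W (length X) (map (pos X) Y)"

lemma pos_le_all: "set Y \<subseteq> set X \<Longrightarrow> \<forall>k \<in> set (map (pos X) Y). k < length X"
  by auto

lemma wire_simps [simp]:
  "set Y \<subseteq> set X \<Longrightarrow> dom (wire X Y) = length X" "cod (wire X Y) = length Y" "set Y \<subseteq> set X \<Longrightarrow> arr (wire X Y)"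
  unfolding wire_def by (subst W_simps, auto intro!: Cart_arr)+

lemma wire_Idn: "distinct X \<Longrightarrow> wire X X = Idn (length X)"
  by (simp add: wire_def map_pos_self W_upt)

text \<open>The form met in normal forms: the first outputs run to the feedback loop untouched,
  while the others are rewired by substitution of names.\<close>

lemma wire_post_left:
  assumes "set Y1 \<subseteq> set X" "set Y2 \<subseteq> set X" "set Q \<subseteq> set Z" "length Z = length Y2" "n = length Y1"
  shows "wire X (Y1 @ Y2) \<cdot> (Idn n \<otimes> wire Z Q) = wire X (Y1 @ map (sub Z Y2) Q)"
proof -
  have "wire X (Y1 @ Y2) \<cdot> (Idn n \<otimes> wire Z Q) = W (length X) (map (pos X) Y1 @ map ((!) (map (pos X) Y2)) (map (pos Z) Q))"
    unfolding wire_def map_append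
  proof (rule W_post_left)
    show "\<forall>u\<in>set (map (pos Z) Q). u < length (map (pos X) Y2)"
      using assms by (metis length_map pos_le_all)
  qed (use assms in auto)
  also have "map ((!) (map (pos X) Y2)) (map (pos Z) Q) = map (pos X) (map (sub Z Y2) Q)"
    using assms pos_less[of _ Z] by (auto simp: sub_def subset_eq)
  finally show ?thesis by (simp add: wire_def)
qed

lemma wire_comp:
  assumes "set Y \<subseteq> set X" "set Q \<subseteq> set Z" "length Z = length Y"
  shows "wire X Y \<cdot> wire Z Q = wire X (map (sub Z Y) Q)"
proof -
  have "wire X Y \<cdot> (Idn 0 \<otimes> wire Z Q) = wire X (map (sub Z Y) Q)"
    using wire_post_left[of "[]" X Y Q Z 0] assms by simp
  then show ?thesis using assms by simp
qed

lemma wire_comp_same: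
  assumes "set Y \<subseteq> set X" "set Q \<subseteq> set Y" "distinct Y"
  shows "wire X Y \<cdot> wire Y Q = wire X Q"
proof -
  have "map (sub Y Y) Q = Q" using assms by (intro map_idI) (auto simp: sub_self)
  then show ?thesis using wire_comp[OF assms(1,2)] by simp
qed

lemma wire_tens:
  assumes "set X \<inter> set X' = {}" "set Y \<subseteq> set X" "set Y' \<subseteq> set X'"
  shows "wire X Y \<otimes> wire X' Y' = wire (X @ X') (Y @ Y')"
proof -
  have "map (pos (X @ X')) Y = map (pos X) Y" "map (pos (X @ X')) Y' = map ((+) (length X)) (map (pos X') Y')"
    using assms by (auto simp: pos_append1 subset_eq) (subst pos_append2, auto)
  moreover have "wire X Y \<otimes> wire X' Y' = W (length X + length X') (map (pos X) Y @ map ((+) (length X)) (map (pos X') Y'))"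
    unfolding wire_def by (rule W_tens) (use assms in auto)
  ultimately show ?thesis by (simp only: wire_def length_append map_append)
qed

lemma wire_Sym:
  assumes "distinct (X @ Y)" "m = length X" "n = length Y"
  shows "Sym m n = wire (X @ Y) (Y @ X)"
proof -
  have "map (pos (X @ Y)) (X @ Y) = [0..<m + n]" using map_pos_self[OF assms(1)] assms by simp
  also have "\<dots> = [0..<m] @ [m..<m + n]" by (rule upt_add_eq_append) simp
  finally have "map (pos (X @ Y)) X = [0..<m] \<and> map (pos (X @ Y)) Y = [m..<m + n]"
    unfolding map_append by (subst (asm) append_eq_append_conv) (use assms in simp_all)
  then show ?thesis unfolding W_Sym wire_def using assms by simp
qed

lemma wire_map: "inj_on h (set X) \<Longrightarrow> set Y \<subseteq> set X \<Longrightarrow> wire (map h X) (map h Y) = wire X Y"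
proof -
  assume "inj_on h (set X)" "set Y \<subseteq> set X"
  then have "map (pos (map h X)) (map h Y) = map (pos X) Y" by (auto simp: pos_map subset_eq)
  then show ?thesis by (simp only: wire_def length_map)
qed

lemma wire_Copy: "Copy = wire [a] [a, a]" and wire_Disc: "Disc = wire [a] []"
proof -
  have p: "pos [a] a = 0" "length [a] = 1" by (simp_all add: pos_def)
  show "Copy = wire [a] [a, a]" "Disc = wire [a] []"
    unfolding wire_def list.map p by (rule W_Copy W_Disc)+
qed

text \<open>Permuting the inputs only reorders the list of available names; the requested names
  \<open>Y\<close> stay the same.\<close>

lemma wire_pre_swap:
  assumes "distinct (X1 @ X2 @ X3 @ X4)" "set Y \<subseteq> set (X1 @ X2 @ X3 @ X4)"
    "n1 = length X1" "n2 = length X2" "n3 = length X3" "n4 = length X4"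
  shows "(Idn n1 \<otimes> (Sym n2 n3 \<otimes> Idn n4)) \<cdot> wire (X1 @ X3 @ X2 @ X4) Y = wire (X1 @ X2 @ X3 @ X4) Y"
proof -
  have s: "Sym n2 n3 = wire (X2 @ X3) (X3 @ X2)" by (rule wire_Sym) (use assms in auto)
  have i: "Idn n1 = wire X1 X1" "Idn n4 = wire X4 X4" using assms by (simp_all add: wire_Idn)
  have 1: "Sym n2 n3 \<otimes> Idn n4 = wire ((X2 @ X3) @ X4) ((X3 @ X2) @ X4)"
    unfolding s i by (rule wire_tens) (use assms in auto)
  have "Idn n1 \<otimes> (Sym n2 n3 \<otimes> Idn n4) = wire (X1 @ ((X2 @ X3) @ X4)) (X1 @ ((X3 @ X2) @ X4))"
    unfolding i(1) 1 by (rule wire_tens) (use assms in auto)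
  moreover have "wire (X1 @ X2 @ X3 @ X4) (X1 @ X3 @ X2 @ X4) \<cdot> wire (X1 @ X3 @ X2 @ X4) Y = wire (X1 @ X2 @ X3 @ X4) Y"
    by (rule wire_comp_same) (use assms in auto)
  ultimately show ?thesis by simp
qed

lemma wire_post_swap:
  assumes "set (Y1 @ Y2 @ Y3 @ Y4) \<subseteq> set X"
    "n1 = length Y1" "n2 = length Y2" "n3 = length Y3" "n4 = length Y4"
  shows "wire X (Y1 @ Y2 @ Y3 @ Y4) \<cdot> (Idn n1 \<otimes> (Sym n2 n3 \<otimes> Idn n4)) = wire X (Y1 @ Y3 @ Y2 @ Y4)"
proof -
  \<comment> \<open>The outputs may repeat a name, so their positions are named by distinct numbers
    before the symmetry is read as a wiring; substitution returns to the original names.\<close>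
  let ?Z2 = "[0..<n2]" and ?Z3 = "[n2..<n2 + n3]" and ?Z4 = "[n2 + n3..<n2 + n3 + n4]"
  let ?Z = "(?Z2 @ ?Z3) @ ?Z4" and ?Q = "(?Z3 @ ?Z2) @ ?Z4"
  have 1: "Sym n2 n3 \<otimes> Idn n4 = wire ?Z ?Q"
  proof -
    have "Sym n2 n3 = wire (?Z2 @ ?Z3) (?Z3 @ ?Z2)" by (rule wire_Sym) auto
    moreover have "Idn n4 = wire ?Z4 ?Z4" by (simp add: wire_Idn)
    ultimately show ?thesis by (simp only:) (rule wire_tens, auto)
  qed
  have "map (sub ?Z (Y2 @ Y3 @ Y4)) ?Z = Y2 @ Y3 @ Y4"
    using assms by (intro map_sub_self) auto
  then have 2: "map (sub ?Z (Y2 @ Y3 @ Y4)) ?Z2 = Y2" "map (sub ?Z (Y2 @ Y3 @ Y4)) ?Z3 = Y3" "map (sub ?Z (Y2 @ Y3 @ Y4)) ?Z4 = Y4"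
    using assms by auto
  have "wire X (Y1 @ (Y2 @ Y3 @ Y4)) \<cdot> (Idn n1 \<otimes> wire ?Z ?Q) = wire X (Y1 @ map (sub ?Z (Y2 @ Y3 @ Y4)) ?Q)"
    by (rule wire_post_left) (use assms in auto)
  then show ?thesis using 1 2 by simp
qed

section \<open>Tracing one wire of a wiring\<close>

lemma Tr_tight_left:
  assumes "arr f" "arr g" "dom g = x + cod f" "cod g = x + n"
  shows "Tr x ((Idn x \<otimes> f) \<cdot> g) = f \<cdot> Tr x g"
  using Tr_tight[of f g "Idn n" x] assms by simp

lemma Tr_tight_right:
  assumes "arr h" "arr g" "dom g = x + m" "cod g = x + dom h"
  shows "Tr x (g \<cdot> (Idn x \<otimes> h)) = Tr x g \<cdot> h"
  using Tr_tight[of "Idn m" g h x] assms by simp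

text \<open>The wiring factors as duplicating \<open>b\<close>, exchanging that copy with
  \<open>a\<close>, and distributing. Tightening confines the trace to the exchange, which yanking
  removes, so feedback becomes substitution of \<open>b\<close> for \<open>a\<close>.\<close>

lemma Tr1_wire:
  assumes "distinct (a # X)" "set Y \<subseteq> set (a # X)" "b \<in> set X"
  shows "Tr 1 (wire (a # X) (b # Y)) = wire X (map (\<lambda>y. if y = a then b else y) Y)"
proof -
  let ?k = "length X"
  have i1: "Idn 1 = wire [a] [a]" by (simp add: wire_Idn)
  have 1: "Idn 1 \<otimes> wire X (b # X) = wire (a # X) (a # b # X)"
    unfolding i1 by (subst wire_tens) (use assms in auto)
  have 2: "wire (a # X) (a # b # X) \<cdot> (Sym 1 1 \<otimes> Idn ?k) = wire (a # X) (b # a # X)"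
    using wire_post_swap[of "[]" "[a]" "[b]" X "a # X" 0 1 1 ?k] assms by auto
  have 3: "wire (a # X) (b # a # X) \<cdot> (Idn 1 \<otimes> wire (a # X) Y) = wire (a # X) (b # Y)"
  proof -
    have "map (sub (a # X) (a # X)) Y = Y" using assms by (intro map_idI) (auto simp: sub_self)
    then show ?thesis using wire_post_left[of "[b]" "a # X" "a # X" Y "a # X" 1] assms by auto
  qed
  have "wire (a # X) (b # Y) = (Idn 1 \<otimes> wire X (b # X)) \<cdot> (Sym 1 1 \<otimes> Idn ?k) \<cdot> (Idn 1 \<otimes> wire (a # X) Y)"
    by (simp only: 1 2 3)
  moreover have "Tr 1 ((Idn 1 \<otimes> wire X (b # X)) \<cdot> (Sym 1 1 \<otimes> Idn ?k) \<cdot> (Idn 1 \<otimes> wire (a # X) Y)) =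
    wire X (b # X) \<cdot> Tr 1 (Sym 1 1 \<otimes> Idn ?k) \<cdot> wire (a # X) Y"
    using assms by (intro Tr_tight) auto
  moreover have "Tr 1 (Sym 1 1 \<otimes> Idn ?k) = Idn (1 + ?k)"
    by (subst Tr_super) (simp_all add: Tr_yank[of 1, simplified])
  ultimately have "Tr 1 (wire (a # X) (b # Y)) = wire X (b # X) \<cdot> wire (a # X) Y"
    using assms by simp
  also have "\<dots> = wire X (map (sub (a # X) (b # X)) Y)"
    by (rule wire_comp) (use assms in auto)
  also have "map (sub (a # X) (b # X)) Y = map (\<lambda>y. if y = a then b else y) Y"
    using assms by (intro map_cong) (auto simp: sub_Cons)
  finally show ?thesis .
qed

text \<open>A wire fed by itself cannot be substituted away. One copying splits off the loop;
  tightening and superposing leave \<open>Tr 1 Copy\<close> as the source of the name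
  \<open>a\<close>.\<close>

lemma Tr1_wire_loop:
  assumes "distinct (a # X)" "set Y \<subseteq> set (a # X)"
  shows "Tr 1 (wire (a # X) (a # Y)) = (Tr 1 Copy \<otimes> Idn (length X)) \<cdot> wire (a # X) Y"
proof -
  let ?k = "length X"
  have 1: "Copy \<otimes> Idn ?k = wire (a # X) (a # a # X)"
  proof -
    have "Copy \<otimes> Idn ?k = wire [a] [a, a] \<otimes> wire X X" using assms wire_Copy[of a] by (simp add: wire_Idn)
    also have "\<dots> = wire ([a] @ X) ([a, a] @ X)" using assms by (intro wire_tens) auto
    finally show ?thesis by simp
  qed
  have "map (sub (a # X) (a # X)) Y = Y" using assms by (intro map_idI) (auto simp: sub_self)
  then have "wire (a # X) (a # a # X) \<cdot> (Idn 1 \<otimes> wire (a # X) Y) = wire (a # X) (a # Y)"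
    using wire_post_left[of "[a]" "a # X" "a # X" Y "a # X" 1] assms by auto
  then have "Tr 1 (wire (a # X) (a # Y)) = Tr 1 ((Copy \<otimes> Idn ?k) \<cdot> (Idn 1 \<otimes> wire (a # X) Y))"
    by (simp only: 1)
  also have "\<dots> = Tr 1 (Copy \<otimes> Idn ?k) \<cdot> wire (a # X) Y"
    using assms by (intro Tr_tight_right[where m = ?k]) auto
  also have "Tr 1 (Copy \<otimes> Idn ?k) = Tr 1 Copy \<otimes> Idn ?k"
    by (rule Tr_super) auto
  finally show ?thesis .
qed

end

section \<open>Diagrams in traced normal form\<close>

text \<open>
  A block \<open>Some \<phi>\<close> is a hyperedge labelled \<open>\<phi>\<close> with its sources and targets; a block \<open>None\<close> without
  sources is a vertex that is neither an input nor a target, denoted by \<open>Tr\<^sup>1(copy)\<close>.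
\<close>

type_synonym ('g, 'v) diagram = "('g option \<times> 'v list \<times> 'v list) list"

definition ins :: "('g, 'v) diagram \<Rightarrow> 'v list" where
  "ins D = concat (map (\<lambda>d. fst (snd d)) D)"
definition outs :: "('g, 'v) diagram \<Rightarrow> 'v list" where
  "outs D = concat (map (\<lambda>d. snd (snd d)) D)"

text \<open>Only sources are renamed: composing and tracing redirect the uses of a wire, while its
  producer keeps its name.\<close>

definition map_ins :: "('v \<Rightarrow> 'v) \<Rightarrow> ('g, 'v) diagram \<Rightarrow> ('g, 'v) diagram" where
  "map_ins \<sigma> D = map (\<lambda>(b, i, o'). (b, map \<sigma> i, o')) D"
definition map_diag :: "('v \<Rightarrow> 'w) \<Rightarrow> ('g, 'v) diagram \<Rightarrow> ('g, 'w) diagram" where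
  "map_diag h D = map (\<lambda>(b, i, o'). (b, map h i, map h o')) D"

lemma ins_simps [simp]:
  "ins [] = []" "ins (d # D) = fst (snd d) @ ins D" "ins (D @ D') = ins D @ ins D'"
  "outs [] = []" "outs (d # D) = snd (snd d) @ outs D" "outs (D @ D') = outs D @ outs D'"
  by (simp_all add: ins_def outs_def)

lemma map_diag_simps [simp]:
  "map_ins \<sigma> [] = []" "map_ins \<sigma> ((b, i, o') # D) = (b, map \<sigma> i, o') # map_ins \<sigma> D"
  "map_diag h [] = []" "map_diag h ((b, i, o') # D) = (b, map h i, map h o') # map_diag h D"
  by (simp_all add: map_ins_def map_diag_def)

lemma ins_map_ins [simp]: "ins (map_ins \<sigma> D) = map \<sigma> (ins D)" "outs (map_ins \<sigma> D) = outs D"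
  "ins (map_diag h D) = map h (ins D)" "outs (map_diag h D) = map h (outs D)"
  by (induct D) auto

context signature begin

fun blk :: "'g option \<Rightarrow> 'g mor" where
  "blk None = Tr 1 Copy"
| "blk (Some \<phi>) = Gen \<phi>"

fun wf_blk :: "'g option \<times> 'v list \<times> 'v list \<Rightarrow> bool" where
  "wf_blk (None, i, o') \<longleftrightarrow> i = [] \<and> length o' = 1"
| "wf_blk (Some \<phi>, i, o') \<longleftrightarrow> \<phi> \<in> gens S \<and> length i = arity S \<phi> \<and> length o' = coarity S \<phi>"

primrec box :: "('g, 'v) diagram \<Rightarrow> 'g mor" where
  "box [] = Idn 0"
| "box (d # D) = blk (fst d) \<otimes> box D"

text \<open>Distinctness of \<open>outs D @ f\<close> is left-monogamy in syntactic form: every wire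
  has a single producer, a block or an input. Uses of a wire, in sources or outputs, may repeat or
  be absent.\<close>

definition valid :: "('g, 'v) diagram \<Rightarrow> 'v list \<Rightarrow> 'v list \<Rightarrow> bool" where
  "valid D f g \<longleftrightarrow> (\<forall>d \<in> set D. wf_blk d) \<and> distinct (outs D @ f) \<and> set (ins D @ g) \<subseteq> set (outs D @ f)"

text \<open>All blocks stand side by side next to the inputs; one wiring then feeds the sources of
  the blocks back through the trace and emits the outputs.\<close>

definition nf :: "('g, 'v) diagram \<Rightarrow> 'v list \<Rightarrow> 'v list \<Rightarrow> 'g mor" where
  "nf D f g = Tr (length (ins D)) ((box D \<otimes> Idn (length f)) \<cdot> wire (outs D @ f) (ins D @ g))"

lemma blk_simps:
  "wf_blk d \<Longrightarrow> arr (blk (fst d)) \<and> dom (blk (fst d)) = length (fst (snd d)) \<and> cod (blk (fst d)) = length (snd (snd d))"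
  by (cases d rule: wf_blk.cases) auto

lemma box_simps [simp]:
  assumes "\<forall>d \<in> set D. wf_blk d"
  shows "arr (box D)" "dom (box D) = length (ins D)" "cod (box D) = length (outs D)"
  using assms by (induct D) (auto simp: blk_simps)

lemma box_append: "\<forall>d \<in> set D. wf_blk d \<Longrightarrow> \<forall>d \<in> set D'. wf_blk d \<Longrightarrow> box (D @ D') = box D \<otimes> box D'"
  by (induct D) (auto simp: blk_simps)

lemma box_map_ins [simp]: "box (map_ins \<sigma> D) = box D" and box_map_diag [simp]: "box (map_diag h D) = box D"
  by (induct D) auto

lemma wf_map_ins [simp]: "(\<forall>d \<in> set (map_ins \<sigma> D). wf_blk d) \<longleftrightarrow> (\<forall>d \<in> set D. wf_blk d)"
  and wf_map_diag [simp]: "(\<forall>d \<in> set (map_diag h D). wf_blk d) \<longleftrightarrow> (\<forall>d \<in> set D. wf_blk d)"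
proof -
  have "wf_blk (b, map \<sigma> i, o') = wf_blk (b, i, o')" "wf_blk (b, map h i, map h o') = wf_blk (b, i, o')" for b i o'
    by (cases b; simp)+
  then show "(\<forall>d \<in> set (map_ins \<sigma> D). wf_blk d) \<longleftrightarrow> (\<forall>d \<in> set D. wf_blk d)"
    "(\<forall>d \<in> set (map_diag h D). wf_blk d) \<longleftrightarrow> (\<forall>d \<in> set D. wf_blk d)"
    by (induct D) auto
qed

lemma nf_simps [simp]:
  assumes "valid D f g"
  shows "arr (nf D f g)" "dom (nf D f g) = length f" "cod (nf D f g) = length g"
  using assms unfolding nf_def valid_def by (auto)

text \<open>Names matter only through equality (\<open>wire_map\<close>), so a renaming injective on
  the produced wires preserves the morphism.\<close>

lemma nf_map:
  assumes "inj_on h (set (outs D @ f))" "valid D f g"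
  shows "nf (map_diag h D) (map h f) (map h g) = nf D f g" "valid (map_diag h D) (map h f) (map h g)"
proof -
  have "wire (map h (outs D @ f)) (map h (ins D @ g)) = wire (outs D @ f) (ins D @ g)"
    by (rule wire_map) (use assms in \<open>auto simp: valid_def\<close>)
  then show "nf (map_diag h D) (map h f) (map h g) = nf D f g"
    unfolding nf_def by simp
  show "valid (map_diag h D) (map h f) (map h g)"
    unfolding valid_def
  proof (intro conjI)
    show "\<forall>d\<in>set (map_diag h D). wf_blk d" using assms(2) by (simp add: valid_def)
    show "distinct (outs (map_diag h D) @ map h f)"
      unfolding ins_map_ins map_append[symmetric] distinct_map using assms by (simp add: valid_def)
    show "set (ins (map_diag h D) @ map h g) \<subseteq> set (outs (map_diag h D) @ map h f)"
      unfolding ins_map_ins map_append[symmetric] set_map using assms(2) unfolding valid_def by (intro image_mono) simp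
  qed
qed

lemma nf_wire:
  assumes "distinct f" "set g \<subseteq> set f"
  shows "nf [] f g = wire f g" "valid [] f g"
  using assms by (simp_all add: nf_def valid_def)

text \<open>The wiring of the single block is a symmetry; the generator slides round the loop,
  leaves it by tightening, and the remaining loop is yanked.\<close>

lemma nf_Gen:
  assumes "\<phi> \<in> gens S" "distinct (X @ Y)" "length X = arity S \<phi>" "length Y = coarity S \<phi>"
  shows "nf [(Some \<phi>, X, Y)] X Y = Gen \<phi>" "valid [(Some \<phi>, X, Y)] X Y"
proof -
  let ?a = "arity S \<phi>" and ?b = "coarity S \<phi>"
  have "wire (Y @ X) (X @ Y) = Sym ?b ?a" by (rule wire_Sym[symmetric]) (use assms in auto)
  then have "nf [(Some \<phi>, X, Y)] X Y = Tr ?a ((Gen \<phi> \<otimes> Idn ?a) \<cdot> Sym ?b ?a)"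
    using assms by (simp add: nf_def)
  also have "\<dots> = Tr ?b (Sym ?b ?a \<cdot> (Gen \<phi> \<otimes> Idn ?b))"
    by (rule Tr_slide[symmetric]) (use assms in auto)
  also have "Sym ?b ?a \<cdot> (Gen \<phi> \<otimes> Idn ?b) = (Idn ?b \<otimes> Gen \<phi>) \<cdot> Sym ?b ?b"
    by (rule Sym_nat[symmetric]) (use assms in auto)
  also have "Tr ?b ((Idn ?b \<otimes> Gen \<phi>) \<cdot> Sym ?b ?b) = Gen \<phi> \<cdot> Tr ?b (Sym ?b ?b)"
    by (rule Tr_tight_left) (use assms in auto)
  finally show "nf [(Some \<phi>, X, Y)] X Y = Gen \<phi>" using assms by (simp add: Tr_yank)
  show "valid [(Some \<phi>, X, Y)] X Y" using assms by (auto simp: valid_def)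
qed

section \<open>Closure of normal forms under tensor, composition and trace\<close>

lemma nf_tens_Idn:
  assumes "valid D f g" "distinct Z" "set Z \<inter> set (outs D @ f) = {}"
  shows "nf D (f @ Z) (g @ Z) = nf D f g \<otimes> Idn (length Z)" "valid D (f @ Z) (g @ Z)"
proof -
  have w: "\<forall>d \<in> set D. wf_blk d" and d: "distinct (outs D @ f)" and s: "set (ins D @ g) \<subseteq> set (outs D @ f)"
    using assms by (auto simp: valid_def)
  have "wire (outs D @ f) (ins D @ g) \<otimes> wire Z Z = wire ((outs D @ f) @ Z) ((ins D @ g) @ Z)"
    using assms s by (intro wire_tens) auto
  then have "wire (outs D @ (f @ Z)) (ins D @ (g @ Z)) = wire (outs D @ f) (ins D @ g) \<otimes> Idn (length Z)"
    using assms by (simp add: wire_Idn)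
  then have "nf D (f @ Z) (g @ Z) =
      Tr (length (ins D)) (((box D \<otimes> Idn (length f)) \<cdot> wire (outs D @ f) (ins D @ g)) \<otimes> Idn (length Z))"
    unfolding nf_def using w s by (simp add: whisker_right del: tens_comp)
  also have "\<dots> = nf D f g \<otimes> Idn (length Z)"
    unfolding nf_def using w s by (intro Tr_super) auto
  finally show "nf D (f @ Z) (g @ Z) = nf D f g \<otimes> Idn (length Z)" .
  show "valid D (f @ Z) (g @ Z)" using assms by (auto simp: valid_def)
qed

text \<open>Tightening, superposing and vanishing merge the two traces into one over both lists of
  sources, at the price of symmetries around the boxes; naturality moves the boxes to the front.
  What remains is pure wiring, evaluated by names: \<open>\<sigma>\<close> replaces the inputs of
  the second diagram by the outputs of the first.\<close>

lemma nf_comp: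
  assumes v: "valid D f g" and v': "valid D' f' g'" and dj: "set (outs D @ f) \<inter> set (outs D' @ f') = {}"
    and len: "length g = length f'"
  defines "\<sigma> \<equiv> sub (outs D' @ f') (outs D' @ g)"
  shows "nf (D @ map_ins \<sigma> D') f (map \<sigma> g') = nf D f g \<cdot> nf D' f' g'"
    and "valid (D @ map_ins \<sigma> D') f (map \<sigma> g')"
proof -
  have w: "\<forall>d \<in> set D. wf_blk d" and d: "distinct (outs D @ f)" and s: "set (ins D @ g) \<subseteq> set (outs D @ f)"
    using v by (auto simp: valid_def)
  have w': "\<forall>d \<in> set D'. wf_blk d" and d': "distinct (outs D' @ f')" and s': "set (ins D' @ g') \<subseteq> set (outs D' @ f')"
    using v' by (auto simp: valid_def)
  have len': "length (outs D' @ f') = length (outs D' @ g)" using len by simp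
  have "set (map \<sigma> (ins D' @ g')) \<subseteq> set (outs D' @ g)"
    unfolding set_map \<sigma>_def using sub_in[OF _ len'] s' by blast
  moreover have "\<forall>d \<in> set (map_ins \<sigma> D'). wf_blk d" using w' by simp
  moreover have "set (ins (D @ map_ins \<sigma> D') @ map \<sigma> g') \<subseteq> set (outs (D @ map_ins \<sigma> D') @ f)"
    using calculation(1) s by auto
  ultimately show "valid (D @ map_ins \<sigma> D') f (map \<sigma> g')"
    unfolding valid_def using w d d' dj by (intro conjI) (simp_all only: set_append ball_Un ins_simps ins_map_ins, auto)
  let ?A = "length (ins D)" and ?A' = "length (ins D')" and ?B = "length (outs D)" and ?B' = "length (outs D')"
  let ?l = "length f" and ?m = "length f'" and ?n = "length g'"
  let ?W = "wire (outs D @ f) (ins D @ g)" and ?W' = "wire (outs D' @ f') (ins D' @ g')"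
  let ?X = "(box D \<otimes> Idn ?l) \<cdot> ?W" and ?Y = "(box D' \<otimes> Idn ?m) \<cdot> ?W'"
  let ?s = "Tr ?A ?X"
  have ar [simp]: "arr ?W" "arr ?W'" "dom ?W = ?B + ?l" "dom ?W' = ?B' + ?m" "cod ?W = ?A + ?m" "cod ?W' = ?A' + ?n"
    using s s' len by auto
  note [simp] = len box_simps[OF w] box_simps[OF w']
  let ?S1 = "Idn ?A \<otimes> Sym ?A' ?l" and ?S2 = "Sym ?m ?A' \<cdot> ?Y"
  \<comment> \<open>\<open>?Z\<close> is the body of the merged trace, with the boxes still
    separated by wiring.\<close>
  let ?Z = "?S1 \<cdot> ((?X \<otimes> Idn ?A') \<cdot> (Idn ?A \<otimes> ?S2))"
  have "nf D f g \<cdot> nf D' f' g' = ?s \<cdot> Tr ?A' ?Y" by (simp add: nf_def)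
  also have "\<dots> = Tr ?A' ((Idn ?A' \<otimes> ?s) \<cdot> ?Y)"
    by (rule Tr_tight_left[symmetric]) simp_all
  also have "Idn ?A' \<otimes> ?s = Sym ?A' ?l \<cdot> (?s \<otimes> Idn ?A') \<cdot> Sym ?m ?A'"
  proof -
    have "(Idn ?A' \<otimes> ?s) \<cdot> Sym ?A' ?m = Sym ?A' ?l \<cdot> (?s \<otimes> Idn ?A')"
      by (rule Sym_nat) simp_all
    then have "(Idn ?A' \<otimes> ?s) \<cdot> Sym ?A' ?m \<cdot> Sym ?m ?A' = Sym ?A' ?l \<cdot> (?s \<otimes> Idn ?A') \<cdot> Sym ?m ?A'"
      by (simp only:)
    then show ?thesis by (subst (asm) comp_assoc) simp_all
  qed
  also have "?s \<otimes> Idn ?A' = Tr ?A (?X \<otimes> Idn ?A')"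
    by (rule Tr_super[symmetric]) simp_all
  also have "Sym ?A' ?l \<cdot> Tr ?A (?X \<otimes> Idn ?A') \<cdot> Sym ?m ?A' \<cdot> ?Y = Sym ?A' ?l \<cdot> Tr ?A (?X \<otimes> Idn ?A') \<cdot> ?S2"
    by (rule comp_assoc) simp_all
  also have "\<dots> = Tr ?A (?S1 \<cdot> (?X \<otimes> Idn ?A') \<cdot> (Idn ?A \<otimes> ?S2))"
    by (rule Tr_tight[symmetric]) simp_all
  also have "?S1 \<cdot> (?X \<otimes> Idn ?A') \<cdot> (Idn ?A \<otimes> ?S2) = ?Z"
    by (rule comp_assoc) simp_all
  also have "Tr ?A' (Tr ?A ?Z) = Tr (?A + ?A') ?Z"
    by (rule Tr_Tr) simp_all
  finally have L: "nf D f g \<cdot> nf D' f' g' = Tr (?A + ?A') ?Z" .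
  \<comment> \<open>\<open>?V\<close> collects the wiring that remains once both boxes have been
    pulled to the front.\<close>
  let ?V = "(Idn ?B \<otimes> Sym ?B' ?l) \<cdot> ((?W \<otimes> Idn ?B') \<cdot> (Idn ?A \<otimes> (Sym ?m ?B' \<cdot> ?W')))"
  have 1: "?S2 = (Idn ?m \<otimes> box D') \<cdot> (Sym ?m ?B' \<cdot> ?W')"
  proof -
    have "?S2 = Sym ?m ?A' \<cdot> (box D' \<otimes> Idn ?m) \<cdot> ?W'" by (rule comp_assoc[symmetric]) simp_all
    also have "Sym ?m ?A' \<cdot> (box D' \<otimes> Idn ?m) = (Idn ?m \<otimes> box D') \<cdot> Sym ?m ?B'"
      by (rule Sym_nat[symmetric]) simp_all
    also have "\<dots> \<cdot> ?W' = (Idn ?m \<otimes> box D') \<cdot> (Sym ?m ?B' \<cdot> ?W')" by (rule comp_assoc) simp_all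
    finally show ?thesis .
  qed
  let ?T = "Sym ?m ?B' \<cdot> ?W'"
  have T: "arr ?T" "dom ?T = ?m + ?B'" "cod ?T = ?A' + ?n" by simp_all
  have 2: "Idn ?A \<otimes> ?S2 = (Idn (?A + ?m) \<otimes> box D') \<cdot> (Idn ?A \<otimes> ?T)"
    unfolding 1 using T by (simp add: whisker_left del: tens_comp)
  have 3: "(?X \<otimes> Idn ?A') \<cdot> (Idn (?A + ?m) \<otimes> box D') = (box D \<otimes> (Idn ?l \<otimes> box D')) \<cdot> (?W \<otimes> Idn ?B')"
  proof -
    have "(?X \<otimes> Idn ?A') \<cdot> (Idn (?A + ?m) \<otimes> box D') = ?X \<otimes> box D'" by simp
    also have "\<dots> = ((box D \<otimes> Idn ?l) \<otimes> box D') \<cdot> (?W \<otimes> Idn ?B')" by (subst tens_comp) simp_all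
    finally show ?thesis by simp
  qed
  have 4: "?S1 \<cdot> (box D \<otimes> (Idn ?l \<otimes> box D')) = (box D \<otimes> (box D' \<otimes> Idn ?l)) \<cdot> (Idn ?B \<otimes> Sym ?B' ?l)"
  proof -
    have "Sym ?A' ?l \<cdot> (Idn ?l \<otimes> box D') = (box D' \<otimes> Idn ?l) \<cdot> Sym ?B' ?l"
      by (rule Sym_nat[symmetric]) simp_all
    then show ?thesis by simp
  qed
  have "?Z = ?S1 \<cdot> ((?X \<otimes> Idn ?A') \<cdot> ((Idn (?A + ?m) \<otimes> box D') \<cdot> (Idn ?A \<otimes> ?T)))"
    unfolding 2 ..
  also have "(?X \<otimes> Idn ?A') \<cdot> ((Idn (?A + ?m) \<otimes> box D') \<cdot> (Idn ?A \<otimes> ?T)) =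
    ((?X \<otimes> Idn ?A') \<cdot> (Idn (?A + ?m) \<otimes> box D')) \<cdot> (Idn ?A \<otimes> ?T)"
    by (rule comp_assoc[symmetric]) simp_all
  also have "\<dots> = (box D \<otimes> (Idn ?l \<otimes> box D')) \<cdot> ((?W \<otimes> Idn ?B') \<cdot> (Idn ?A \<otimes> ?T))"
    unfolding 3 by (rule comp_assoc) simp_all
  also have "?S1 \<cdot> \<dots> = (?S1 \<cdot> (box D \<otimes> (Idn ?l \<otimes> box D'))) \<cdot> ((?W \<otimes> Idn ?B') \<cdot> (Idn ?A \<otimes> ?T))"
    by (rule comp_assoc[symmetric]) simp_all
  also have "\<dots> = (box D \<otimes> (box D' \<otimes> Idn ?l)) \<cdot> ?V"
    unfolding 4 by (rule comp_assoc) simp_all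
  finally have Z: "?Z = (box D \<otimes> (box D' \<otimes> Idn ?l)) \<cdot> ?V" .
  have 5: "?W \<otimes> Idn ?B' = wire (outs D @ f @ outs D') (ins D @ g @ outs D')"
    using wire_tens[of "outs D @ f" "outs D'" "ins D @ g" "outs D'"] s d' dj by (auto simp: wire_Idn)
  have 6: "\<dots> \<cdot> (Idn ?A \<otimes> Sym ?m ?B') = wire (outs D @ f @ outs D') (ins D @ outs D' @ g)"
    using wire_post_swap[of "ins D" g "outs D'" "[]" "outs D @ f @ outs D'" ?A ?m ?B' 0] s len by auto
  have 7: "wire (outs D @ f @ outs D') (ins D @ outs D' @ g) \<cdot> (Idn ?A \<otimes> ?W') =
       wire (outs D @ f @ outs D') (ins D @ map \<sigma> (ins D' @ g'))"
    unfolding \<sigma>_def by (rule wire_post_left) (use s s' len in auto)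
  have 8: "(?W \<otimes> Idn ?B') \<cdot> (Idn ?A \<otimes> ?T) = wire (outs D @ f @ outs D') (ins D @ map \<sigma> (ins D' @ g'))"
  proof -
    have "Idn ?A \<otimes> ?T = (Idn ?A \<otimes> Sym ?m ?B') \<cdot> (Idn ?A \<otimes> ?W')" by simp
    then have "(?W \<otimes> Idn ?B') \<cdot> (Idn ?A \<otimes> ?T) = (?W \<otimes> Idn ?B') \<cdot> (Idn ?A \<otimes> Sym ?m ?B') \<cdot> (Idn ?A \<otimes> ?W')"
      by (simp only:) (rule comp_assoc[symmetric], simp_all)
    then show ?thesis unfolding 5 6 7 .
  qed
  have "set (map \<sigma> (ins D' @ g')) \<subseteq> set (outs D' @ g)" by fact
  then have 9: "?V = wire (outs D @ outs D' @ f) (ins D @ map \<sigma> (ins D' @ g'))"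
    unfolding 8 using wire_pre_swap[of "outs D" "outs D'" f "[]" "ins D @ map \<sigma> (ins D' @ g')" ?B ?B' ?l 0]
      d d' dj s by (simp add: subset_eq) blast
  have "nf (D @ map_ins \<sigma> D') f (map \<sigma> g') = Tr (?A + ?A') ((box (D @ map_ins \<sigma> D') \<otimes> Idn ?l) \<cdot> ?V)"
    unfolding nf_def 9 by simp
  also have "box (D @ map_ins \<sigma> D') = box D \<otimes> box D'"
    using w w' by (subst box_append) auto
  finally show "nf (D @ map_ins \<sigma> D') f (map \<sigma> g') = nf D f g \<cdot> nf D' f' g'"
    unfolding L Z by simp
qed

text \<open>Vanishing merges the outer trace with the inner one, sliding a symmetry puts the extra
  wire first, and vanishing splits the traces again. The extra wire is now traced innermost, where
  tightening passes it over the boxes.\<close>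

lemma Tr1_nf:
  assumes v: "valid D (a # f) (b # g)"
  shows "Tr 1 (nf D (a # f) (b # g)) =
    Tr (length (ins D)) ((box D \<otimes> Idn (length f)) \<cdot> Tr 1 (wire (a # outs D @ f) (b # ins D @ g)))"
proof -
  have w: "\<forall>d \<in> set D. wf_blk d" and d: "distinct (outs D @ a # f)" and s: "set (ins D @ b # g) \<subseteq> set (outs D @ a # f)"
    using v by (auto simp: valid_def)
  note [simp] = box_simps[OF w]
  let ?A = "length (ins D)" and ?B = "length (outs D)" and ?m = "length f" and ?n = "length g"
  let ?w = "wire (outs D @ a # f) (ins D @ b # g)" and ?w' = "wire (a # outs D @ f) (b # ins D @ g)"
  have ar [simp]: "arr ?w" "dom ?w = ?B + (1 + ?m)" "cod ?w = ?A + (1 + ?n)"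
     "arr ?w'" "dom ?w' = 1 + (?B + ?m)" "cod ?w' = 1 + (?A + ?n)"
    using s by auto
  let ?Z = "(box D \<otimes> Idn (1 + ?m)) \<cdot> ?w"
  let ?Y = "?Z \<cdot> (Sym ?A 1 \<otimes> Idn ?n)"
  have 1: "?Z = ?Y \<cdot> (Sym 1 ?A \<otimes> Idn ?n)"
  proof -
    have "?Y \<cdot> (Sym 1 ?A \<otimes> Idn ?n) = ?Z \<cdot> ((Sym ?A 1 \<otimes> Idn ?n) \<cdot> (Sym 1 ?A \<otimes> Idn ?n))"
      by (rule comp_assoc) simp_all
    also have "(Sym ?A 1 \<otimes> Idn ?n) \<cdot> (Sym 1 ?A \<otimes> Idn ?n) = Idn (?A + 1 + ?n)"
      by (subst tens_comp) (simp_all del: One_nat_def)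
    finally show ?thesis by simp
  qed
  have 2: "?w \<cdot> (Sym ?A 1 \<otimes> Idn ?n) = wire (outs D @ a # f) (b # ins D @ g)"
    using wire_post_swap[of "[]" "ins D" "[b]" g "outs D @ a # f" 0 ?A 1 ?n] s by auto
  have 3: "(Sym 1 ?A \<otimes> Idn ?m) \<cdot> (box D \<otimes> Idn (1 + ?m)) = (Idn 1 \<otimes> (box D \<otimes> Idn ?m)) \<cdot> (Sym 1 ?B \<otimes> Idn ?m)"
  proof -
    have "Sym 1 ?A \<cdot> (box D \<otimes> Idn 1) = (Idn 1 \<otimes> box D) \<cdot> Sym 1 ?B"
      by (rule Sym_nat[symmetric]) simp_all
    then have "(Sym 1 ?A \<cdot> (box D \<otimes> Idn 1)) \<otimes> Idn ?m = ((Idn 1 \<otimes> box D) \<cdot> Sym 1 ?B) \<otimes> Idn ?m"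
      by (simp only:)
    then show ?thesis by (simp add: whisker_right del: tens_comp)
  qed
  have 4: "(Sym 1 ?B \<otimes> Idn ?m) \<cdot> wire (outs D @ a # f) (b # ins D @ g) = ?w'"
    using wire_pre_swap[of "[]" "[a]" "outs D" f "b # ins D @ g" 0 1 ?B ?m] s d by auto
  let ?v = "wire (outs D @ a # f) (b # ins D @ g)"
  have [simp]: "arr ?v" "dom ?v = ?B + (1 + ?m)" "cod ?v = 1 + (?A + ?n)" using s by auto
  have Z0: "?Y = (box D \<otimes> Idn (1 + ?m)) \<cdot> ?v"
    unfolding 2[symmetric] by (rule comp_assoc) simp_all
  have "(Sym 1 ?A \<otimes> Idn ?m) \<cdot> ?Y = (Sym 1 ?A \<otimes> Idn ?m) \<cdot> (box D \<otimes> Idn (1 + ?m)) \<cdot> ?v"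
    unfolding Z0 by (rule comp_assoc[symmetric]) simp_all
  also have "\<dots> = (Idn 1 \<otimes> (box D \<otimes> Idn ?m)) \<cdot> ((Sym 1 ?B \<otimes> Idn ?m) \<cdot> ?v)"
    unfolding 3 by (rule comp_assoc) simp_all
  finally have 5: "(Sym 1 ?A \<otimes> Idn ?m) \<cdot> ?Y = (Idn 1 \<otimes> (box D \<otimes> Idn ?m)) \<cdot> ?w'"
    unfolding 4 .
  have "Tr 1 (nf D (a # f) (b # g)) = Tr 1 (Tr ?A ?Z)" by (simp add: nf_def)
  also have "\<dots> = Tr (?A + 1) ?Z" by (rule Tr_Tr) simp_all
  also have "\<dots> = Tr (?A + 1) (?Y \<cdot> (Sym 1 ?A \<otimes> Idn ?n))" by (simp only: 1[symmetric])
  also have "\<dots> = Tr (1 + ?A) ((Sym 1 ?A \<otimes> Idn ?m) \<cdot> ?Y)"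
    by (rule Tr_slide) (simp_all add: Z0)
  also have "\<dots> = Tr ?A (Tr 1 ((Idn 1 \<otimes> (box D \<otimes> Idn ?m)) \<cdot> ?w'))"
    unfolding 5 by (rule Tr_Tr[symmetric]) simp_all
  also have "Tr 1 ((Idn 1 \<otimes> (box D \<otimes> Idn ?m)) \<cdot> ?w') = (box D \<otimes> Idn ?m) \<cdot> Tr 1 ?w'"
    by (rule Tr_tight_left) simp_all
  finally show ?thesis .
qed

lemma nf_Tr1:
  assumes v: "valid D (a # f) (b # g)" and ab: "a \<noteq> b"
  defines "\<sigma> \<equiv> \<lambda>v. if v = a then b else v"
  shows "nf (map_ins \<sigma> D) f (map \<sigma> g) = Tr 1 (nf D (a # f) (b # g))" "valid (map_ins \<sigma> D) f (map \<sigma> g)"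
proof -
  have w: "\<forall>d \<in> set D. wf_blk d" and d: "distinct (outs D @ a # f)" and s: "set (ins D @ b # g) \<subseteq> set (outs D @ a # f)"
    using v by (auto simp: valid_def)
  have "Tr 1 (wire (a # outs D @ f) (b # ins D @ g)) = wire (outs D @ f) (map \<sigma> (ins D @ g))"
    unfolding \<sigma>_def by (rule Tr1_wire) (use d s ab in auto)
  then show "nf (map_ins \<sigma> D) f (map \<sigma> g) = Tr 1 (nf D (a # f) (b # g))"
    unfolding Tr1_nf[OF v] by (simp add: nf_def)
  have "b \<in> set (outs D @ f)" using s ab by auto
  then show "valid (map_ins \<sigma> D) f (map \<sigma> g)" using w d s unfolding valid_def \<sigma>_def by auto
qed

text \<open>The traced input is returned as the traced output, so closing the loop removes the only
  producer of \<open>a\<close>; a block \<open>None\<close> takes over that role.\<close>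

lemma nf_Tr1_loop:
  assumes v: "valid D (a # f) (a # g)"
  shows "nf ((None, [], [a]) # D) f g = Tr 1 (nf D (a # f) (a # g))" "valid ((None, [], [a]) # D) f g"
proof -
  have w: "\<forall>d \<in> set D. wf_blk d" and d: "distinct (outs D @ a # f)" and s: "set (ins D @ a # g) \<subseteq> set (outs D @ a # f)"
    using v by (auto simp: valid_def)
  note [simp] = box_simps[OF w]
  let ?A = "length (ins D)" and ?B = "length (outs D)" and ?m = "length f" and ?n = "length g"
  let ?w = "wire (a # outs D @ f) (ins D @ g)"
  have [simp]: "arr ?w" "dom ?w = 1 + (?B + ?m)" "cod ?w = ?A + ?n" using s by auto
  have U [simp]: "arr (Tr 1 Copy)" "dom (Tr 1 Copy) = 0" "cod (Tr 1 Copy) = 1" by simp_all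
  have 1: "Tr 1 (wire (a # outs D @ f) (a # ins D @ g)) = (Tr 1 Copy \<otimes> Idn (?B + ?m)) \<cdot> ?w"
    using Tr1_wire_loop[of a "outs D @ f" "ins D @ g"] d s by auto
  have "(box D \<otimes> Idn ?m) \<cdot> ((Tr 1 Copy \<otimes> Idn (?B + ?m)) \<cdot> ?w) = (Idn 0 \<otimes> (box D \<otimes> Idn ?m)) \<cdot> (Tr 1 Copy \<otimes> Idn (?B + ?m)) \<cdot> ?w"
    by (subst comp_assoc) (simp_all del: dom_simps(5) cod_simps(5) One_nat_def)
  also have "(Idn 0 \<otimes> (box D \<otimes> Idn ?m)) \<cdot> (Tr 1 Copy \<otimes> Idn (?B + ?m)) = Tr 1 Copy \<otimes> (box D \<otimes> Idn ?m)"
    by (subst tens_comp) (simp_all del: dom_simps(5) cod_simps(5) One_nat_def)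
  finally show "nf ((None, [], [a]) # D) f g = Tr 1 (nf D (a # f) (a # g))"
    unfolding Tr1_nf[OF v] 1 by (simp add: nf_def del: One_nat_def)
  show "valid ((None, [], [a]) # D) f g" using w d s by (auto simp: valid_def)
qed

text \<open>Conjugation invariance of the trace: moving the boxes past a permutation produces
  \<open>P\<close>; its inverse \<open>Q\<close> slides round the loop and cancels it.\<close>

lemma Tr_conj:
  assumes b: "arr b" "dom b = A" "cod b = B" and b': "arr b'" "dom b' = A'" "cod b' = B'"
    and P: "arr P" "dom P = A" "cod P = A'" and Q: "arr Q" "dom Q = A'" "cod Q = A" "Q \<cdot> P = Idn A'"
    and R: "arr R" "dom R = B" "cod R = B'" "b \<cdot> R = P \<cdot> b'"
    and w: "arr w" "dom w = B' + m" "cod w = A' + n"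
  shows "Tr A ((b \<otimes> Idn m) \<cdot> ((R \<otimes> Idn m) \<cdot> w \<cdot> (Q \<otimes> Idn n))) = Tr A' ((b' \<otimes> Idn m) \<cdot> w)"
proof -
  let ?F = "(P \<otimes> Idn m) \<cdot> ((b' \<otimes> Idn m) \<cdot> w)"
  note [simp] = b b' P Q(1-3) R(1-3) w
  have "(b \<otimes> Idn m) \<cdot> ((R \<otimes> Idn m) \<cdot> w \<cdot> (Q \<otimes> Idn n)) = ((b \<otimes> Idn m) \<cdot> (R \<otimes> Idn m)) \<cdot> w \<cdot> (Q \<otimes> Idn n)"
    by (simp del: tens_comp)
  also have "(b \<otimes> Idn m) \<cdot> (R \<otimes> Idn m) = (P \<otimes> Idn m) \<cdot> (b' \<otimes> Idn m)"
    by (simp add: R)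
  also have "\<dots> \<cdot> w = ?F" by (rule comp_assoc) simp_all
  finally have "Tr A ((b \<otimes> Idn m) \<cdot> ((R \<otimes> Idn m) \<cdot> w \<cdot> (Q \<otimes> Idn n))) = Tr A (?F \<cdot> (Q \<otimes> Idn n))"
    by (simp only:)
  also have "\<dots> = Tr A' ((Q \<otimes> Idn m) \<cdot> ?F)"
    by (rule Tr_slide) simp_all
  also have "(Q \<otimes> Idn m) \<cdot> ?F = (Q \<otimes> Idn m) \<cdot> (P \<otimes> Idn m) \<cdot> ((b' \<otimes> Idn m) \<cdot> w)"
    by (rule comp_assoc[symmetric]) simp_all
  also have "(Q \<otimes> Idn m) \<cdot> (P \<otimes> Idn m) = Idn (A' + m)"
    by (simp add: Q(4))
  finally show ?thesis by simp
qed

lemma nf_swap: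
  assumes v: "valid (xs @ d # e # ys) f g"
  shows "nf (xs @ d # e # ys) f g = nf (xs @ e # d # ys) f g" "valid (xs @ e # d # ys) f g"
proof -
  show v': "valid (xs @ e # d # ys) f g" using v by (auto simp: valid_def)
  let ?D = "xs @ d # e # ys" and ?D' = "xs @ e # d # ys"
  have w: "\<forall>d \<in> set ?D. wf_blk d" and dd: "distinct (outs ?D @ f)" and s: "set (ins ?D @ g) \<subseteq> set (outs ?D @ f)"
    using v unfolding valid_def by blast+
  have w': "\<forall>d \<in> set ?D'. wf_blk d" using w by auto
  let ?i = "\<lambda>d. length (fst (snd d))" and ?o = "\<lambda>d. length (snd (snd d))"
  have bs [simp]: "arr (blk (fst d))" "dom (blk (fst d)) = ?i d" "cod (blk (fst d)) = ?o d"
     "arr (blk (fst e))" "dom (blk (fst e)) = ?i e" "cod (blk (fst e)) = ?o e"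
     "arr (box xs)" "dom (box xs) = length (ins xs)" "cod (box xs) = length (outs xs)"
     "arr (box ys)" "dom (box ys) = length (ins ys)" "cod (box ys) = length (outs ys)"
    using w blk_simps[of d] blk_simps[of e] box_simps[of xs] box_simps[of ys] by auto
  let ?m = "length f" and ?n = "length g"
  let ?Pi = "Idn (length (ins xs)) \<otimes> (Sym (?i d) (?i e) \<otimes> Idn (length (ins ys)))"
  let ?Qi = "Idn (length (ins xs)) \<otimes> (Sym (?i e) (?i d) \<otimes> Idn (length (ins ys)))"
  let ?Po = "Idn (length (outs xs)) \<otimes> (Sym (?o d) (?o e) \<otimes> Idn (length (outs ys)))"
  let ?w = "wire (outs ?D @ f) (ins ?D @ g)" and ?w' = "wire (outs ?D' @ f) (ins ?D' @ g)"
  have s': "set (ins ?D' @ g) \<subseteq> set (outs ?D' @ f)" using s by auto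
  have 1: "?w = (?Po \<otimes> Idn ?m) \<cdot> ?w' \<cdot> (?Qi \<otimes> Idn ?n)"
  proof -
    have "(?Po \<otimes> Idn ?m) \<cdot> ?w' = wire (outs ?D @ f) (ins ?D' @ g)"
      using wire_pre_swap[of "outs xs" "snd (snd d)" "snd (snd e)" "outs ys @ f" "ins ?D' @ g" "length (outs xs)" "?o d" "?o e" "length (outs ys) + ?m"]
         dd s by auto
    moreover have "wire (outs ?D @ f) (ins ?D' @ g) \<cdot> (?Qi \<otimes> Idn ?n) = ?w"
      using wire_post_swap[of "ins xs" "fst (snd e)" "fst (snd d)" "ins ys @ g" "outs ?D @ f" "length (ins xs)" "?i e" "?i d" "length (ins ys) + ?n"]
         s by auto
    ultimately show ?thesis by (simp only:)
  qed
  have 2: "box ?D = box xs \<otimes> (blk (fst d) \<otimes> (blk (fst e) \<otimes> box ys))" "box ?D' = box xs \<otimes> (blk (fst e) \<otimes> (blk (fst d) \<otimes> box ys))"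
    using w by (subst box_append; auto)+
  have 3: "box ?D \<cdot> ?Po = ?Pi \<cdot> box ?D'"
    unfolding 2 by (subst tens_Sym_mid) simp_all
  have 4: "?Qi \<cdot> ?Pi = Idn (length (ins ?D'))" by (simp add: add_ac)
  have "arr ?w'" "dom ?w' = length (outs ?D') + ?m" "cod ?w' = length (ins ?D') + ?n"
    using s' by (subst wire_simps; simp)+
  then show "nf ?D f g = nf ?D' f g"
    unfolding nf_def 1 by (intro Tr_conj[where B = "length (outs ?D)" and B' = "length (outs ?D')", OF _ _ _ _ _ _ _ _ _ _ _ _ 4 _ _ _ 3] box_simps[OF w] box_simps[OF w']) simp_all
qed

lemma nf_move:
  assumes "valid (xs @ ys @ d # zs) f g"
  shows "nf (xs @ ys @ d # zs) f g = nf (xs @ d # ys @ zs) f g \<and> valid (xs @ d # ys @ zs) f g"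
  using assms
proof (induct ys arbitrary: xs)
  case (Cons y ys)
  have "nf ((xs @ [y]) @ ys @ d # zs) f g = nf ((xs @ [y]) @ d # ys @ zs) f g \<and> valid ((xs @ [y]) @ d # ys @ zs) f g"
    by (rule Cons.hyps) (use Cons.prems in simp)
  then show ?case using nf_swap[of xs y d "ys @ zs" f g] by simp
qed simp

text \<open>Exchanges of neighbouring blocks generate all permutations. The prefix \<open>xs\<close>
  strengthens the induction: it collects the blocks already in place.\<close>

lemma nf_mset:
  assumes "mset D = mset D'" "valid D f g"
  shows "nf D f g = nf D' f g" "valid D' f g"
proof -
  have "nf (xs @ D) f g = nf (xs @ D') f g \<and> valid (xs @ D') f g" if "valid (xs @ D) f g" for xs
    using assms(1) that
  proof (induct D' arbitrary: xs D)
    case (Cons d D')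
    then have "d \<in> set D" by (metis list.set_intros(1) set_mset_mset)
    then obtain ys zs where D: "D = ys @ d # zs" by (meson split_list)
    have 1: "nf (xs @ D) f g = nf ((xs @ [d]) @ ys @ zs) f g" "valid ((xs @ [d]) @ ys @ zs) f g"
      using nf_move[of xs ys d zs f g] Cons.prems D by simp_all
    have "mset (ys @ zs) = mset D'" using Cons.prems D by simp
    from Cons.hyps[OF this 1(2)] show ?case using 1 by simp
  qed simp
  from this[of "[]"] show "nf D f g = nf D' f g" "valid D' f g" using assms by auto
qed

end

section \<open>Every traced term has a normal form\<close>

context signature begin

text \<open>Names are fixed to be natural numbers, so that fresh ones are obtained by a
  shift.\<close>

definition NF :: "'g mor \<Rightarrow> bool" where
  "NF h \<longleftrightarrow> (\<exists>D f (g :: nat list). valid D f g \<and> h = nf D f g)"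

lemma NF_arr: "NF h \<Longrightarrow> arr h"
  by (auto simp: NF_def)

lemma NF_wire: "distinct f \<Longrightarrow> set g \<subseteq> set f \<Longrightarrow> NF (wire (f :: nat list) g)"
  unfolding NF_def using nf_wire by metis

lemma NF_Idn: "NF (Idn n)"
  using NF_wire[of "[0..<n]" "[0..<n]"] by (simp add: wire_Idn)

lemma NF_Sym: "NF (Sym m n)"
proof -
  have "Sym m n = wire ([0..<m] @ [m..<m + n]) ([m..<m + n] @ [0..<m])" by (rule wire_Sym) auto
  moreover have "NF (wire ([0..<m] @ [m..<m + n]) ([m..<m + n] @ [0..<m]))" by (rule NF_wire) auto
  ultimately show ?thesis by (simp only:)
qed

lemma NF_Copy: "NF Copy" and NF_Disc: "NF Disc"
  using NF_wire[of "[0]" "[0, 0]"] NF_wire[of "[0]" "[]"] wire_Copy[of "0 :: nat"] wire_Disc[of "0 :: nat"] by simp_all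

lemma NF_Gen: "\<phi> \<in> gens S \<Longrightarrow> NF (Gen \<phi>)"
  using nf_Gen[of \<phi> "[0..<arity S \<phi>]" "[arity S \<phi>..<arity S \<phi> + coarity S \<phi>]"]
  unfolding NF_def by (simp del: upt_Suc) metis

lemma NF_comp: assumes "NF s" "NF t" "cod s = dom t" shows "NF (s \<cdot> t)"
proof -
  obtain D f g where 1: "valid D f (g :: nat list)" "s = nf D f g" using assms(1) by (auto simp: NF_def)
  obtain D' f' g' where 2: "valid D' f' (g' :: nat list)" "t = nf D' f' g'" using assms(2) by (auto simp: NF_def)
  \<comment> \<open>\<open>K\<close> exceeds every name of the first diagram, so shifting the second
    by \<open>K\<close> makes the two sets of names disjoint; \<open>insert 0\<close> covers the
    case without names.\<close>
  define K where "K = Suc (Max (insert 0 (set (outs D @ f))))"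
  have K: "x < K" if "x \<in> set (outs D @ f)" for x
    unfolding K_def using that by (auto simp: less_Suc_eq_le intro!: Max_ge)
  have inj: "inj_on ((+) K) A" for A by simp
  note 3 = nf_map[OF inj 2(1)]
  have "set (outs D @ f) \<inter> set (outs (map_diag ((+) K) D') @ map ((+) K) f') = {}"
    using K by force
  moreover have "length g = length (map ((+) K) f')" using assms(3) 1 2 by simp
  ultimately show ?thesis
    using nf_comp[OF 1(1) 3(2)] 3(1) 1(2) 2(2) unfolding NF_def by metis
qed

lemma NF_tens_Idn: assumes "NF s" shows "NF (s \<otimes> Idn k)"
proof -
  obtain D f g where 1: "valid D f (g :: nat list)" "s = nf D f g" using assms(1) by (auto simp: NF_def)
  define K where "K = Suc (Max (insert 0 (set (outs D @ f))))"
  have K: "x < K" if "x \<in> set (outs D @ f)" for x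
    unfolding K_def using that by (auto simp: less_Suc_eq_le intro!: Max_ge)
  have "distinct [K..<K + k]" "set [K..<K + k] \<inter> set (outs D @ f) = {}" using K by force+
  from nf_tens_Idn[OF 1(1) this] show ?thesis unfolding NF_def using 1(2) by (metis length_upt add_diff_cancel_left')
qed

text \<open>Whiskering on the left is whiskering on the right conjugated by symmetries, and a tensor
  is a composite of the two.\<close>

lemma NF_tens: assumes "NF s" "NF t" shows "NF (s \<otimes> t)"
proof -
  have [simp]: "arr s" "arr t" using assms NF_arr by auto
  have "(Idn (cod s) \<otimes> t) \<cdot> Sym (cod s) (cod t) \<cdot> Sym (cod t) (cod s) = Sym (cod s) (dom t) \<cdot> (t \<otimes> Idn (cod s)) \<cdot> Sym (cod t) (cod s)"
    by (subst Sym_nat[where m = "cod s" and m' = "dom t"]) simp_all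
  moreover have "(Idn (cod s) \<otimes> t) \<cdot> Sym (cod s) (cod t) \<cdot> Sym (cod t) (cod s) = Idn (cod s) \<otimes> t"
    by (subst comp_assoc) simp_all
  ultimately have "Idn (cod s) \<otimes> t = Sym (cod s) (dom t) \<cdot> (t \<otimes> Idn (cod s)) \<cdot> Sym (cod t) (cod s)"
    by (simp only:)
  then have "NF (Idn (cod s) \<otimes> t)"
    using assms by (simp only:) (intro NF_comp NF_Sym NF_tens_Idn, simp_all)
  then have "NF ((s \<otimes> Idn (dom t)) \<cdot> (Idn (cod s) \<otimes> t))"
    using assms by (intro NF_comp NF_tens_Idn) simp_all
  then show ?thesis by simp
qed

lemma NF_Tr1: assumes "NF s" "1 \<le> dom s" "1 \<le> cod s" shows "NF (Tr 1 s)"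
proof -
  obtain D f g where 1: "valid D f (g :: nat list)" "s = nf D f g" using assms(1) by (auto simp: NF_def)
  then have "1 \<le> length f" "1 \<le> length g" using assms by auto
  then obtain a f' b g' where f: "f = a # f'" "g = b # g'" by (metis One_nat_def Suc_le_length_iff)
  show ?thesis
  proof (cases "a = b")
    case True
    then show ?thesis using nf_Tr1_loop[of D a f' g'] 1 f unfolding NF_def by metis
  next
    case False
    then show ?thesis using nf_Tr1[of D a f' b g'] 1 f unfolding NF_def by metis
  qed
qed

lemma NF_Tr: "NF s \<Longrightarrow> x \<le> dom s \<Longrightarrow> x \<le> cod s \<Longrightarrow> NF (Tr x s)"
proof (induct x)
  case (Suc x)
  have "Tr 1 (Tr x s) = Tr (x + 1) s" by (rule Tr_Tr) (use Suc NF_arr in auto)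
  moreover have "NF (Tr 1 (Tr x s))" by (rule NF_Tr1) (use Suc in auto)
  ultimately show ?case by simp
qed (simp add: NF_arr)

lemma NF_cls: "ttyped S t m n \<Longrightarrow> NF (cls m n t)"
proof (induct rule: ttyped.induct)
  case (4 s l m t n)
  then show ?case using NF_comp[of "cls l m s" "cls m n t"] by (simp add: cls_comp)
next
  case (5 s m n t m' n')
  then show ?case using NF_tens[of "cls m n s" "cls m' n' t"] by (simp add: cls_tens)
next
  case (6 t x m n)
  then show ?case using NF_Tr[of "cls (x + m) (x + n) t" x] by (simp add: cls_Tr)
qed (use NF_Gen NF_Idn NF_Sym NF_Copy NF_Disc in \<open>simp_all add: Gen_def Idn_def Sym_def Copy_def Disc_def\<close>)

end

section \<open>Counting semantics of Frobenius terms\<close>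

text \<open>Arity read off the raw term, total even on ill-typed ones; it lets the matrices below be
  defined by primitive recursion without a typing derivation.\<close>

primrec fdom :: "'g msig \<Rightarrow> 'g fterm \<Rightarrow> nat" where
  "fdom S (FGen \<phi>) = arity S \<phi>"
| "fdom S (FId n) = n"
| "fdom S (FSym m n) = m + n"
| "fdom S (s ;\<^sub>F t) = fdom S s"
| "fdom S (s \<otimes>\<^sub>F t) = fdom S s + fdom S t"
| "fdom S FMerge = 2"
| "fdom S FUnit = 0"
| "fdom S FCopy = 1"
| "fdom S FCounit = 1"

primrec fcod :: "'g msig \<Rightarrow> 'g fterm \<Rightarrow> nat" where
  "fcod S (FGen \<phi>) = coarity S \<phi>"
| "fcod S (FId n) = n"
| "fcod S (FSym m n) = n + m"
| "fcod S (s ;\<^sub>F t) = fcod S t"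
| "fcod S (s \<otimes>\<^sub>F t) = fcod S s + fcod S t"
| "fcod S FMerge = 1"
| "fcod S FUnit = 1"
| "fcod S FCopy = 2"
| "fcod S FCounit = 0"

lemma ftyped_dom: "ftyped S t m n \<Longrightarrow> fdom S t = m \<and> fcod S t = n"
  by (induct rule: ftyped.induct) auto

definition tuples :: "('g, 'u) hgraph \<Rightarrow> nat \<Rightarrow> 'u list set" where
  "tuples K n = {xs. set xs \<subseteq> verts K \<and> length xs = n}"

text \<open>
  The entry of the matrix of a term at \<open>x\<close> and \<open>y\<close>, meaningful only for lists of the right lengths.
\<close>

primrec cnt :: "'g msig \<Rightarrow> ('g, 'u) hgraph \<Rightarrow> 'g fterm \<Rightarrow> 'u list \<Rightarrow> 'u list \<Rightarrow> nat" where
  "cnt S K (FGen \<phi>) x y = card {e \<in> edges K. lab K e = \<phi> \<and> src K e = x \<and> tgt K e = y}"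
| "cnt S K (FId n) x y = of_bool (x = y)"
| "cnt S K (FSym m n) x y = of_bool (y = drop m x @ take m x)"
| "cnt S K (s ;\<^sub>F t) x y = (\<Sum>z\<in>tuples K (fcod S s). cnt S K s x z * cnt S K t z y)"
| "cnt S K (s \<otimes>\<^sub>F t) x y = cnt S K s (take (fdom S s) x) (take (fcod S s) y) *
     cnt S K t (drop (fdom S s) x) (drop (fcod S s) y)"
| "cnt S K FMerge x y = of_bool (x = [hd y, hd y])"
| "cnt S K FUnit x y = 1"
| "cnt S K FCopy x y = of_bool (y = [hd x, hd x])"
| "cnt S K FCounit x y = 1"

lemma tuples_0 [simp]: "tuples K 0 = {[]}"
  by (auto simp: tuples_def)

lemma tuples_length: "x \<in> tuples K n \<Longrightarrow> length x = n"
  by (simp add: tuples_def)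

lemma tuples_Cons [simp]: "v # x \<in> tuples K n \<longleftrightarrow> v \<in> verts K \<and> 0 < n \<and> x \<in> tuples K (n - 1)"
  by (cases n) (auto simp: tuples_def)

lemma tuples_append: "x \<in> tuples K m \<Longrightarrow> y \<in> tuples K n \<Longrightarrow> x @ y \<in> tuples K (m + n)"
  by (auto simp: tuples_def)

lemma tuples_append_iff: "length x = m \<Longrightarrow> x @ y \<in> tuples K (m + n) \<longleftrightarrow> x \<in> tuples K m \<and> y \<in> tuples K n"
  by (auto simp: tuples_def)

lemma tuples_addE:
  assumes "x \<in> tuples K (m + n)"
  obtains a b where "x = a @ b" "a \<in> tuples K m" "b \<in> tuples K n"
proof
  show "x = take m x @ drop m x" by simp
  show "take m x \<in> tuples K m" "drop m x \<in> tuples K n"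
    using assms by (auto simp: tuples_def dest: in_set_takeD in_set_dropD)
qed

lemma tuples_SucE:
  assumes "x \<in> tuples K (Suc n)"
  obtains v a where "x = v # a" "v \<in> verts K" "a \<in> tuples K n"
  using assms by (cases x) (auto simp: tuples_def)

lemma finite_tuples [simp]: "finite (verts K) \<Longrightarrow> finite (tuples K n)"
  unfolding tuples_def by (rule finite_lists_length_eq)

lemma sum_tuples_add:
  assumes "finite (verts K)"
  shows "(\<Sum>z\<in>tuples K (m + n). F z) = (\<Sum>a\<in>tuples K m. \<Sum>b\<in>tuples K n. F (a @ b))"
proof -
  have "(\<Sum>a\<in>tuples K m. \<Sum>b\<in>tuples K n. F (a @ b)) = (\<Sum>(a, b)\<in>tuples K m \<times> tuples K n. F (a @ b))"
    by (rule sum.cartesian_product)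
  also have "\<dots> = (\<Sum>z\<in>tuples K (m + n). F z)"
    by (rule sum.reindex_bij_witness[where i = "\<lambda>z. (take m z, drop m z)" and j = "\<lambda>(a, b). a @ b"])
      (auto simp: tuples_def dest: in_set_takeD in_set_dropD)
  finally show ?thesis ..
qed

lemma sum_tuples_Suc:
  assumes "finite (verts K)"
  shows "(\<Sum>z\<in>tuples K (Suc n). F z) = (\<Sum>v\<in>verts K. \<Sum>b\<in>tuples K n. F (v # b))"
proof -
  have "(\<Sum>v\<in>verts K. \<Sum>b\<in>tuples K n. F (v # b)) = (\<Sum>(v, b)\<in>verts K \<times> tuples K n. F (v # b))"
    by (rule sum.cartesian_product)
  also have "\<dots> = (\<Sum>z\<in>tuples K (Suc n). F z)"
    by (rule sum.reindex_bij_witness[where i = "\<lambda>z. (hd z, tl z)" and j = "\<lambda>(a, b). a # b"])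
      (auto simp: tuples_def neq_Nil_conv length_Suc_conv dest: list.set_sel(2))
  finally show ?thesis ..
qed

lemma sum_delta_bool:
  fixes F :: "'a \<Rightarrow> nat"
  assumes "finite A"
  shows "(\<Sum>z\<in>A. of_bool (x = z) * F z) = of_bool (x \<in> A) * F x"
    "(\<Sum>z\<in>A. of_bool (z = x) * F z) = of_bool (x \<in> A) * F x"
    "(\<Sum>z\<in>A. F z * of_bool (x = z)) = of_bool (x \<in> A) * F x"
    "(\<Sum>z\<in>A. F z * of_bool (z = x)) = of_bool (x \<in> A) * F x"
  using assms by (simp_all add: of_bool_def if_distrib[of "\<lambda>n. n * _"] if_distrib[of "\<lambda>n. _ * n"] cong: if_cong)

lemma sum_delta_bool':
  fixes F G H :: "'a \<Rightarrow> nat"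
  assumes "finite A"
  shows "(\<Sum>z\<in>A. F z * (of_bool (x = z) * G z)) = of_bool (x \<in> A) * (F x * G x)"
    "(\<Sum>z\<in>A. F z * (of_bool (z = x) * G z)) = of_bool (x \<in> A) * (F x * G x)"
    "(\<Sum>z\<in>A. F z * (G z * of_bool (x = z))) = of_bool (x \<in> A) * (F x * G x)"
    "(\<Sum>z\<in>A. F z * (G z * of_bool (z = x))) = of_bool (x \<in> A) * (F x * G x)"
    "(\<Sum>z\<in>A. F z * (G z * (of_bool (x = z) * H z))) = of_bool (x \<in> A) * (F x * (G x * H x))"
    "(\<Sum>z\<in>A. F z * (G z * (of_bool (z = x) * H z))) = of_bool (x \<in> A) * (F x * (G x * H x))"
    "(\<Sum>z\<in>A. of_bool (x = z)) = (of_bool (x \<in> A) :: nat)"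
    "(\<Sum>z\<in>A. of_bool (z = x)) = (of_bool (x \<in> A) :: nat)"
  using sum_delta_bool(1,2)[OF assms, of x "\<lambda>z. F z * G z"] sum_delta_bool(1,2)[OF assms, of x "\<lambda>z. F z * (G z * H z)"]
    sum_delta_bool(1,2)[OF assms, of x "\<lambda>z. 1"]
  by (simp_all add: mult_ac)

lemma ftyped_iff [simp]:
  "ftyped S (FGen \<phi>) m n \<longleftrightarrow> \<phi> \<in> gens S \<and> m = arity S \<phi> \<and> n = coarity S \<phi>"
  "ftyped S (FId k) m n \<longleftrightarrow> m = k \<and> n = k"
  "ftyped S (FSym i j) m n \<longleftrightarrow> m = i + j \<and> n = j + i"
  "ftyped S (s ;\<^sub>F t) m n \<longleftrightarrow> (\<exists>k. ftyped S s m k \<and> ftyped S t k n)"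
  "ftyped S (s \<otimes>\<^sub>F t) m n \<longleftrightarrow>
     (\<exists>i j i' j'. ftyped S s i j \<and> ftyped S t i' j' \<and> m = i + i' \<and> n = j + j')"
  "ftyped S FMerge m n \<longleftrightarrow> m = 2 \<and> n = 1"
  "ftyped S FUnit m n \<longleftrightarrow> m = 0 \<and> n = 1"
  "ftyped S FCopy m n \<longleftrightarrow> m = 1 \<and> n = 2"
  "ftyped S FCounit m n \<longleftrightarrow> m = 1 \<and> n = 0"
  by ((subst ftyped.simps, force)+)

lemma feq_typed: "feq S m n s t \<Longrightarrow> ftyped S s m n \<and> ftyped S t m n"
proof (induction rule: feq.induct)
qed (simp_all, (metis add.assoc add.commute add.left_commute one_add_one)+)

context
  fixes S :: "'g msig" and K :: "('g, 'u) hgraph"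
  assumes fin [simp]: "finite (verts K)"
begin

lemma cnt_tens [simp]:
  "length a = fdom S s \<Longrightarrow> length c = fcod S s \<Longrightarrow> cnt S K (s \<otimes>\<^sub>F t) (a @ b) (c @ d) = cnt S K s a c * cnt S K t b d"
  by simp

lemma cnt_Seq_Id_left: "x \<in> tuples K m \<Longrightarrow> cnt S K (FId m ;\<^sub>F t) x y = cnt S K t x y"
  by (simp add: sum_delta_bool)

lemma cnt_Seq_Id_right: "fcod S t = n \<Longrightarrow> y \<in> tuples K n \<Longrightarrow> cnt S K (t ;\<^sub>F FId n) x y = cnt S K t x y"
  by (simp add: sum_delta_bool)

lemma cnt_Seq_assoc: "cnt S K ((s ;\<^sub>F t) ;\<^sub>F u) x y = cnt S K (s ;\<^sub>F (t ;\<^sub>F u)) x y"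
proof -
  have "cnt S K ((s ;\<^sub>F t) ;\<^sub>F u) x y = (\<Sum>z\<in>tuples K (fcod S t). \<Sum>w\<in>tuples K (fcod S s). cnt S K s x w * cnt S K t w z * cnt S K u z y)"
    by (simp add: sum_distrib_right)
  also have "\<dots> = cnt S K (s ;\<^sub>F (t ;\<^sub>F u)) x y"
    by (subst sum.swap) (simp add: sum_distrib_left mult.assoc)
  finally show ?thesis .
qed

lemma cnt_interchange:
  assumes "ftyped S s l m" "ftyped S t m n" "ftyped S s' l' m'" "ftyped S t' m' n'"
    "x \<in> tuples K (l + l')" "y \<in> tuples K (n + n')"
  shows "cnt S K ((s ;\<^sub>F t) \<otimes>\<^sub>F (s' ;\<^sub>F t')) x y = cnt S K ((s \<otimes>\<^sub>F s') ;\<^sub>F (t \<otimes>\<^sub>F t')) x y"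
proof -
  note [simp] = ftyped_dom[OF assms(1)] ftyped_dom[OF assms(2)] ftyped_dom[OF assms(3)] ftyped_dom[OF assms(4)]
  obtain a b where x: "x = a @ b" "a \<in> tuples K l" "b \<in> tuples K l'" using tuples_addE[OF assms(5)] .
  obtain c d where y: "y = c @ d" "c \<in> tuples K n" "d \<in> tuples K n'" using tuples_addE[OF assms(6)] .
  note [simp] = tuples_length[OF x(2)] tuples_length[OF y(2)]
  show ?thesis unfolding x(1) y(1)
    by (simp add: sum_tuples_add sum_product tuples_length mult_ac)
qed

lemma cnt_Sym_nat:
  assumes "ftyped S s m n" "ftyped S t m' n'" "x \<in> tuples K (m + m')" "y \<in> tuples K (n' + n)"
  shows "cnt S K ((s \<otimes>\<^sub>F t) ;\<^sub>F FSym n n') x y = cnt S K (FSym m m' ;\<^sub>F (t \<otimes>\<^sub>F s)) x y"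
proof -
  note [simp] = ftyped_dom[OF assms(1)] ftyped_dom[OF assms(2)]
  obtain a b where x: "x = a @ b" "a \<in> tuples K m" "b \<in> tuples K m'" using tuples_addE[OF assms(3)] .
  obtain c d where y: "y = c @ d" "c \<in> tuples K n'" "d \<in> tuples K n" using tuples_addE[OF assms(4)] .
  note [simp] = tuples_length[OF x(2)] tuples_length[OF y(2)] tuples_length[OF x(3)] tuples_length[OF y(3)]
  have 1: "(\<Sum>z\<in>tuples K (n + n'). F z * of_bool (c @ d = drop n z @ take n z)) = F (d @ c)" for F :: "'u list \<Rightarrow> nat"
  proof -
    have "(\<Sum>z\<in>tuples K (n + n'). F z * of_bool (c @ d = drop n z @ take n z)) = (\<Sum>z\<in>tuples K (n + n'). F z * of_bool (z = d @ c))"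
    proof (rule sum.cong)
      fix z assume "z \<in> tuples K (n + n')"
      then obtain p q where "z = p @ q" "p \<in> tuples K n" "q \<in> tuples K n'" by (rule tuples_addE)
      then show "F z * of_bool (c @ d = drop n z @ take n z) = F z * of_bool (z = d @ c)"
        by (auto simp: tuples_length)
    qed simp
    then show ?thesis using y by (simp add: sum_delta_bool tuples_append)
  qed
  show ?thesis unfolding x(1) y(1)
    using 1 x y by (simp add: sum_delta_bool tuples_append)
qed

text \<open>Structural axioms become rearrangements of finite sums and splittings of index tuples;
  the Frobenius structure has delta matrices, so its laws reduce to equalities between
  indices.\<close>

lemma feq_cnt: "feq S m n s t \<Longrightarrow> x \<in> tuples K m \<Longrightarrow> y \<in> tuples K n \<Longrightarrow> cnt S K s x y = cnt S K t x y"
proof (induction arbitrary: x y rule: feq.induct)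
  case (feq_Seq l m s s' t n t')
  then show ?case using ftyped_dom feq_typed by (metis (no_types, lifting) cnt.simps(4) sum.cong)
next
  case (feq_Tens m n s s' m' n' t t')
  have e: "fdom S s = m" "fdom S s' = m" "fcod S s = n" "fcod S s' = n"
    using feq_typed[OF feq_Tens(1)] ftyped_dom by blast+
  obtain a b where x: "x = a @ b" "a \<in> tuples K m" "b \<in> tuples K m'" using tuples_addE[OF feq_Tens(5)] .
  obtain c d where y: "y = c @ d" "c \<in> tuples K n" "d \<in> tuples K n'" using tuples_addE[OF feq_Tens(6)] .
  show ?case using feq_Tens.IH x y e by (simp add: tuples_length)
next
  case (feq_id_left t m n) then show ?case using cnt_Seq_Id_left by metis
next
  case (feq_id_right t m n) then show ?case using cnt_Seq_Id_right ftyped_dom by metis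
next
  case (feq_seq_assoc s k l t m u n) then show ?case using cnt_Seq_assoc by metis
next
  case (feq_tens_id m n)
  then show ?case by (elim tuples_addE) (simp add: tuples_length)
next
  case (feq_interchange s l m t n s' l' m' t' n') then show ?case using cnt_interchange by metis
next
  case (feq_tens_assoc s m n t m' n' u m'' n'')
  note e = ftyped_dom[OF feq_tens_assoc(1)] ftyped_dom[OF feq_tens_assoc(2)]
  show ?case using feq_tens_assoc(4,5) by (elim tuples_addE) (simp add: tuples_length e mult.assoc)
next
  case (feq_sym_natural s m n t m' n') then show ?case using cnt_Sym_nat by metis
next
  case (feq_sym_inverse m n)
  then show ?case by (elim tuples_addE) (auto simp: tuples_length sum_delta_bool tuples_append)
next
  case (feq_sym_hexagon m n p)
  obtain a b c where x: "x = (a @ b) @ c" "a \<in> tuples K m" "b \<in> tuples K n" "c \<in> tuples K p"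
    using feq_sym_hexagon(1) by (metis tuples_addE)
  have "(\<Sum>z\<in>tuples K (m + (p + n)). of_bool (a = take m z \<and> drop m z = c @ b) * F z) = F (a @ c @ b)" for F :: "'u list \<Rightarrow> nat"
  proof -
    have "(\<Sum>z\<in>tuples K (m + (p + n)). of_bool (a = take m z \<and> drop m z = c @ b) * F z) = (\<Sum>z\<in>tuples K (m + (p + n)). of_bool (z = a @ c @ b) * F z)"
    proof (rule sum.cong)
      fix z assume "z \<in> tuples K (m + (p + n))"
      then obtain p' q where "z = p' @ q" "p' \<in> tuples K m" "q \<in> tuples K (p + n)" by (rule tuples_addE)
      then show "of_bool (a = take m z \<and> drop m z = c @ b) * F z = of_bool (z = a @ c @ b) * F z"
        using x by (auto simp: tuples_length)
    qed simp
    then show ?thesis using x by (simp add: sum_delta_bool tuples_append)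
  qed
  note * = this[unfolded of_bool_conj]
  obtain d d' e where y: "y = (d @ d') @ e" "d \<in> tuples K p" "d' \<in> tuples K m" "e \<in> tuples K n"
    using feq_sym_hexagon(2) by (metis tuples_addE)
  show ?case using x y by (simp add: * tuples_length) (auto simp: tuples_length)
next
  case (feq_tens_unit_right t m n)
  then show ?case using ftyped_dom[OF feq_tens_unit_right(1)] by (simp add: tuples_length)
\<comment> \<open>The laws of the algebra live on at most three wires, so their index tuples can be
  written out entry by entry.\<close>
qed (simp_all del: sum_of_bool_eq sum_mult_of_bool_eq sum_of_bool_mult_eq,
  (auto elim!: tuples_SucE simp: numeral_eq_Suc sum_tuples_Suc sum_delta_bool sum_delta_bool' of_bool_conj
    simp del: sum_of_bool_eq sum_mult_of_bool_eq sum_of_bool_mult_eq)+)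

end

section \<open>Counting the canonical trace\<close>

lemma sum_delta_on:
  fixes f g :: "'a \<Rightarrow> nat"
  assumes "finite A" "c \<in> A" "\<And>z. z \<in> A \<Longrightarrow> f z = of_bool (z = c)"
  shows "(\<Sum>z\<in>A. f z * g z) = g c" "(\<Sum>z\<in>A. g z * f z) = g c"
proof -
  have "(\<Sum>z\<in>A. f z * g z) = (\<Sum>z\<in>A. of_bool (z = c) * g z)"
    using assms by (intro sum.cong) auto
  then show "(\<Sum>z\<in>A. f z * g z) = g c" using assms by (simp add: sum_delta_bool)
  then show "(\<Sum>z\<in>A. g z * f z) = g c" by (simp add: mult.commute)
qed

lemma fdom_structure [simp]:
  "fdom S (merges x) = x + x" "fcod S (merges x) = x" "fdom S (units x) = 0" "fcod S (units x) = x"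
  "fdom S (copies x) = x" "fcod S (copies x) = x + x" "fdom S (counits x) = x" "fcod S (counits x) = 0"
  by (induct x) auto

context
  fixes S :: "'g msig" and K :: "('g, 'u) hgraph"
  assumes fin [simp]: "finite (verts K)"
begin

lemma cnt_units: "w \<in> tuples K x \<Longrightarrow> cnt S K (units x) [] w = 1"
proof (induct x arbitrary: w)
  case (Suc x)
  from Suc(2) obtain w' p where "w = w' @ p" "w' \<in> tuples K x" "p \<in> tuples K 1"
    using tuples_addE[of w K x 1] by auto
  then show ?case using Suc(1)[of w'] by (simp add: tuples_length)
qed simp

lemma cnt_counits: "w \<in> tuples K x \<Longrightarrow> cnt S K (counits x) w [] = 1"
proof (induct x arbitrary: w)
  case (Suc x)
  from Suc(2) obtain w' p where "w = w' @ p" "w' \<in> tuples K x" "p \<in> tuples K 1"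
    using tuples_addE[of w K x 1] by auto
  then show ?case using Suc(1)[of w'] by (simp add: tuples_length)
qed simp

lemma cnt_shuffle:
  assumes "u \<in> tuples K x" "p \<in> tuples K y" "v \<in> tuples K z" "q \<in> tuples K w" "r \<in> tuples K (x + (z + y) + w)"
  shows "cnt S K (FId x \<otimes>\<^sub>F FSym y z \<otimes>\<^sub>F FId w) (u @ p @ v @ q) r = of_bool (r = u @ v @ p @ q)"
proof -
  obtain a b b' c where "r = (a @ (b @ b')) @ c" "a \<in> tuples K x" "b \<in> tuples K z" "b' \<in> tuples K y" "c \<in> tuples K w"
    using assms(5) by (metis tuples_addE)
  then show ?thesis using assms by (auto simp: tuples_length)
qed

text \<open>The shuffle brings the two last coordinates together, where \<open>FMerge\<close>
  compares them; the induction handles the others.\<close>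

lemma cnt_merges:
  "u \<in> tuples K x \<Longrightarrow> v \<in> tuples K x \<Longrightarrow> w \<in> tuples K x \<Longrightarrow> cnt S K (merges x) (u @ v) w = of_bool (u = w \<and> v = w)"
proof (induct x arbitrary: u v w)
  case (Suc x)
  obtain u' p where u: "u = u' @ p" "u' \<in> tuples K x" "p \<in> tuples K 1"
    using tuples_addE[of u K x 1] Suc.prems by auto
  obtain v' q where v: "v = v' @ q" "v' \<in> tuples K x" "q \<in> tuples K 1"
    using tuples_addE[of v K x 1] Suc.prems by auto
  obtain w' r where w: "w = w' @ r" "w' \<in> tuples K x" "r \<in> tuples K 1"
    using tuples_addE[of w K x 1] Suc.prems by auto
  have "cnt S K (merges (Suc x)) (u @ v) w = cnt S K (merges x \<otimes>\<^sub>F FMerge) (u' @ v' @ p @ q) w"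
    unfolding u v merges.simps cnt.simps(4) append_assoc
  proof (rule sum_delta_on(1))
    fix z assume "z \<in> tuples K (fcod S (FId x \<otimes>\<^sub>F FSym 1 x \<otimes>\<^sub>F FId 1))"
    then show "cnt S K (FId x \<otimes>\<^sub>F FSym 1 x \<otimes>\<^sub>F FId 1) (u' @ p @ v' @ q) z = of_bool (z = u' @ v' @ p @ q)"
      using u v by (intro cnt_shuffle) simp_all
  next
    show "finite (tuples K (fcod S (FId x \<otimes>\<^sub>F FSym 1 x \<otimes>\<^sub>F FId 1)))" by simp
  qed (use u v in \<open>auto simp: tuples_def\<close>)
  then show ?case using Suc.hyps[of u' v' w'] u v w
    by (auto simp: tuples_length elim!: tuples_SucE)
qed simp

lemma cnt_copies:
  "u \<in> tuples K x \<Longrightarrow> v \<in> tuples K x \<Longrightarrow> w \<in> tuples K x \<Longrightarrow> cnt S K (copies x) w (u @ v) = of_bool (u = w \<and> v = w)"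
proof (induct x arbitrary: u v w)
  case (Suc x)
  obtain u' p where u: "u = u' @ p" "u' \<in> tuples K x" "p \<in> tuples K 1"
    using tuples_addE[of u K x 1] Suc.prems by auto
  obtain v' q where v: "v = v' @ q" "v' \<in> tuples K x" "q \<in> tuples K 1"
    using tuples_addE[of v K x 1] Suc.prems by auto
  obtain w' r where w: "w = w' @ r" "w' \<in> tuples K x" "r \<in> tuples K 1"
    using tuples_addE[of w K x 1] Suc.prems by auto
  have "cnt S K (copies (Suc x)) w (u @ v) = cnt S K (copies x \<otimes>\<^sub>F FCopy) w (u' @ v' @ p @ q)"
    unfolding u v copies.simps cnt.simps(4) append_assoc
  proof (rule sum_delta_on(2))
    fix z assume "z \<in> tuples K (fcod S (copies x \<otimes>\<^sub>F FCopy))"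
    then have "z \<in> tuples K (x + (x + 1) + 1)" by (simp add: numeral_2_eq_2)
    then obtain a b c d where z: "z = (a @ (b @ c)) @ d" "a \<in> tuples K x" "b \<in> tuples K x" "c \<in> tuples K 1" "d \<in> tuples K 1"
      by (metis tuples_addE)
    have "cnt S K (FId x \<otimes>\<^sub>F FSym x 1 \<otimes>\<^sub>F FId 1) (a @ b @ c @ d) (u' @ p @ v' @ q) = of_bool (u' @ p @ v' @ q = a @ c @ b @ d)"
      using z u v by (intro cnt_shuffle) (auto simp: tuples_def)
    then show "cnt S K (FId x \<otimes>\<^sub>F FSym x 1 \<otimes>\<^sub>F FId 1) z (u' @ p @ v' @ q) = of_bool (z = u' @ v' @ p @ q)"
      using z u v by (auto simp: tuples_length simp del: cnt.simps)
  next
    show "finite (tuples K (fcod S (copies x \<otimes>\<^sub>F FCopy)))" by simp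
  qed (use u v in \<open>auto simp: tuples_def\<close>)
  then show ?case using Suc.hyps[of u' v' w'] u v w
    by (auto simp: tuples_length elim!: tuples_SucE)
qed simp

lemma cnt_cup: "u \<in> tuples K x \<Longrightarrow> v \<in> tuples K x \<Longrightarrow> cnt S K (cup x) [] (u @ v) = of_bool (u = v)"
proof -
  assume a: "u \<in> tuples K x" "v \<in> tuples K x"
  have "cnt S K (cup x) [] (u @ v) = (\<Sum>w\<in>tuples K x. of_bool (w = u) * of_bool (v = w))"
    unfolding cup_def cnt.simps(4) by (rule sum.cong) (use a in \<open>auto simp: cnt_units cnt_copies\<close>)
  also have "\<dots> = of_bool (u = v)" by (subst sum_delta_bool) (use a in auto)
  finally show ?thesis .
qed

lemma cnt_cap: "u \<in> tuples K x \<Longrightarrow> v \<in> tuples K x \<Longrightarrow> cnt S K (cap x) (u @ v) [] = of_bool (u = v)"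
proof -
  assume a: "u \<in> tuples K x" "v \<in> tuples K x"
  have "cnt S K (cap x) (u @ v) [] = (\<Sum>w\<in>tuples K x. of_bool (w = u) * of_bool (v = w))"
    unfolding cap_def cnt.simps(4) by (rule sum.cong) (use a in \<open>auto simp: cnt_counits cnt_merges\<close>)
  also have "\<dots> = of_bool (u = v)" by (subst sum_delta_bool) (use a in auto)
  finally show ?thesis .
qed

lemma fdom_cup [simp]: "fdom S (cup x) = 0" "fcod S (cup x) = x + x" "fdom S (cap x) = x + x" "fcod S (cap x) = 0"
  by (simp_all add: cup_def cap_def)

text \<open>The cup supplies two equal copies of the loop tuple and the cap compares one of them
  with the loop output. All other sums collapse and the partial trace of the matrix remains.\<close>

lemma cnt_trace:
  assumes "fdom S h = x + m" "fcod S h = x + n" "a \<in> tuples K m" "b \<in> tuples K n"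
  shows "cnt S K (canonical_trace x m n h) a b = (\<Sum>z\<in>tuples K x. cnt S K h (z @ a) (z @ b))"
proof -
  have 1: "cnt S K ((cup x \<otimes>\<^sub>F FId m) ;\<^sub>F (FId x \<otimes>\<^sub>F h)) a (p @ q @ r) = cnt S K h (p @ a) (q @ r)"
    if "p \<in> tuples K x" "q \<in> tuples K x" "r \<in> tuples K n" for p q r
  proof -
    have "cnt S K ((cup x \<otimes>\<^sub>F FId m) ;\<^sub>F (FId x \<otimes>\<^sub>F h)) a (p @ q @ r) =
      (\<Sum>u\<in>tuples K x. \<Sum>v\<in>tuples K x. \<Sum>w\<in>tuples K m. of_bool (u = v) * of_bool (a = w) * (of_bool (u = p) * cnt S K h (v @ w) (q @ r)))"
      unfolding cnt.simps(4)
      by (simp add: sum_tuples_add, intro sum.cong refl) (use that assms in \<open>simp_all add: tuples_length cnt_cup\<close>)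
    also have "\<dots> = (\<Sum>u\<in>tuples K x. \<Sum>v\<in>tuples K x. of_bool (u = v) * (of_bool (u = p) * cnt S K h (v @ a) (q @ r)))"
      using assms by (intro sum.cong refl) (simp add: mult.assoc sum_delta_bool' del: sum_of_bool_mult_eq sum_mult_of_bool_eq)
    also have "\<dots> = (\<Sum>u\<in>tuples K x. of_bool (u = p) * cnt S K h (u @ a) (q @ r))"
      by (intro sum.cong refl) (simp add: sum_delta_bool del: sum_of_bool_mult_eq sum_mult_of_bool_eq)
    also have "\<dots> = cnt S K h (p @ a) (q @ r)"
      using that by (subst sum_delta_bool) auto
    finally show ?thesis .
  qed
  have "cnt S K (canonical_trace x m n h) a b =
    (\<Sum>p\<in>tuples K x. \<Sum>q\<in>tuples K x. \<Sum>r\<in>tuples K n. cnt S K h (p @ a) (q @ r) * (of_bool (p = q) * of_bool (r = b)))"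
    unfolding canonical_trace_def cnt.simps(4)[of _ _ "_ ;\<^sub>F _"]
    using assms
    by (simp add: sum_tuples_add add.assoc del: cnt.simps, intro sum.cong refl)
      (subst 1, simp_all add: tuples_length cnt_cap)
  also have "\<dots> = (\<Sum>p\<in>tuples K x. \<Sum>q\<in>tuples K x. of_bool (p = q) * cnt S K h (p @ a) (q @ b))"
    using assms by (intro sum.cong refl) (simp add: sum_delta_bool' mult_ac del: sum_of_bool_mult_eq sum_mult_of_bool_eq)
  also have "\<dots> = (\<Sum>p\<in>tuples K x. cnt S K h (p @ a) (p @ b))"
    by (intro sum.cong refl) (simp add: sum_delta_bool del: sum_of_bool_mult_eq sum_mult_of_bool_eq)
  finally show ?thesis .
qed

text \<open>The cup is a Kronecker delta, so bending the inputs only regroups the indices of the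
  matrix.\<close>

lemma cnt_fold:
  assumes "fdom S t = m" "fcod S t = n" "a \<in> tuples K m" "b \<in> tuples K n"
  shows "cnt S K (fold_term m t) [] (a @ b) = cnt S K t a b"
proof -
  have "cnt S K (fold_term m t) [] (a @ b) = (\<Sum>u\<in>tuples K m. \<Sum>v\<in>tuples K m. of_bool (u = v) * (of_bool (u = a) * cnt S K t v b))"
    unfolding fold_term_def cnt.simps(4) using assms
    by (simp add: sum_tuples_add del: sum_of_bool_mult_eq sum_mult_of_bool_eq, intro sum.cong refl)
      (simp_all add: tuples_length cnt_cup)
  also have "\<dots> = (\<Sum>u\<in>tuples K m. of_bool (u = a) * cnt S K t u b)"
    by (intro sum.cong refl) (simp add: sum_delta_bool del: sum_of_bool_mult_eq sum_mult_of_bool_eq)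
  also have "\<dots> = cnt S K t a b"
    using assms by (subst sum_delta_bool) auto
  finally show ?thesis .
qed

end

lemma ftyped_structure [simp]:
  "ftyped S (merges x) m n \<longleftrightarrow> m = x + x \<and> n = x" "ftyped S (units x) m n \<longleftrightarrow> m = 0 \<and> n = x"
  "ftyped S (copies x) m n \<longleftrightarrow> m = x \<and> n = x + x" "ftyped S (counits x) m n \<longleftrightarrow> m = x \<and> n = 0"
  by (induct x arbitrary: m n) auto

lemma ftyped_trace: "ftyped S h (x + m) (x + n) \<Longrightarrow> ftyped S (canonical_trace x m n h) m n"
  by (force simp: canonical_trace_def cup_def cap_def simp flip: add.assoc)

lemma ftyped_fold: "ftyped S h m n \<Longrightarrow> ftyped S (fold_term m h) 0 (m + n)"
  by (force simp: fold_term_def cup_def)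

lemma ttyped_IC: "ttyped S t m n \<Longrightarrow> ftyped S (IC t) m n"
  by (induct rule: ttyped.induct) (auto intro: ftyped_trace)

section \<open>Soundness for traced terms\<close>

lemma fdom_trace [simp]: "fdom S (canonical_trace x m n h) = m" "fcod S (canonical_trace x m n h) = n"
  by (simp_all add: canonical_trace_def cup_def cap_def)

lemma IC_dom: "ttyped S t m n \<Longrightarrow> fdom S (IC t) = m \<and> fcod S (IC t) = n"
  using ftyped_dom ttyped_IC by blast

context
  fixes S :: "'g msig" and K :: "('g, 'u) hgraph"
  assumes fin [simp]: "finite (verts K)"
begin

text \<open>The identity strand contributes a delta, which removes one summation. The variants of
  this lemma serve tightening, sliding and the rewriting context.\<close>

lemma cnt_whisker_right:
  assumes "z \<in> tuples K x" "length a = fdom S s"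
  shows "cnt S K ((FId x \<otimes>\<^sub>F s) ;\<^sub>F t) (z @ a) q = (\<Sum>p\<in>tuples K (fcod S s). cnt S K s a p * cnt S K t (z @ p) q)"
proof -
  have "cnt S K ((FId x \<otimes>\<^sub>F s) ;\<^sub>F t) (z @ a) q =
     (\<Sum>u\<in>tuples K x. \<Sum>p\<in>tuples K (fcod S s). of_bool (z = u) * (cnt S K s a p * cnt S K t (u @ p) q))"
    using assms by (simp add: sum_tuples_add del: sum_of_bool_mult_eq sum_mult_of_bool_eq)
      (intro sum.cong refl, simp_all add: tuples_length)
  also have "\<dots> = (\<Sum>u\<in>tuples K x. of_bool (z = u) * (\<Sum>p\<in>tuples K (fcod S s). cnt S K s a p * cnt S K t (u @ p) q))"
    by (simp add: sum_distrib_left)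
  also have "\<dots> = (\<Sum>p\<in>tuples K (fcod S s). cnt S K s a p * cnt S K t (z @ p) q)"
    using assms by (subst sum_delta_bool) auto
  finally show ?thesis .
qed

lemma cnt_whisker_right':
  assumes "z \<in> tuples K x" "length b = fcod S s" "fcod S t = x + fdom S s"
  shows "cnt S K (t ;\<^sub>F (FId x \<otimes>\<^sub>F s)) q (z @ b) = (\<Sum>p\<in>tuples K (fdom S s). cnt S K t q (z @ p) * cnt S K s p b)"
proof -
  have "cnt S K (t ;\<^sub>F (FId x \<otimes>\<^sub>F s)) q (z @ b) =
     (\<Sum>u\<in>tuples K x. \<Sum>p\<in>tuples K (fdom S s). of_bool (u = z) * (cnt S K t q (u @ p) * cnt S K s p b))"
    using assms by (simp add: sum_tuples_add del: sum_of_bool_mult_eq sum_mult_of_bool_eq)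
      (intro sum.cong refl, simp_all add: tuples_length)
  also have "\<dots> = (\<Sum>u\<in>tuples K x. of_bool (u = z) * (\<Sum>p\<in>tuples K (fdom S s). cnt S K t q (u @ p) * cnt S K s p b))"
    by (simp add: sum_distrib_left)
  also have "\<dots> = (\<Sum>p\<in>tuples K (fdom S s). cnt S K t q (z @ p) * cnt S K s p b)"
    using assms by (subst sum_delta_bool) auto
  finally show ?thesis .
qed

lemma cnt_whisker_left:
  assumes "a \<in> tuples K x" "length z = fdom S s"
  shows "cnt S K ((s \<otimes>\<^sub>F FId x) ;\<^sub>F t) (z @ a) q = (\<Sum>p\<in>tuples K (fcod S s). cnt S K s z p * cnt S K t (p @ a) q)"
proof -
  have "cnt S K ((s \<otimes>\<^sub>F FId x) ;\<^sub>F t) (z @ a) q =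
     (\<Sum>p\<in>tuples K (fcod S s). \<Sum>u\<in>tuples K x. of_bool (a = u) * (cnt S K s z p * cnt S K t (p @ u) q))"
    using assms by (simp add: sum_tuples_add del: sum_of_bool_mult_eq sum_mult_of_bool_eq)
      (intro sum.cong refl, simp_all add: tuples_length)
  also have "\<dots> = (\<Sum>p\<in>tuples K (fcod S s). cnt S K s z p * cnt S K t (p @ a) q)"
    using assms by (intro sum.cong refl) (subst sum_delta_bool, auto)
  finally show ?thesis .
qed

lemma cnt_whisker_left':
  assumes "b \<in> tuples K x" "length z = fcod S s" "fcod S t = fdom S s + x"
  shows "cnt S K (t ;\<^sub>F (s \<otimes>\<^sub>F FId x)) q (z @ b) = (\<Sum>p\<in>tuples K (fdom S s). cnt S K t q (p @ b) * cnt S K s p z)"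
proof -
  have "cnt S K (t ;\<^sub>F (s \<otimes>\<^sub>F FId x)) q (z @ b) =
     (\<Sum>p\<in>tuples K (fdom S s). \<Sum>u\<in>tuples K x. of_bool (u = b) * (cnt S K t q (p @ u) * cnt S K s p z))"
    using assms by (simp add: sum_tuples_add del: sum_of_bool_mult_eq sum_mult_of_bool_eq)
      (intro sum.cong refl, simp_all add: tuples_length)
  also have "\<dots> = (\<Sum>p\<in>tuples K (fdom S s). cnt S K t q (p @ b) * cnt S K s p z)"
    using assms by (intro sum.cong refl) (subst sum_delta_bool, auto)
  finally show ?thesis .
qed

text \<open>The trace axioms are verified on matrices, where they are exchanges of finite sums,
  instead of being derived in \<open>feq\<close> from the compact closed structure.\<close>

lemma teq_cnt: "teq S m n s t \<Longrightarrow> x \<in> tuples K m \<Longrightarrow> y \<in> tuples K n \<Longrightarrow> cnt S K (IC s) x y = cnt S K (IC t) x y"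
proof (induction arbitrary: x y rule: teq.induct)
  case (teq_Seq l m s s' n t t')
  have "fcod S (IC s) = m" "fcod S (IC s') = m"
    using teq_typed[OF teq_Seq(1)] IC_dom by blast+
  then show ?case using teq_Seq by simp
next
  case (teq_Tens m n s s' m' n' t t')
  have e: "fdom S (IC s) = m" "fdom S (IC s') = m" "fcod S (IC s) = n" "fcod S (IC s') = n"
    using teq_typed[OF teq_Tens(1)] IC_dom by blast+
  obtain a b where x: "x = a @ b" "a \<in> tuples K m" "b \<in> tuples K m'" using tuples_addE[OF teq_Tens(5)] .
  obtain c d where y: "y = c @ d" "c \<in> tuples K n" "d \<in> tuples K n'" using tuples_addE[OF teq_Tens(6)] .
  show ?case using teq_Tens.IH x y e by (simp add: tuples_length)
next
  case (teq_Tr k m n t t')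
  have e: "fdom S (IC t) = k + m" "fdom S (IC t') = k + m" "fcod S (IC t) = k + n" "fcod S (IC t') = k + n"
    using teq_typed[OF teq_Tr(1)] IC_dom by blast+
  show ?case using teq_Tr by (simp add: cnt_trace e tuples_append)
next
  case (teq_tightening s m m' t k n' u n)
  note e = IC_dom[OF teq_tightening(1)] IC_dom[OF teq_tightening(2)] IC_dom[OF teq_tightening(3)]
  let ?s = "cnt S K (IC s)" and ?t = "cnt S K (IC t)" and ?u = "cnt S K (IC u)"
  have "cnt S K (IC (TTr k m n ((TId k \<otimes>\<^sub>T s) ;\<^sub>T t ;\<^sub>T (TId k \<otimes>\<^sub>T u)))) x y
     = (\<Sum>z\<in>tuples K k. \<Sum>q\<in>tuples K n'. (\<Sum>p\<in>tuples K m'. ?s x p * ?t (z @ p) (z @ q)) * ?u q y)"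
    using teq_tightening(4,5) e
    by (simp add: cnt_trace del: cnt.simps, intro sum.cong refl)
      (simp add: cnt_whisker_right' cnt_whisker_right tuples_length del: cnt.simps)
  also have "\<dots> = (\<Sum>q\<in>tuples K n'. \<Sum>z\<in>tuples K k. \<Sum>p\<in>tuples K m'. ?s x p * ?t (z @ p) (z @ q) * ?u q y)"
    by (subst sum.swap) (simp add: sum_distrib_right)
  also have "\<dots> = (\<Sum>q\<in>tuples K n'. \<Sum>p\<in>tuples K m'. \<Sum>z\<in>tuples K k. ?s x p * ?t (z @ p) (z @ q) * ?u q y)"
    by (rule sum.cong[OF refl]) (rule sum.swap)
  also have "\<dots> = cnt S K (IC (s ;\<^sub>T TTr k m' n' t ;\<^sub>T u)) x y"
    using teq_tightening(4,5) e by (simp add: cnt_trace sum_distrib_left sum_distrib_right)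
  finally show ?case .
next
  case (teq_sliding t k m l n s)
  note e = IC_dom[OF teq_sliding(1)] IC_dom[OF teq_sliding(2)]
  let ?s = "cnt S K (IC s)" and ?t = "cnt S K (IC t)"
  have "cnt S K (IC (TTr k m n (t ;\<^sub>T (s \<otimes>\<^sub>T TId n)))) x y = (\<Sum>z\<in>tuples K k. \<Sum>w\<in>tuples K l. ?t (z @ x) (w @ y) * ?s w z)"
    using teq_sliding(3,4) e
    by (simp add: cnt_trace del: cnt.simps, intro sum.cong refl)
      (simp add: cnt_whisker_left' tuples_length del: cnt.simps)
  also have "\<dots> = (\<Sum>w\<in>tuples K l. \<Sum>z\<in>tuples K k. ?s w z * ?t (z @ x) (w @ y))"
    by (subst sum.swap) (simp add: mult.commute)
  also have "\<dots> = cnt S K (IC (TTr l m n ((s \<otimes>\<^sub>T TId m) ;\<^sub>T t))) x y"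
    using teq_sliding(3,4) e
    by (simp add: cnt_trace del: cnt.simps, intro sum.cong refl)
      (simp add: cnt_whisker_left tuples_length del: cnt.simps)
  finally show ?case .
next
  case (teq_vanishing_zero t m n)
  show ?case using teq_vanishing_zero(2,3) IC_dom[OF teq_vanishing_zero(1)] by (simp add: cnt_trace)
next
  case (teq_vanishing_plus t k l m n)
  note e = IC_dom[OF teq_vanishing_plus(1)]
  have "cnt S K (IC (TTr (k + l) m n t)) x y = (\<Sum>u\<in>tuples K k. \<Sum>v\<in>tuples K l. cnt S K (IC t) (u @ v @ x) (u @ v @ y))"
    using teq_vanishing_plus(2,3) e by (simp add: cnt_trace sum_tuples_add)
  also have "\<dots> = (\<Sum>v\<in>tuples K l. \<Sum>u\<in>tuples K k. cnt S K (IC t) (u @ v @ x) (u @ v @ y))"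
    by (rule sum.swap)
  also have "\<dots> = cnt S K (IC (TTr l m n (TTr k (l + m) (l + n) t))) x y"
    using teq_vanishing_plus(2,3) e by (simp add: cnt_trace tuples_append add.assoc)
  finally show ?case .
next
  case (teq_superposing t k m n l)
  note e = IC_dom[OF teq_superposing(1)]
  obtain a b where x: "x = a @ b" "a \<in> tuples K m" "b \<in> tuples K l" using tuples_addE[OF teq_superposing(2)] .
  obtain c d where y: "y = c @ d" "c \<in> tuples K n" "d \<in> tuples K l" using tuples_addE[OF teq_superposing(3)] .
  have "cnt S K (IC (TTr k (m + l) (n + l) (t \<otimes>\<^sub>T TId l))) x y = (\<Sum>z\<in>tuples K k. cnt S K (IC t) (z @ a) (z @ c) * of_bool (b = d))"
  proof -
    have "cnt S K (canonical_trace k (m + l) (n + l) (IC t \<otimes>\<^sub>F FId l)) (a @ b) (c @ d) =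
      (\<Sum>z\<in>tuples K k. cnt S K (IC t \<otimes>\<^sub>F FId l) (z @ a @ b) (z @ c @ d))"
      by (rule cnt_trace) (use teq_superposing(2,3) e x y in simp_all)
    also have "\<dots> = (\<Sum>z\<in>tuples K k. cnt S K (IC t) (z @ a) (z @ c) * of_bool (b = d))"
      by (rule sum.cong[OF refl]) (use x y e in \<open>simp add: tuples_length\<close>)
    finally show ?thesis unfolding x(1) y(1) by simp
  qed
  also have "\<dots> = cnt S K (IC (TTr k m n t \<otimes>\<^sub>T TId l)) x y"
    unfolding x(1) y(1) using e x y by (simp add: tuples_length cnt_trace sum_distrib_right)
  finally show ?case .
next
  case (teq_yanking k)
  have "cnt S K (IC (TTr k k k (TSym k k))) x y = (\<Sum>z\<in>tuples K k. of_bool (x = z) * of_bool (y = z))"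
  proof -
    have "cnt S K (canonical_trace k k k (FSym k k)) x y = (\<Sum>z\<in>tuples K k. cnt S K (FSym k k) (z @ x) (z @ y))"
      by (rule cnt_trace) (use teq_yanking in simp_all)
    also have "\<dots> = (\<Sum>z\<in>tuples K k. of_bool (x = z) * of_bool (y = z))"
      by (rule sum.cong[OF refl]) (use teq_yanking in \<open>auto simp: tuples_length\<close>)
    finally show ?thesis by simp
  qed
  also have "\<dots> = of_bool (x = y)" using teq_yanking by (subst sum_delta_bool) auto
  finally show ?case by simp
\<comment> \<open>The remaining axioms are translated by \<open>IC\<close> into axioms of
  \<open>feq\<close>.\<close>
qed (simp_all only: IC.simps, (rule feq_cnt[OF fin], (rule feq.intros; blast intro: ttyped_IC), assumption+)+)

end

section \<open>Homomorphisms of hypergraphs\<close>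

definition finhyp :: "'g msig \<Rightarrow> ('g, 'u) hgraph \<Rightarrow> bool" where
  "finhyp S F \<longleftrightarrow> hypergraph S F \<and> finite (verts F) \<and> finite (edges F)"

text \<open>A morphism is determined on vertices and hyperedges, but its functions are total; the
  value \<open>undefined\<close> elsewhere selects one representative per morphism, so that
  morphisms can be counted.\<close>

definition restr :: "('g, 'u) hgraph \<Rightarrow> 'u hmap \<Rightarrow> 'u hmap" where
  "restr F h = (restrict (fst h) (verts F), restrict (snd h) (edges F))"

definition homs :: "('g, 'u) hgraph \<Rightarrow> 'u list \<Rightarrow> ('g, 'u) hgraph \<Rightarrow> 'u list \<Rightarrow> 'u hmap set" where
  "homs F x K y = {h. restr F h = h \<and> hmor F K h \<and> map (fst h) x = y}"

lemma restr_eq_iff: "restr F h = restr F h' \<longleftrightarrow> heq_on F h h'"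
  unfolding restr_def heq_on_def by (auto simp: restrict_def fun_eq_iff)

lemma restr_restr [simp]: "restr F (restr F h) = restr F h"
  by (simp add: restr_def)

lemma heq_on_restr: "heq_on F (restr F h) h" "heq_on F h (restr F h)"
  by (auto simp: heq_on_def restr_def)

lemma heq_on_refl [simp]: "heq_on F h h"
  by (simp add: heq_on_def)

lemma heq_on_sym: "heq_on F h k \<Longrightarrow> heq_on F k h"
  by (simp add: heq_on_def)

lemma heq_on_trans: "heq_on F h k \<Longrightarrow> heq_on F k l \<Longrightarrow> heq_on F h l"
  by (simp add: heq_on_def)

lemma heq_on_map: "heq_on F h k \<Longrightarrow> set x \<subseteq> verts F \<Longrightarrow> map (fst h) x = map (fst k) x"
  by (auto simp: heq_on_def)

lemma hmor_heq:
  assumes "hypergraph S F" "heq_on F h k" "hmor F K h" shows "hmor F K k"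
proof -
  have "map (fst h) (src F e) = map (fst k) (src F e)" "map (fst h) (tgt F e) = map (fst k) (tgt F e)"
    if "e \<in> edges F" for e using that assms(1,2) by (auto simp: hypergraph_def heq_on_def)
  then show ?thesis using assms(2,3) unfolding hmor_def heq_on_def by (auto simp: image_subset_iff)
qed

lemma hmor_restr: "hypergraph S F \<Longrightarrow> hmor F K (restr F h) \<longleftrightarrow> hmor F K h"
  using hmor_heq heq_on_restr by metis

lemma hmor_hcomp: "hypergraph S F \<Longrightarrow> hmor F G h \<Longrightarrow> hmor G K k \<Longrightarrow> hmor F K (hcomp k h)"
  unfolding hmor_def hcomp_def by (auto simp: image_subset_iff)

lemma hmor_id: "hmor F F (id, id)"
  by (auto simp: hmor_def)

lemma hcomp_heq:
  assumes "heq_on G k k'" "hmor F G h" shows "heq_on F (hcomp k h) (hcomp k' h)"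
  using assms by (auto simp: heq_on_def hcomp_def hmor_def)

lemma fst_hcomp [simp]: "fst (hcomp k h) = fst k \<circ> fst h" and snd_hcomp [simp]: "snd (hcomp k h) = snd k \<circ> snd h"
  by (simp_all add: hcomp_def)

lemma hmor_in: "hmor F G h \<Longrightarrow> v \<in> verts F \<Longrightarrow> fst h v \<in> verts G" "hmor F G h \<Longrightarrow> e \<in> edges F \<Longrightarrow> snd h e \<in> edges G"
  by (auto simp: hmor_def)

lemma homs_restr:
  assumes "hypergraph S F" "set x \<subseteq> verts F"
  shows "restr F h \<in> homs F x K y \<longleftrightarrow> hmor F K h \<and> map (fst h) x = y"
proof -
  have "map (fst (restr F h)) x = map (fst h) x" using heq_on_map[OF heq_on_restr(1) assms(2)] .
  then show ?thesis by (simp only: homs_def mem_Collect_eq restr_restr hmor_restr[OF assms(1)] simp_thms)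
qed

lemma finite_homs: "finhyp S F \<Longrightarrow> finite (verts K) \<Longrightarrow> finite (edges K) \<Longrightarrow> finite (homs F x K y)"
proof (rule finite_subset)
  show "homs F x K y \<subseteq> (verts F \<rightarrow>\<^sub>E verts K) \<times> (edges F \<rightarrow>\<^sub>E edges K)"
    unfolding homs_def restr_def
    by (auto simp: hmor_def prod_eq_iff intro!: PiE_I) (metis restrict_apply)+
  assume "finhyp S F" "finite (verts K)" "finite (edges K)"
  then show "finite ((verts F \<rightarrow>\<^sub>E verts K) \<times> (edges F \<rightarrow>\<^sub>E edges K))"
    by (auto simp: finhyp_def intro!: finite_PiE)
qed

lemma homs_append: "length x = length y \<Longrightarrow> homs F (x @ x') K (y @ y') = {h. restr F h = h \<and> hmor F K h \<and> map (fst h) x = y \<and> map (fst h) x' = y'}"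
  by (auto simp: homs_def)

lemma homs_swap: "length x = length y \<Longrightarrow> length x' = length y' \<Longrightarrow> homs F (x' @ x) K (y' @ y) = homs F (x @ x') K (y @ y')"
  by (auto simp: homs_append)

text \<open>A morphism out of the pushout is a pair of morphisms agreeing on the interface:
  existence of mediating morphisms makes \<open>?\<Phi>\<close> surjective, uniqueness makes it
  injective. Sorting the pairs by the common image \<open>z\<close> of the interface yields a matrix
  product.\<close>

lemma card_homs_pushout:
  assumes po: "is_pushout S n a c L C G p q"
    and fin: "finhyp S L" "finhyp S C"
    and K: "finhyp S K"
    and l: "set l \<subseteq> verts L" "length l = length u" and d: "set d \<subseteq> verts C" "length d = length v"
  shows "card (homs G (map (fst p) l @ map (fst q) d) K (u @ v)) =
    (\<Sum>z\<in>tuples K n. card (homs L (l @ a) K (u @ z)) * card (homs C (c @ d) K (z @ v)))"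
proof -
  have h: "hypergraph S L" "hypergraph S C" "hypergraph S G" and a: "length a = n" "set a \<subseteq> verts L"
    and c: "length c = n" "set c \<subseteq> verts C" and p: "hmor L G p" and q: "hmor C G q"
    and sq: "map (fst p) a = map (fst q) c"
    and ex: "\<And>K p' q'. hypergraph S K \<and> hmor L K p' \<and> hmor C K q' \<and> map (fst p') a = map (fst q') c \<Longrightarrow>
        (\<exists>k. hmor G K k \<and> heq_on L (hcomp k p) p' \<and> heq_on C (hcomp k q) q' \<and>
           (\<forall>k'. hmor G K k' \<and> heq_on L (hcomp k' p) p' \<and> heq_on C (hcomp k' q) q' \<longrightarrow> heq_on G k' k))"
    using po unfolding is_pushout_def discrete_mor_def by blast+
  have hK: "hypergraph S K" "finite (verts K)" "finite (edges K)" using K by (auto simp: finhyp_def)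
  let ?P = "{(h1, h2). h1 \<in> homs L l K u \<and> h2 \<in> homs C d K v \<and> map (fst h1) a = map (fst h2) c}"
  let ?\<Phi> = "\<lambda>k. (restr L (hcomp k p), restr C (hcomp k q))"
  have p_in: "set (map (fst p) l @ map (fst q) d) \<subseteq> verts G"
    using l d hmor_in[OF p] hmor_in[OF q] by auto
  have "bij_betw ?\<Phi> (homs G (map (fst p) l @ map (fst q) d) K (u @ v)) ?P"
    unfolding bij_betw_def
  proof (intro conjI set_eqI iffI inj_onI)
    fix k k' assume k: "k \<in> homs G (map (fst p) l @ map (fst q) d) K (u @ v)" "k' \<in> homs G (map (fst p) l @ map (fst q) d) K (u @ v)"
      and e: "?\<Phi> k = ?\<Phi> k'"
    then have m: "hmor G K k" "hmor G K k'" "restr G k = k" "restr G k' = k'" by (auto simp: homs_def)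
    have e': "heq_on L (hcomp k' p) (hcomp k p)" "heq_on C (hcomp k' q) (hcomp k q)"
      using e by (simp_all add: restr_eq_iff[symmetric])
    have "map (fst (hcomp k p)) a = map (fst (hcomp k q)) c" using sq by (simp flip: map_map)
    then obtain k0 where "\<And>k'. hmor G K k' \<and> heq_on L (hcomp k' p) (hcomp k p) \<and> heq_on C (hcomp k' q) (hcomp k q) \<Longrightarrow> heq_on G k' k0"
      using ex[of K "hcomp k p" "hcomp k q"] hK hmor_hcomp[OF h(1) p m(1)] hmor_hcomp[OF h(2) q m(1)] by blast
    then have "heq_on G k k0" "heq_on G k' k0" using m e' by auto
    then show "k = k'" using m restr_eq_iff[of G k k'] heq_on_trans heq_on_sym by metis
  next
    fix x assume "x \<in> ?\<Phi> ` homs G (map (fst p) l @ map (fst q) d) K (u @ v)"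
    then obtain k where x: "x = ?\<Phi> k" and k: "hmor G K k" "map (fst k) (map (fst p) l) = u" "map (fst k) (map (fst q) d) = v"
      using l d by (auto simp: homs_append)
    have "map (fst (hcomp k p)) a = map (fst (hcomp k q)) c" using sq by (simp flip: map_map)
    then have "map (fst (restr L (hcomp k p))) a = map (fst (restr C (hcomp k q))) c"
      using heq_on_map[OF heq_on_restr(1)] a c by metis
    then show "x \<in> ?P" unfolding x using k
      by (simp add: homs_restr[OF h(1) l(1)] homs_restr[OF h(2) d(1)] hmor_hcomp[OF h(1) p] hmor_hcomp[OF h(2) q])
  next
    fix x assume "x \<in> ?P"
    then obtain h1 h2 where x: "x = (h1, h2)" and h1: "restr L h1 = h1" "hmor L K h1" "map (fst h1) l = u"
      and h2: "restr C h2 = h2" "hmor C K h2" "map (fst h2) d = v" and e: "map (fst h1) a = map (fst h2) c"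
      by (auto simp: homs_def)
    obtain k where k: "hmor G K k" "heq_on L (hcomp k p) h1" "heq_on C (hcomp k q) h2"
      using ex[of K h1 h2] hK h1 h2 e by blast
    have "map (fst k) (map (fst p) l @ map (fst q) d) = u @ v"
      using heq_on_map[OF k(2) l(1)] heq_on_map[OF k(3) d(1)] h1 h2 by simp
    then have 1: "restr G k \<in> homs G (map (fst p) l @ map (fst q) d) K (u @ v)"
      using homs_restr[OF h(3) p_in] k by blast
    have "heq_on L (hcomp (restr G k) p) h1" "heq_on C (hcomp (restr G k) q) h2"
      using hcomp_heq[OF heq_on_restr(1) p] hcomp_heq[OF heq_on_restr(1) q] k heq_on_trans by blast+
    then have "?\<Phi> (restr G k) = x" using x h1(1) h2(1) restr_eq_iff by (metis)
    then show "x \<in> ?\<Phi> ` homs G (map (fst p) l @ map (fst q) d) K (u @ v)" using 1 by blast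
  qed
  then have 1: "card (homs G (map (fst p) l @ map (fst q) d) K (u @ v)) = card ?P" by (rule bij_betw_same_card)
  have "?P = (\<Union>z\<in>tuples K n. homs L (l @ a) K (u @ z) \<times> homs C (c @ d) K (z @ v))"
  proof (intro set_eqI iffI)
    fix x assume "x \<in> ?P"
    then obtain h1 h2 where x: "x = (h1, h2)" "h1 \<in> homs L l K u" "h2 \<in> homs C d K v" "map (fst h1) a = map (fst h2) c"
      by auto
    then have "hmor L K h1" by (simp add: homs_def)
    then have "set (map (fst h1) a) \<subseteq> verts K" using a by (auto simp: hmor_def)
    then have "map (fst h1) a \<in> tuples K n" unfolding tuples_def using a(1) by simp
    moreover have "x \<in> homs L (l @ a) K (u @ map (fst h1) a) \<times> homs C (c @ d) K (map (fst h1) a @ v)"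
      using x l d c a by (auto simp: homs_def)
    ultimately show "x \<in> (\<Union>z\<in>tuples K n. homs L (l @ a) K (u @ z) \<times> homs C (c @ d) K (z @ v))" by blast
  next
    fix x assume "x \<in> (\<Union>z\<in>tuples K n. homs L (l @ a) K (u @ z) \<times> homs C (c @ d) K (z @ v))"
    then show "x \<in> ?P" using l c by (auto simp: homs_append tuples_length) (auto simp: homs_def)
  qed
  also have "card \<dots> = (\<Sum>z\<in>tuples K n. card (homs L (l @ a) K (u @ z) \<times> homs C (c @ d) K (z @ v)))"
  proof (rule card_UN_disjoint)
    show "finite (tuples K n)" using hK by simp
    show "\<forall>i\<in>tuples K n. finite (homs L (l @ a) K (u @ i) \<times> homs C (c @ d) K (i @ v))"
      using finite_homs fin hK by blast
    show "\<forall>i\<in>tuples K n. \<forall>j\<in>tuples K n. i \<noteq> j \<longrightarrow>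
       (homs L (l @ a) K (u @ i) \<times> homs C (c @ d) K (i @ v)) \<inter> (homs L (l @ a) K (u @ j) \<times> homs C (c @ d) K (j @ v)) = {}"
      by (auto simp: homs_def)
  qed
  finally show ?thesis unfolding 1 by (simp add: card_cartesian_product)
qed

text \<open>As a pushout over the empty interface, disjoint union is covered by the same counting
  lemma as composition.\<close>

lemma disjoint_union_pushout:
  assumes "hypergraph S F" "hypergraph S F'" "hypergraph S H" "is_disjoint_union F F' H p p'"
  shows "is_pushout S 0 [] [] F F' H p p'"
proof -
  have p: "hmor F H p" and p': "hmor F' H p'"
    and bv: "bij_betw (case_sum (fst p) (fst p')) (verts F <+> verts F') (verts H)"
    and be: "bij_betw (case_sum (snd p) (snd p')) (edges F <+> edges F') (edges H)"
    using assms(4) by (auto simp: is_disjoint_union_def)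
  \<comment> \<open>\<open>iv\<close> and \<open>ie\<close> tell from which summand a vertex or
    hyperedge of \<open>H\<close> comes.\<close>
  define iv where "iv = inv_into (verts F <+> verts F') (case_sum (fst p) (fst p'))"
  define ie where "ie = inv_into (edges F <+> edges F') (case_sum (snd p) (snd p'))"
  have iv: "iv (fst p v) = Inl v" if "v \<in> verts F" for v
    unfolding iv_def using bij_betw_inv_into_left[OF bv, of "Inl v"] that by auto
  have iv': "iv (fst p' v) = Inr v" if "v \<in> verts F'" for v
    unfolding iv_def using bij_betw_inv_into_left[OF bv, of "Inr v"] that by auto
  have ie: "ie (snd p v) = Inl v" if "v \<in> edges F" for v
    unfolding ie_def using bij_betw_inv_into_left[OF be, of "Inl v"] that by auto
  have ie': "ie (snd p' v) = Inr v" if "v \<in> edges F'" for v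
    unfolding ie_def using bij_betw_inv_into_left[OF be, of "Inr v"] that by auto
  have vH: "(\<exists>w\<in>verts F. v = fst p w) \<or> (\<exists>w\<in>verts F'. v = fst p' w)" if "v \<in> verts H" for v
    using that bv unfolding bij_betw_def by force
  have eH: "(\<exists>w\<in>edges F. v = snd p w) \<or> (\<exists>w\<in>edges F'. v = snd p' w)" if "v \<in> edges H" for v
    using that be unfolding bij_betw_def by force
  have "\<exists>k. hmor H K k \<and> heq_on F (hcomp k p) r \<and> heq_on F' (hcomp k p') r' \<and>
           (\<forall>k'. hmor H K k' \<and> heq_on F (hcomp k' p) r \<and> heq_on F' (hcomp k' p') r' \<longrightarrow> heq_on H k' k)"
    if K: "hypergraph S K" "hmor F K r" "hmor F' K r'" for K r r'
  proof -
    define k where "k = (case_sum (fst r) (fst r') \<circ> iv, case_sum (snd r) (snd r') \<circ> ie)"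
    have k1: "heq_on F (hcomp k p) r" and k2: "heq_on F' (hcomp k p') r'"
      by (auto simp: heq_on_def k_def iv iv' ie ie')
    have m1: "map (fst k) (map (fst p) xs) = map (fst r) xs" if "set xs \<subseteq> verts F" for xs
      using heq_on_map[OF k1 that] by simp
    have m2: "map (fst k) (map (fst p') xs) = map (fst r') xs" if "set xs \<subseteq> verts F'" for xs
      using heq_on_map[OF k2 that] by simp
    have "hmor H K k" unfolding hmor_def
    proof (intro conjI ballI)
      show "fst k ` verts H \<subseteq> verts K"
      proof (rule image_subsetI)
        fix v assume "v \<in> verts H"
        then consider w where "w \<in> verts F" "v = fst p w" | w where "w \<in> verts F'" "v = fst p' w" using vH by blast
        then show "fst k v \<in> verts K"
          by cases (simp_all add: k_def iv iv' hmor_in(1)[OF K(2)] hmor_in(1)[OF K(3)])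
      qed
      show "snd k ` edges H \<subseteq> edges K"
      proof (rule image_subsetI)
        fix v assume "v \<in> edges H"
        then consider w where "w \<in> edges F" "v = snd p w" | w where "w \<in> edges F'" "v = snd p' w" using eH by blast
        then show "snd k v \<in> edges K"
          by cases (simp_all add: k_def ie ie' hmor_in(2)[OF K(2)] hmor_in(2)[OF K(3)])
      qed
      fix e assume "e \<in> edges H"
      then consider w where "w \<in> edges F" "e = snd p w" | w where "w \<in> edges F'" "e = snd p' w" using eH by blast
      then have "lab K (snd k e) = lab H e \<and> src K (snd k e) = map (fst k) (src H e) \<and> tgt K (snd k e) = map (fst k) (tgt H e)"
      proof cases
        case 1
        then have "set (src F w) \<subseteq> verts F" "set (tgt F w) \<subseteq> verts F" using assms(1) by (auto simp: hypergraph_def)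
        then show ?thesis using 1 p K(2) m1 ie by (auto simp: hmor_def k_def)
      next
        case 2
        then have "set (src F' w) \<subseteq> verts F'" "set (tgt F' w) \<subseteq> verts F'" using assms(2) by (auto simp: hypergraph_def)
        then show ?thesis using 2 p' K(3) m2 ie' by (auto simp: hmor_def k_def)
      qed
      then show "lab K (snd k e) = lab H e" "src K (snd k e) = map (fst k) (src H e)" "tgt K (snd k e) = map (fst k) (tgt H e)"
        by auto
    qed
    moreover have "heq_on H k' k" if "heq_on F (hcomp k' p) r" "heq_on F' (hcomp k' p') r'" for k'
      unfolding heq_on_def
    proof (intro conjI ballI)
      fix v assume "v \<in> verts H"
      then consider w where "w \<in> verts F" "v = fst p w" | w where "w \<in> verts F'" "v = fst p' w" using vH by blast
      then show "fst k' v = fst k v" using that k1 k2 by cases (simp_all add: heq_on_def)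
    next
      fix v assume "v \<in> edges H"
      then consider w where "w \<in> edges F" "v = snd p w" | w where "w \<in> edges F'" "v = snd p' w" using eH by blast
      then show "snd k' v = snd k v" using that k1 k2 by cases (simp_all add: heq_on_def)
    qed
    ultimately show ?thesis using k1 k2 by blast
  qed
  then show ?thesis using assms(1-3) p p' unfolding is_pushout_def discrete_mor_def by simp
qed

section \<open>Isomorphisms and pushouts\<close>

definition iso :: "('g, 'u) hgraph \<Rightarrow> ('g, 'u) hgraph \<Rightarrow> 'u hmap \<Rightarrow> bool" where
  "iso F G h \<longleftrightarrow> hmor F G h \<and> bij_betw (fst h) (verts F) (verts G) \<and> bij_betw (snd h) (edges F) (edges G)"

lemma iso_inv:
  assumes "hypergraph S F" "iso F G h"
  obtains h' where "iso G F h'" "heq_on F (hcomp h' h) (id, id)" "heq_on G (hcomp h h') (id, id)"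
proof
  have h: "hmor F G h" "bij_betw (fst h) (verts F) (verts G)" "bij_betw (snd h) (edges F) (edges G)"
    using assms by (auto simp: iso_def)
  let ?h = "(inv_into (verts F) (fst h), inv_into (edges F) (snd h))"
  have v: "fst ?h (fst h v) = v" if "v \<in> verts F" for v using bij_betw_inv_into_left[OF h(2) that] by simp
  have e: "snd ?h (snd h v) = v" if "v \<in> edges F" for v using bij_betw_inv_into_left[OF h(3) that] by simp
  have vm: "map (fst ?h) (map (fst h) xs) = xs" if "set xs \<subseteq> verts F" for xs
    using that v by (auto intro!: map_idI)
  show "heq_on F (hcomp ?h h) (id, id)" using v e by (simp add: heq_on_def)
  show "heq_on G (hcomp h ?h) (id, id)"
    using bij_betw_inv_into_right[OF h(2)] bij_betw_inv_into_right[OF h(3)] by (simp add: heq_on_def)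
  have b: "bij_betw (fst ?h) (verts G) (verts F)" "bij_betw (snd ?h) (edges G) (edges F)"
    using bij_betw_inv_into h by auto
  have "hmor G F ?h" unfolding hmor_def
  proof (intro conjI ballI)
    show "fst ?h ` verts G \<subseteq> verts F" "snd ?h ` edges G \<subseteq> edges F" using b bij_betw_imp_surj_on by blast+
    fix d assume "d \<in> edges G"
    then obtain d' where d: "d' \<in> edges F" "d = snd h d'" using h(3) by (metis bij_betw_imp_surj_on imageE)
    then have "set (src F d') \<subseteq> verts F" "set (tgt F d') \<subseteq> verts F" using assms(1) by (auto simp: hypergraph_def)
    then show "lab F (snd ?h d) = lab G d" "src F (snd ?h d) = map (fst ?h) (src G d)" "tgt F (snd ?h d) = map (fst ?h) (tgt G d)"
      using d h(1) vm e[OF d(1)] unfolding hmor_def by (simp_all del: map_map)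
  qed
  then show "iso G F ?h" using b by (simp add: iso_def)
qed

lemma iso_hypergraph:
  assumes "hypergraph S F" "iso F G h" shows "hypergraph S G"
  unfolding hypergraph_def
proof
  fix e assume "e \<in> edges G"
  then obtain d where d: "d \<in> edges F" "e = snd h d" using assms(2) by (metis bij_betw_imp_surj_on imageE iso_def)
  have m: "hmor F G h" using assms(2) by (simp add: iso_def)
  then have "lab G e = lab F d" "src G e = map (fst h) (src F d)" "tgt G e = map (fst h) (tgt F d)" "fst h ` verts F \<subseteq> verts G"
    using d by (auto simp: hmor_def)
  moreover have "lab F d \<in> gens S \<and> length (src F d) = arity S (lab F d) \<and> set (src F d) \<subseteq> verts F \<and>
     length (tgt F d) = coarity S (lab F d) \<and> set (tgt F d) \<subseteq> verts F" using assms(1) d by (simp add: hypergraph_def)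
  ultimately show "lab G e \<in> gens S \<and> length (src G e) = arity S (lab G e) \<and> set (src G e) \<subseteq> verts G \<and>
     length (tgt G e) = coarity S (lab G e) \<and> set (tgt G e) \<subseteq> verts G" by auto
qed

lemma iso_finhyp: "finhyp S F \<Longrightarrow> iso F G h \<Longrightarrow> finhyp S G"
  using iso_hypergraph unfolding finhyp_def iso_def by (metis bij_betw_finite)

lemma pushout_iso:
  fixes L C G G' :: "('g, 'u) hgraph"
  assumes "is_pushout S n a c L C G p q" "is_pushout S n a c L C G' p' q'"
  obtains k where "iso G G' k" "heq_on L (hcomp k p) p'" "heq_on C (hcomp k q) q'"
proof -
  have h: "hypergraph S L" "hypergraph S C" "hypergraph S G" and p: "hmor L G p" and q: "hmor C G q"
    and sq: "map (fst p) a = map (fst q) c"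
    and ex: "\<And>K p' q'. hypergraph S K \<and> hmor L K p' \<and> hmor C K q' \<and> map (fst p') a = map (fst q') c \<Longrightarrow>
        (\<exists>k. hmor G K k \<and> heq_on L (hcomp k p) p' \<and> heq_on C (hcomp k q) q' \<and>
           (\<forall>k'. hmor G K k' \<and> heq_on L (hcomp k' p) p' \<and> heq_on C (hcomp k' q) q' \<longrightarrow> heq_on G k' k))"
    using assms(1) unfolding is_pushout_def discrete_mor_def by blast+
  have h': "hypergraph S G'" and p': "hmor L G' p'" and q': "hmor C G' q'"
    and sq': "map (fst p') a = map (fst q') c"
    and ex': "\<And>K r s. hypergraph S K \<and> hmor L K r \<and> hmor C K s \<and> map (fst r) a = map (fst s) c \<Longrightarrow>
        (\<exists>k. hmor G' K k \<and> heq_on L (hcomp k p') r \<and> heq_on C (hcomp k q') s \<and>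
           (\<forall>k'. hmor G' K k' \<and> heq_on L (hcomp k' p') r \<and> heq_on C (hcomp k' q') s \<longrightarrow> heq_on G' k' k))"
    using assms(2) unfolding is_pushout_def discrete_mor_def by blast+
  obtain k where k: "hmor G G' k" "heq_on L (hcomp k p) p'" "heq_on C (hcomp k q) q'"
    using ex[of G' p' q'] h' p' q' sq' by blast
  obtain k' where k': "hmor G' G k'" "heq_on L (hcomp k' p') p" "heq_on C (hcomp k' q') q"
    using ex'[of G p q] h p q sq by blast
  have assoc: "hcomp (hcomp x y) z = hcomp x (hcomp y z)" for x y z :: "'u hmap"
    by (simp add: hcomp_def comp_assoc)
  have cong: "heq_on F (hcomp x y) (hcomp x z)" if "heq_on F y z" for F :: "('g, 'u) hgraph" and x y z using that by (simp add: heq_on_def)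
  have 1: "heq_on G (hcomp k' k) (id, id)"
  proof -
    have "heq_on L (hcomp (hcomp k' k) p) p" "heq_on C (hcomp (hcomp k' k) q) q"
      unfolding assoc using cong[OF k(2), of k'] cong[OF k(3), of k'] k'(2,3) heq_on_trans by blast+
    moreover have "hmor G G (hcomp k' k)" using hmor_hcomp h k k' by blast
    moreover have "heq_on L (hcomp (id, id) p) p" "heq_on C (hcomp (id, id) q) q" by (simp_all add: hcomp_def)
    ultimately show ?thesis using ex[of G p q] h p q sq hmor_id heq_on_trans heq_on_sym by meson
  qed
  have 2: "heq_on G' (hcomp k k') (id, id)"
  proof -
    have "heq_on L (hcomp (hcomp k k') p') p'" "heq_on C (hcomp (hcomp k k') q') q'"
      unfolding assoc using cong[OF k'(2), of k] cong[OF k'(3), of k] k(2,3) heq_on_trans by blast+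
    moreover have "hmor G' G' (hcomp k k')" using hmor_hcomp h' k k' by blast
    moreover have "heq_on L (hcomp (id, id) p') p'" "heq_on C (hcomp (id, id) q') q'" by (simp_all add: hcomp_def)
    ultimately show ?thesis using ex'[of G' p' q'] h' p' q' sq' hmor_id heq_on_trans heq_on_sym by meson
  qed
  have "bij_betw (fst k) (verts G) (verts G')"
    by (rule bij_betw_byWitness[where f' = "fst k'"]) (use 1 2 k k' in \<open>auto simp: heq_on_def hmor_def\<close>)
  moreover have "bij_betw (snd k) (edges G) (edges G')"
    by (rule bij_betw_byWitness[where f' = "snd k'"]) (use 1 2 k k' in \<open>auto simp: heq_on_def hmor_def\<close>)
  ultimately have "iso G G' k" using k by (simp add: iso_def)
  then show ?thesis using that k by blast
qed

text \<open>Precomposing mediating morphisms with the inverse of \<open>h\<close> transports the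
  universal property. This makes \<open>csp_seq\<close> closed under isomorphism of cospans.\<close>

lemma pushout_transfer:
  fixes L C G G' :: "('g, 'u) hgraph"
  assumes po: "is_pushout S n a c L C G p q" and i: "iso G G' h"
  shows "is_pushout S n a c L C G' (hcomp h p) (hcomp h q)"
proof -
  have hy: "hypergraph S L" "hypergraph S C" "hypergraph S G" and p: "hmor L G p" and q: "hmor C G q"
    and sq: "map (fst p) a = map (fst q) c" and dm: "discrete_mor n L a" "discrete_mor n C c"
    and ex: "\<And>K p' q'. hypergraph S K \<and> hmor L K p' \<and> hmor C K q' \<and> map (fst p') a = map (fst q') c \<Longrightarrow>
        (\<exists>k. hmor G K k \<and> heq_on L (hcomp k p) p' \<and> heq_on C (hcomp k q) q' \<and>
           (\<forall>k'. hmor G K k' \<and> heq_on L (hcomp k' p) p' \<and> heq_on C (hcomp k' q) q' \<longrightarrow> heq_on G k' k))"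
    using po unfolding is_pushout_def by blast+
  obtain h' where h': "iso G' G h'" "heq_on G (hcomp h' h) (id, id)" "heq_on G' (hcomp h h') (id, id)"
    using iso_inv[OF hy(3) i] .
  have m: "hmor G G' h" "hmor G' G h'" using i h' by (auto simp: iso_def)
  have hy': "hypergraph S G'" using iso_hypergraph hy i by blast
  have assoc: "hcomp (hcomp x y) z = hcomp x (hcomp y z)" for x y z :: "'u hmap"
    by (simp add: hcomp_def comp_assoc)
  have "\<exists>k. hmor G' K k \<and> heq_on L (hcomp k (hcomp h p)) r \<and> heq_on C (hcomp k (hcomp h q)) s \<and>
           (\<forall>k'. hmor G' K k' \<and> heq_on L (hcomp k' (hcomp h p)) r \<and> heq_on C (hcomp k' (hcomp h q)) s \<longrightarrow> heq_on G' k' k)"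
    if K: "hypergraph S K" "hmor L K r" "hmor C K s" "map (fst r) a = map (fst s) c" for K r s
  proof -
    obtain k where k: "hmor G K k" "heq_on L (hcomp k p) r" "heq_on C (hcomp k q) s"
      "\<And>k'. hmor G K k' \<and> heq_on L (hcomp k' p) r \<and> heq_on C (hcomp k' q) s \<Longrightarrow> heq_on G k' k"
      using ex[of K r s] K by blast
    have e: "heq_on G (hcomp (hcomp k h') h) k" using h'(2) by (simp add: heq_on_def)
    have 1: "heq_on L (hcomp (hcomp k h') (hcomp h p)) r" "heq_on C (hcomp (hcomp k h') (hcomp h q)) s"
      using hcomp_heq[OF e p] hcomp_heq[OF e q] k(2,3) heq_on_trans unfolding assoc by blast+
    have 2: "hmor G' K (hcomp k h')" using hmor_hcomp hy' m k(1) by blast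
    have "heq_on G' k' (hcomp k h')"
      if k': "hmor G' K k'" "heq_on L (hcomp k' (hcomp h p)) r" "heq_on C (hcomp k' (hcomp h q)) s" for k'
    proof -
      have "heq_on G (hcomp k' h) k" using k(4)[of "hcomp k' h"] k' hmor_hcomp[OF hy(3) m(1)] unfolding assoc by blast
      then have "heq_on G' (hcomp (hcomp k' h) h') (hcomp k h')" using hcomp_heq m(2) by blast
      moreover have "heq_on G' k' (hcomp (hcomp k' h) h')" using h'(3) by (simp add: heq_on_def)
      ultimately show ?thesis using heq_on_trans by blast
    qed
    then show ?thesis using 1 2 by blast
  qed
  moreover have "map (fst (hcomp h p)) a = map (fst (hcomp h q)) c" using sq by (simp flip: map_map)
  moreover have "hmor L G' (hcomp h p)" "hmor C G' (hcomp h q)" using hmor_hcomp hy p q m by blast+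
  ultimately show ?thesis unfolding is_pushout_def using hy hy' dm by simp
qed

text \<open>An infinite cardinal absorbs its double, so a disjoint sum of two hypergraphs over
  \<open>'u\<close> fits into \<open>'u\<close> again.\<close>

lemma ex_emb: "\<exists>emb :: 'u + 'u \<Rightarrow> 'u::infinite. inj emb"
proof -
  have "infinite (UNIV :: 'u set)" by (rule infinite_UNIV)
  from card_of_Plus_infinite1[OF this ordIso_imp_ordLeq[OF card_of_refl[of "UNIV :: 'u set"]]]
  obtain f :: "'u + 'u \<Rightarrow> 'u" where "bij_betw f (UNIV <+> UNIV) UNIV"
    unfolding card_of_ordIso[symmetric] by blast
  then show ?thesis by (auto simp: bij_betw_def)
qed

text \<open>Explicit gluing. The facts on images and injectivity carry finiteness from the two parts
  to the pushout and from the pushout back to the complement.\<close>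

lemma pushout_exists:
  fixes L C :: "('g, 'u::infinite) hgraph"
  assumes L: "hypergraph S L" and C: "hypergraph S C" and a: "discrete_mor n L a" and c: "discrete_mor n C c"
  obtains G p q where "is_pushout S n a c L C G p q" "verts G = fst p ` verts L \<union> fst q ` verts C"
    "edges G = snd p ` edges L \<union> snd q ` edges C" "inj_on (snd q) (edges C)" "inj_on (fst q) (verts C - set c)"
proof -
  obtain emb :: "'u + 'u \<Rightarrow> 'u" where emb: "inj emb" using ex_emb by blast
  \<comment> \<open>\<open>R\<close> identifies corresponding interface points; \<open>r\<close>
    selects a representative of each class of the generated equivalence \<open>E\<close>, which
    keeps the quotient inside the type \<open>'u\<close>.\<close>
  define R where "R = {(emb (Inl (a ! k)), emb (Inr (c ! k))) | k. k < n}"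
  define E where "E = (R \<union> R\<inverse>)\<^sup>*"
  define r where "r x = (SOME y. (x, y) \<in> E)" for x
  have E_refl: "(x, x) \<in> E" and E_sym: "(x, y) \<in> E \<Longrightarrow> (y, x) \<in> E" and E_trans: "(x, y) \<in> E \<Longrightarrow> (y, z) \<in> E \<Longrightarrow> (x, z) \<in> E" for x y z
    unfolding E_def using symD[OF sym_rtrancl[OF sym_Un_converse]] by (auto intro: rtrancl_trans)
  have rE: "(x, r x) \<in> E" for x unfolding r_def using E_refl someI[of "\<lambda>y. (x, y) \<in> E"] by blast
  have r_eq: "(x, y) \<in> E \<Longrightarrow> r x = r y" for x y
    unfolding r_def using E_sym E_trans by (metis (mono_tags, lifting))
  have r_eqD: "r x = r y \<Longrightarrow> (x, y) \<in> E" for x y using rE E_sym E_trans by metis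
  define i where "i = inv emb"
  have i [simp]: "i (emb x) = x" for x using emb by (simp add: i_def)
  define p where "p = (\<lambda>v. r (emb (Inl v)), \<lambda>e. emb (Inl e))"
  define q where "q = (\<lambda>v. r (emb (Inr v)), \<lambda>e. emb (Inr e))"
  define G :: "('g, 'u) hgraph" where "G = \<lparr>verts = fst p ` verts L \<union> fst q ` verts C, edges = snd p ` edges L \<union> snd q ` edges C,
     lab = case_sum (lab L) (lab C) \<circ> i, src = case_sum (map (fst p) \<circ> src L) (map (fst q) \<circ> src C) \<circ> i,
     tgt = case_sum (map (fst p) \<circ> tgt L) (map (fst q) \<circ> tgt C) \<circ> i\<rparr>"
  have len: "length a = n" "length c = n" using a c by (auto simp: discrete_mor_def)
  have pm: "hmor L G p" unfolding hmor_def by (auto simp: G_def p_def)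
  have qm: "hmor C G q" unfolding hmor_def by (auto simp: G_def q_def)
  have hG: "hypergraph S G" unfolding hypergraph_def
  proof
    fix e assume "e \<in> edges G"
    then consider d where "d \<in> edges L" "e = emb (Inl d)" | d where "d \<in> edges C" "e = emb (Inr d)" by (auto simp: G_def p_def q_def)
    then show "lab G e \<in> gens S \<and> length (src G e) = arity S (lab G e) \<and> set (src G e) \<subseteq> verts G \<and>
       length (tgt G e) = coarity S (lab G e) \<and> set (tgt G e) \<subseteq> verts G"
    proof cases
      case 1
      then have "lab L d \<in> gens S \<and> length (src L d) = arity S (lab L d) \<and> length (tgt L d) = coarity S (lab L d)"
        and "fst p ` set (src L d) \<subseteq> fst p ` verts L" "fst p ` set (tgt L d) \<subseteq> fst p ` verts L"
        using L by (auto simp: hypergraph_def)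
      then show ?thesis using 1 by (simp add: G_def le_supI1)
    next
      case 2
      then have "lab C d \<in> gens S \<and> length (src C d) = arity S (lab C d) \<and> length (tgt C d) = coarity S (lab C d)"
        and "fst q ` set (src C d) \<subseteq> fst q ` verts C" "fst q ` set (tgt C d) \<subseteq> fst q ` verts C"
        using C by (auto simp: hypergraph_def)
      then show ?thesis using 2 by (simp add: G_def le_supI2)
    qed
  qed
  have sq: "map (fst p) a = map (fst q) c"
  proof (rule nth_equalityI)
    fix k assume k: "k < length (map (fst p) a)"
    then have "(emb (Inl (a ! k)), emb (Inr (c ! k))) \<in> R" unfolding R_def using len by auto
    then show "map (fst p) a ! k = map (fst q) c ! k" using k len by (auto simp: p_def q_def E_def intro!: r_eq)
  qed (use len in simp)
  have "\<exists>k. hmor G K k \<and> heq_on L (hcomp k p) p' \<and> heq_on C (hcomp k q) q' \<and>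
           (\<forall>k'. hmor G K k' \<and> heq_on L (hcomp k' p) p' \<and> heq_on C (hcomp k' q) q' \<longrightarrow> heq_on G k' k)"
    if K: "hypergraph S K" "hmor L K p'" "hmor C K q'" "map (fst p') a = map (fst q') c" for K p' q'
  proof -
    \<comment> \<open>\<open>h\<close> is the mediating vertex map before passing to the quotient;
      agreement on the interface makes it constant on classes.\<close>
    define h where "h = case_sum (fst p') (fst q') \<circ> i"
    have "h x = h y" if xy: "(x, y) \<in> R" for x y
    proof -
      obtain k where "k < n" "x = emb (Inl (a ! k))" "y = emb (Inr (c ! k))"
        using xy unfolding R_def by blast
      then show ?thesis using K(4) len unfolding h_def by (simp add: list_eq_iff_nth_eq)
    qed
    then have hR: "h x = h y" if "(x, y) \<in> R \<union> R\<inverse>" for x y using that by force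
    have hE: "h x = h y" if "(x, y) \<in> E" for x y
      using that unfolding E_def by (induct rule: rtrancl_induct) (simp, metis hR)
    have hr: "h (r x) = h x" for x using hE[OF rE] by metis
    define k where "k = (h, case_sum (snd p') (snd q') \<circ> i)"
    have kp: "heq_on L (hcomp k p) p'" "heq_on C (hcomp k q) q'"
      by (simp_all add: heq_on_def k_def p_def q_def hr) (simp_all add: h_def)
    have "hmor G K k" unfolding hmor_def
    proof (intro conjI ballI)
      show "fst k ` verts G \<subseteq> verts K"
        using K(2,3) kp by (auto simp: G_def heq_on_def hmor_def)
      show "snd k ` edges G \<subseteq> edges K"
        using K(2,3) kp by (auto simp: G_def heq_on_def hmor_def)
      fix e assume "e \<in> edges G"
      then consider d where "d \<in> edges L" "e = emb (Inl d)" | d where "d \<in> edges C" "e = emb (Inr d)" by (auto simp: G_def p_def q_def)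
      then have "lab K (snd k e) = lab G e \<and> src K (snd k e) = map (fst k) (src G e) \<and> tgt K (snd k e) = map (fst k) (tgt G e)"
      proof cases
        case 1
        then have "set (src L d) \<subseteq> verts L" "set (tgt L d) \<subseteq> verts L" using L by (auto simp: hypergraph_def)
        then show ?thesis using 1 K(2) heq_on_map[OF kp(1)] by (simp add: hmor_def G_def k_def)
      next
        case 2
        then have "set (src C d) \<subseteq> verts C" "set (tgt C d) \<subseteq> verts C" using C by (auto simp: hypergraph_def)
        then show ?thesis using 2 K(3) heq_on_map[OF kp(2)] by (simp add: hmor_def G_def k_def)
      qed
      then show "lab K (snd k e) = lab G e" "src K (snd k e) = map (fst k) (src G e)" "tgt K (snd k e) = map (fst k) (tgt G e)"
        by auto
    qed
    moreover have "heq_on G k' k" if "heq_on L (hcomp k' p) p'" "heq_on C (hcomp k' q) q'" for k'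
      using that kp by (auto simp: heq_on_def G_def)
    ultimately show ?thesis using kp by blast
  qed
  then have "is_pushout S n a c L C G p q" unfolding is_pushout_def using L C a c hG pm qm sq by blast
  moreover have "inj_on (snd q) (edges C)" using emb by (auto simp: q_def inj_on_def)
  moreover have "inj_on (fst q) (verts C - set c)"
  proof (rule inj_onI)
    fix v w assume v: "v \<in> verts C - set c" "w \<in> verts C - set c" "fst q v = fst q w"
    then have "(emb (Inr v), emb (Inr w)) \<in> E" using r_eqD by (auto simp: q_def)
    \<comment> \<open>A vertex outside the interface is isolated in \<open>R\<close>, so its class
      is a singleton.\<close>
    moreover have "(emb (Inr v), y) \<notin> R \<union> R\<inverse>" for y
    proof
      assume "(emb (Inr v), y) \<in> R \<union> R\<inverse>"
      then have "(\<exists>k<n. emb (Inr v) = emb (Inl (a ! k))) \<or> (\<exists>k<n. emb (Inr v) = emb (Inr (c ! k)))"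
        unfolding R_def by blast
      then show False using emb v(1) len by (auto dest: injD)
    qed
    ultimately have "emb (Inr v) = emb (Inr w)" unfolding E_def by (metis converse_rtranclE)
    then show "v = w" using emb by (auto dest: injD)
  qed
  ultimately show ?thesis using that[of G p q] by (simp add: G_def)
qed

text \<open>The explicit pushout is finite, and every other one is isomorphic to it.\<close>

lemma pushout_finhyp:
  fixes L C :: "('g, 'u::infinite) hgraph"
  assumes po: "is_pushout S n a c L C G p q" and "finhyp S L" "finhyp S C"
  shows "finhyp S G"
proof -
  have "hypergraph S L" "hypergraph S C" "discrete_mor n L a" "discrete_mor n C c"
    using po by (auto simp: is_pushout_def)
  from pushout_exists[OF this] obtain G' p' q' where po': "is_pushout S n a c L C G' p' q'"
    and G': "verts G' = fst p' ` verts L \<union> fst q' ` verts C" "edges G' = snd p' ` edges L \<union> snd q' ` edges C" by metis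
  have "finhyp S G'" using po' G' assms unfolding finhyp_def is_pushout_def by auto
  then show ?thesis using pushout_iso[OF po' po] iso_finhyp by metis
qed

text \<open>A rewriting step puts no bound on \<open>C\<close>. Its hyperedges, and its vertices
  outside the finite list \<open>c\<close>, survive injectively in the pushout, so finiteness of
  \<open>G\<close> bounds them.\<close>

lemma pushout_complement_finhyp:
  fixes L C :: "('g, 'u::infinite) hgraph"
  assumes po: "is_pushout S n a c L C G p q" and "finhyp S G"
  shows "finhyp S C"
proof -
  have h: "hypergraph S L" "hypergraph S C" "discrete_mor n L a" "discrete_mor n C c"
    using po by (auto simp: is_pushout_def)
  from pushout_exists[OF this] obtain G' p' q' where po': "is_pushout S n a c L C G' p' q'"
    and G': "verts G' = fst p' ` verts L \<union> fst q' ` verts C" "edges G' = snd p' ` edges L \<union> snd q' ` edges C"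
      "inj_on (snd q') (edges C)" "inj_on (fst q') (verts C - set c)" by metis
  have "finhyp S G'" using pushout_iso[OF po po'] iso_finhyp assms(2) by metis
  then have f: "finite (verts G')" "finite (edges G')" by (auto simp: finhyp_def)
  have "finite (edges C)" using G' f by (metis finite_Un finite_image_iff)
  moreover have "finite (fst q' ` (verts C - set c))" by (rule finite_subset[OF _ f(1)]) (auto simp: G'(1))
  then have "finite (verts C - set c)" using G'(4) finite_imageD by blast
  then have "finite (verts C)" by simp
  ultimately show ?thesis using h by (simp add: finhyp_def)
qed

section \<open>Interpretations are determined by homomorphism counts\<close>

lemma homs_discrete:
  assumes F: "discrete_on F vs" and x: "x \<in> tuples K (length vs)"
  shows "homs F vs K x = {restr F (sub vs x, undefined)}"
proof -
  have F': "distinct vs" "verts F = set vs" "edges F = {}" using F by (auto simp: discrete_on_def)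
  have len: "length vs = length x" "set x \<subseteq> verts K" using x by (auto simp: tuples_def)
  \<comment> \<open>Without hyperedges, \<open>F\<close> is a hypergraph over any signature.\<close>
  have hy: "hypergraph undefined F" using F' by (simp add: hypergraph_def)
  have h1: "map (sub vs x) vs = x" using map_sub_self[OF F'(1) len(1)] .
  have m: "hmor F K (sub vs x, undefined)" using F' sub_in[of _ vs x] len by (auto simp: hmor_def)
  then have "restr F (sub vs x, undefined) \<in> homs F vs K x"
    using homs_restr[OF hy] F' h1 by simp
  moreover have "h = restr F (sub vs x, undefined)" if h: "h \<in> homs F vs K x" for h
  proof -
    have "map (fst h) vs = map (sub vs x) vs" using h h1 by (simp add: homs_def)
    then have "heq_on F h (sub vs x, undefined)" using F' unfolding heq_on_def by simp
    then show ?thesis using h restr_eq_iff[of F h] by (simp add: homs_def)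
  qed
  ultimately show ?thesis by blast
qed

lemma card_homs_discrete:
  assumes F: "discrete_on F vs" and ws: "set ws \<subseteq> set vs" and x: "x \<in> tuples K (length vs)"
  shows "card (homs F (vs @ ws) K (x @ y)) = of_bool (map (sub vs x) ws = y)"
proof -
  let ?h = "restr F (sub vs x, undefined)"
  have V: "verts F = set vs" using F by (simp add: discrete_on_def)
  have "homs F (vs @ ws) K (x @ y) = {h \<in> homs F vs K x. map (fst h) ws = y}"
    using tuples_length[OF x] by (auto simp: homs_append) (auto simp: homs_def)
  also have "\<dots> = (if map (fst ?h) ws = y then {?h} else {})"
    unfolding homs_discrete[OF F x] by auto
  also have "map (fst ?h) ws = map (sub vs x) ws" using ws V by (auto simp: restr_def)
  finally show ?thesis by simp
qed

text \<open>The legs exhaust the vertices, so a morphism with prescribed values on them is a choice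
  of image for the single hyperedge.\<close>

lemma card_homs_gen:
  assumes "(F, f, g) \<in> csp_gen S \<phi>" "x \<in> tuples K (length f)" "y \<in> tuples K (length g)"
  shows "card (homs F (f @ g) K (x @ y)) = card {e \<in> edges K. lab K e = \<phi> \<and> src K e = x \<and> tgt K e = y}"
proof -
  obtain e where F: "hypergraph S F" "distinct (f @ g)" "verts F = set (f @ g)" "edges F = {e}" "lab F e = \<phi>" "src F e = f" "tgt F e = g"
    using assms(1) by (auto simp: csp_gen_def)
  let ?s = "sub (f @ g) (x @ y)"
  have len: "length f = length x" "length g = length y" using assms tuples_length by metis+
  have "map ?s (f @ g) = x @ y" by (rule map_sub_self) (use F len in auto)
  then have s: "map ?s f = x" "map ?s g = y" using len by auto
  have s_in: "?s v \<in> verts K" if "v \<in> set (f @ g)" for v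
    using sub_in[OF that, of "x @ y"] len assms(2,3) by (auto simp: tuples_def)
  have "bij_betw (\<lambda>d. restr F (?s, \<lambda>_. d)) {d \<in> edges K. lab K d = \<phi> \<and> src K d = x \<and> tgt K d = y} (homs F (f @ g) K (x @ y))"
    unfolding bij_betw_def
  proof (intro conjI inj_onI set_eqI iffI)
    fix d d' assume "restr F (?s, \<lambda>_. d) = restr F (?s, \<lambda>_. d')"
    then have "heq_on F (?s, \<lambda>_. d) (?s, \<lambda>_. d')" by (simp add: restr_eq_iff)
    then show "d = d'" using F by (simp add: heq_on_def)
  next
    fix h assume "h \<in> (\<lambda>d. restr F (?s, \<lambda>_. d)) ` {d \<in> edges K. lab K d = \<phi> \<and> src K d = x \<and> tgt K d = y}"
    then obtain d where d: "h = restr F (?s, \<lambda>_. d)" "d \<in> edges K" "lab K d = \<phi>" "src K d = x" "tgt K d = y" by blast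
    have "hmor F K (?s, \<lambda>_. d)" using F d s s_in by (auto simp: hmor_def)
    then show "h \<in> homs F (f @ g) K (x @ y)"
      unfolding d(1) using homs_restr[OF F(1)] F s by simp
  next
    fix h assume h: "h \<in> homs F (f @ g) K (x @ y)"
    then have h': "hmor F K h" "restr F h = h" "map (fst h) f = x" "map (fst h) g = y" using len by (auto simp: homs_append)
    then have d: "snd h e \<in> edges K" "lab K (snd h e) = \<phi>" "src K (snd h e) = x" "tgt K (snd h e) = y"
      using F by (auto simp: hmor_def)
    have "map (fst h) (f @ g) = map ?s (f @ g)" using s h' by simp
    then have "heq_on F h (?s, \<lambda>_. snd h e)" using F unfolding heq_on_def by (auto simp del: map_append)
    then have "h = restr F (?s, \<lambda>_. snd h e)" using h'(2) restr_eq_iff by metis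
    then show "h \<in> (\<lambda>d. restr F (?s, \<lambda>_. d)) ` {d \<in> edges K. lab K d = \<phi> \<and> src K d = x \<and> tgt K d = y}"
      using d by blast
  qed
  then show ?thesis by (simp add: bij_betw_same_card)
qed

text \<open>The cospan has the matrix of \<open>t\<close> as its table of homomorphism counts. This
  numerical condition replaces membership in \<open>interp\<close> in all later arguments.\<close>

definition represents :: "'g msig \<Rightarrow> nat \<Rightarrow> nat \<Rightarrow> 'g fterm \<Rightarrow> ('g, 'u) cospan \<Rightarrow> bool" where
  "represents S m n t = (\<lambda>(F, f, g). finhyp S F \<and> f \<in> tuples F m \<and> g \<in> tuples F n \<and>
     (\<forall>K x y. finhyp S K \<and> x \<in> tuples K m \<and> y \<in> tuples K n \<longrightarrow> card (homs F (f @ g) K (x @ y)) = cnt S K t x y))"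

lemma hmor_tuples: "hmor F G h \<Longrightarrow> x \<in> tuples F n \<Longrightarrow> map (fst h) x \<in> tuples G n"
  by (auto simp: tuples_def hmor_def)

lemma finhyp_discrete: "discrete_on F vs \<Longrightarrow> finhyp S F"
  by (auto simp: discrete_on_def finhyp_def hypergraph_def)

text \<open>Pushouts contribute matrix products, and disjoint unions, as pushouts over the empty
  interface, contribute products of entries.\<close>

lemma interp_represents:
  fixes F :: "('g, 'u::infinite) hgraph"
  shows "ftyped S t m n \<Longrightarrow> (F, f, g) \<in> interp S t \<Longrightarrow> represents S m n t (F, f, g)"
proof (induction t arbitrary: m n F f g)
  case (FGen \<phi>)
  then have g: "(F, f, g) \<in> csp_gen S \<phi>" and mn: "\<phi> \<in> gens S" "m = arity S \<phi>" "n = coarity S \<phi>" by auto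
  then have "finhyp S F" "length f = m" "length g = n" "f \<in> tuples F m" "g \<in> tuples F n"
    by (auto simp: csp_gen_def finhyp_def hypergraph_def tuples_def)
  then show ?case using card_homs_gen[OF g] by (auto simp: represents_def)
next
  case (FId k)
  then obtain vs where F: "discrete_on F vs" "length vs = k" "f = vs" "g = vs" "m = k" "n = k" by auto
  then have v: "vs \<in> tuples F k" by (auto simp: discrete_on_def tuples_def)
  have "card (homs F (vs @ vs) K (x @ y)) = of_bool (x = y)" if "x \<in> tuples K k" for x y and K :: "('g, 'u) hgraph"
  proof -
    have "map (sub vs x) vs = x" by (rule map_sub_self) (use F that in \<open>auto simp: discrete_on_def tuples_def\<close>)
    then show ?thesis using card_homs_discrete[of F vs vs x K y] F that by simp
  qed
  then show ?case using F v finhyp_discrete by (auto simp: represents_def)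
next
  case (FSym k l)
  then obtain vs ws where F: "discrete_on F (vs @ ws)" "length vs = k" "length ws = l" "f = vs @ ws" "g = ws @ vs" "m = k + l" "n = l + k" by auto
  then have v: "vs @ ws \<in> tuples F (k + l)" "ws @ vs \<in> tuples F (l + k)" by (auto simp: discrete_on_def tuples_def)
  have "card (homs F ((vs @ ws) @ (ws @ vs)) K (x @ y)) = of_bool (y = drop k x @ take k x)" if x: "x \<in> tuples K (k + l)" for x y and K :: "('g, 'u) hgraph"
  proof -
    obtain a b where ab: "x = a @ b" "a \<in> tuples K k" "b \<in> tuples K l" using tuples_addE[OF x] .
    have "map (sub (vs @ ws) x) (vs @ ws) = x" by (rule map_sub_self) (use F x in \<open>auto simp: discrete_on_def tuples_def\<close>)
    then have "map (sub (vs @ ws) x) vs = a" "map (sub (vs @ ws) x) ws = b"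
      unfolding ab map_append using F ab tuples_length by (metis append_eq_append_conv length_map)+
    then show ?thesis using card_homs_discrete[of F "vs @ ws" "ws @ vs" x K y] F x ab(1) tuples_length[OF ab(2)] by auto
  qed
  then show ?case using F v finhyp_discrete by (auto simp: represents_def)
next
  case (FSeq s t)
  then obtain k where k: "ftyped S s m k" "ftyped S t k n" by auto
  obtain p p' G f' g' G' f'' g'' where e: "f = map (fst p) f'" "g = map (fst p') g''"
    and G: "(G, f', g') \<in> interp S s" "(G', f'', g'') \<in> interp S t" and po: "is_pushout S (length g') g' f'' G G' F p p'"
    using FSeq.prems(2) by (auto simp: csp_seq_def)
  have r: "represents S m k s (G, f', g')" "represents S k n t (G', f'', g'')" using FSeq.IH k G by auto
  then have G1: "finhyp S G" "f' \<in> tuples G m" "g' \<in> tuples G k" and G2: "finhyp S G'" "f'' \<in> tuples G' k" "g'' \<in> tuples G' n"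
    by (auto simp: represents_def)
  have pm: "hmor G F p" "hmor G' F p'" using po by (auto simp: is_pushout_def)
  have fF: "finhyp S F" using pushout_finhyp[OF po] G1 G2 by blast
  have "card (homs F (f @ g) K (x @ y)) = cnt S K (s ;\<^sub>F t) x y"
    if "finhyp S K" "x \<in> tuples K m" "y \<in> tuples K n" for x y and K :: "('g, 'u) hgraph"
  proof -
    have "card (homs F (f @ g) K (x @ y)) = (\<Sum>z\<in>tuples K (length g'). card (homs G (f' @ g') K (x @ z)) * card (homs G' (f'' @ g'') K (z @ y)))"
      unfolding e by (rule card_homs_pushout[OF po]) (use G1 G2 that in \<open>auto simp: tuples_def\<close>)
    also have "\<dots> = (\<Sum>z\<in>tuples K k. cnt S K s x z * cnt S K t z y)"
      unfolding tuples_length[OF G1(3)] by (rule sum.cong) (use r that in \<open>auto simp: represents_def\<close>)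
    finally show ?thesis using ftyped_dom[OF k(1)] by simp
  qed
  then show ?case using fF hmor_tuples[OF pm(1) G1(2)] hmor_tuples[OF pm(2) G2(3)] unfolding e by (simp add: represents_def)
next
  case (FTens s t)
  then obtain m1 n1 m2 n2 where k: "ftyped S s m1 n1" "ftyped S t m2 n2" "m = m1 + m2" "n = n1 + n2" by auto
  obtain p p' G f' g' G' f'' g'' where e: "f = map (fst p) f' @ map (fst p') f''" "g = map (fst p) g' @ map (fst p') g''"
    and G: "(G, f', g') \<in> interp S s" "(G', f'', g'') \<in> interp S t" and du: "is_disjoint_union G G' F p p'" and hF: "hypergraph S F"
    using FTens.prems(2) by (auto simp: csp_tens_def)
  have r: "represents S m1 n1 s (G, f', g')" "represents S m2 n2 t (G', f'', g'')" using FTens.IH k G by auto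
  then have G1: "finhyp S G" "f' \<in> tuples G m1" "g' \<in> tuples G n1" and G2: "finhyp S G'" "f'' \<in> tuples G' m2" "g'' \<in> tuples G' n2"
    by (auto simp: represents_def)
  have po: "is_pushout S 0 [] [] G G' F p p'" using disjoint_union_pushout[OF _ _ hF du] G1 G2 by (auto simp: finhyp_def)
  have pm: "hmor G F p" "hmor G' F p'" using po by (auto simp: is_pushout_def)
  have fF: "finhyp S F" using pushout_finhyp[OF po] G1 G2 by blast
  have "card (homs F (f @ g) K (x @ y)) = cnt S K (s \<otimes>\<^sub>F t) x y"
    if xy: "finhyp S K" "x \<in> tuples K m" "y \<in> tuples K n" for x y and K :: "('g, 'u) hgraph"
  proof -
    obtain a b where x: "x = a @ b" "a \<in> tuples K m1" "b \<in> tuples K m2" using tuples_addE xy(2) k(3) by metis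
    obtain c d where y: "y = c @ d" "c \<in> tuples K n1" "d \<in> tuples K n2" using tuples_addE xy(3) k(4) by metis
    have "homs F (f @ g) K (x @ y) = homs F (map (fst p) (f' @ g') @ map (fst p') (f'' @ g'')) K ((a @ c) @ (b @ d))"
      unfolding e x(1) y(1) using G1 G2 x y by (auto simp: tuples_def homs_def)
    also have "card \<dots> = (\<Sum>z\<in>tuples K 0. card (homs G ((f' @ g') @ []) K ((a @ c) @ z)) * card (homs G' ([] @ (f'' @ g'')) K (z @ (b @ d))))"
      by (rule card_homs_pushout[OF po]) (use G1 G2 x y that in \<open>auto simp: tuples_def\<close>)
    also have "\<dots> = cnt S K s a c * cnt S K t b d" using r x y xy(1) by (simp add: represents_def)
    finally show ?thesis using ftyped_dom[OF k(1)] x y by (simp add: tuples_length)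
  qed
  moreover have "f \<in> tuples F m" "g \<in> tuples F n" unfolding e k
    using hmor_tuples[OF pm(1)] hmor_tuples[OF pm(2)] G1 G2 by (auto intro!: tuples_append)
  ultimately show ?case using fF by (simp add: represents_def)
next
  case FMerge
  then obtain v where F: "discrete_on F [v]" "f = [v, v]" "g = [v]" "m = 2" "n = 1" by auto
  have "card (homs F ([v, v] @ [v]) K (x @ y)) = cnt S K FMerge x y" if xy: "x \<in> tuples K 2" "y \<in> tuples K 1" for x y and K :: "('g, 'u) hgraph"
  proof -
    obtain w where w: "y = [w]" using xy(2) by (auto elim: tuples_SucE)
    \<comment> \<open>The input leg repeats \<open>v\<close>; counting starts from the output leg,
      which lists the vertex once.\<close>
    have "homs F ([v, v] @ [v]) K (x @ y) = homs F ([v] @ [v, v]) K (y @ x)"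
      using tuples_length[OF xy(1)] w by (intro homs_swap) auto
    moreover have "sub [v] [w] v = w" using map_sub_self[of "[v]" "[w]"] by simp
    ultimately show ?thesis using card_homs_discrete[OF F(1), of "[v, v]" y K x] xy w by auto
  qed
  then show ?case using F finhyp_discrete[OF F(1)] by (auto simp: represents_def discrete_on_def tuples_def)
next
  case FUnit
  then obtain v where F: "discrete_on F [v]" "f = []" "g = [v]" "m = 0" "n = 1" by auto
  have "card (homs F ([] @ [v]) K (x @ y)) = cnt S K FUnit x y" if xy: "x \<in> tuples K 0" "y \<in> tuples K 1" for x y and K :: "('g, 'u) hgraph"
    using card_homs_discrete[OF F(1), of "[]" y K "[]"] xy by simp
  then show ?case using F finhyp_discrete[OF F(1)] by (auto simp: represents_def discrete_on_def tuples_def)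
next
  case FCopy
  then obtain v where F: "discrete_on F [v]" "f = [v]" "g = [v, v]" "m = 1" "n = 2" by auto
  have "card (homs F ([v] @ [v, v]) K (x @ y)) = cnt S K FCopy x y" if xy: "x \<in> tuples K 1" "y \<in> tuples K 2" for x y and K :: "('g, 'u) hgraph"
  proof -
    obtain w where w: "x = [w]" using xy(1) by (auto elim: tuples_SucE)
    have "sub [v] [w] v = w" using map_sub_self[of "[v]" "[w]"] by simp
    then show ?thesis using card_homs_discrete[OF F(1), of "[v, v]" x K y] xy w by auto
  qed
  then show ?case using F finhyp_discrete[OF F(1)] by (auto simp: represents_def discrete_on_def tuples_def)
next
  case FCounit
  then obtain v where F: "discrete_on F [v]" "f = [v]" "g = []" "m = 1" "n = 0" by auto
  have "card (homs F ([v] @ []) K (x @ y)) = cnt S K FCounit x y" if xy: "x \<in> tuples K 1" "y \<in> tuples K 0" for x y and K :: "('g, 'u) hgraph"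
    using card_homs_discrete[OF F(1), of "[]" x K "[]"] xy by simp
  then show ?case using F finhyp_discrete[OF F(1)] by (auto simp: represents_def discrete_on_def tuples_def)
qed

text \<open>
  Homomorphism counts determine surjection counts, by induction on the target, since a homomorphism
  is a surjection onto a unique subhypergraph. Finite hypergraphs that surject onto each other are
  isomorphic.
\<close>

definition surjs :: "('g, 'u) hgraph \<Rightarrow> 'u list \<Rightarrow> ('g, 'u) hgraph \<Rightarrow> 'u list \<Rightarrow> 'u hmap set" where
  "surjs F x K y = {h \<in> homs F x K y. fst h ` verts F = verts K \<and> snd h ` edges F = edges K}"

text \<open>The candidates for the image of a morphism that sends the marked vertices to
  \<open>y\<close>.\<close>

definition subs :: "'g msig \<Rightarrow> ('g, 'u) hgraph \<Rightarrow> 'u list \<Rightarrow> ('u set \<times> 'u set) set" where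
  "subs S K y = {(V, E). V \<subseteq> verts K \<and> E \<subseteq> edges K \<and> hypergraph S (K\<lparr>verts := V, edges := E\<rparr>) \<and> set y \<subseteq> V}"

lemma card_homs_surjs:
  fixes K :: "('g, 'u) hgraph"
  assumes F: "finhyp S F" "set x \<subseteq> verts F" and K: "finhyp S K"
  shows "card (homs F x K y) = (\<Sum>(V, E)\<in>subs S K y. card (surjs F x (K\<lparr>verts := V, edges := E\<rparr>) y))"
proof -
  let ?K = "\<lambda>(V, E). K\<lparr>verts := V, edges := E\<rparr>"
  have "homs F x K y = (\<Union>VE\<in>subs S K y. surjs F x (?K VE) y)"
  proof (intro set_eqI iffI)
    fix h assume "h \<in> homs F x K y"
    then have h: "restr F h = h" "hmor F K h" "map (fst h) x = y" by (auto simp: homs_def)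
    let ?V = "fst h ` verts F" and ?E = "snd h ` edges F"
    have "hypergraph S (?K (?V, ?E))"
      unfolding hypergraph_def
    proof
      fix e assume "e \<in> edges (?K (?V, ?E))"
      then obtain d where d: "d \<in> edges F" "e = snd h d" by auto
      then have "lab K e = lab F d" "src K e = map (fst h) (src F d)" "tgt K e = map (fst h) (tgt F d)"
        using h by (auto simp: hmor_def)
      moreover have "lab F d \<in> gens S \<and> length (src F d) = arity S (lab F d) \<and> set (src F d) \<subseteq> verts F \<and>
         length (tgt F d) = coarity S (lab F d) \<and> set (tgt F d) \<subseteq> verts F"
        using F d by (simp add: finhyp_def hypergraph_def)
      ultimately show "lab (?K (?V, ?E)) e \<in> gens S \<and> length (src (?K (?V, ?E)) e) = arity S (lab (?K (?V, ?E)) e) \<and>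
          set (src (?K (?V, ?E)) e) \<subseteq> verts (?K (?V, ?E)) \<and> length (tgt (?K (?V, ?E)) e) = coarity S (lab (?K (?V, ?E)) e) \<and>
          set (tgt (?K (?V, ?E)) e) \<subseteq> verts (?K (?V, ?E))"
        by auto
    qed
    moreover have "set y \<subseteq> ?V" unfolding h(3)[symmetric] set_map by (rule image_mono[OF F(2)])
    moreover have "?V \<subseteq> verts K" "?E \<subseteq> edges K" using h(2) by (auto simp: hmor_def)
    ultimately have 1: "(?V, ?E) \<in> subs S K y" by (simp add: subs_def)
    have "h \<in> surjs F x (?K (?V, ?E)) y" using h by (auto simp: surjs_def homs_def hmor_def)
    then show "h \<in> (\<Union>VE\<in>subs S K y. surjs F x (?K VE) y)" using 1 by blast
  next
    fix h assume "h \<in> (\<Union>VE\<in>subs S K y. surjs F x (?K VE) y)"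
    then show "h \<in> homs F x K y" by (auto simp: subs_def surjs_def homs_def hmor_def)
  qed
  also have "card \<dots> = (\<Sum>VE\<in>subs S K y. card (surjs F x (?K VE) y))"
  proof (rule card_UN_disjoint)
    have "subs S K y \<subseteq> Pow (verts K) \<times> Pow (edges K)" by (auto simp: subs_def)
    then show "finite (subs S K y)" using K by (rule_tac finite_subset) (auto simp: finhyp_def)
    show "\<forall>VE\<in>subs S K y. finite (surjs F x (?K VE) y)"
    proof
      fix VE assume "VE \<in> subs S K y"
      then have "finite (verts (?K VE))" "finite (edges (?K VE))" using K by (auto simp: subs_def finhyp_def) (metis finite_subset)+
      then have "finite (homs F x (?K VE) y)" using finite_homs F by blast
      then show "finite (surjs F x (?K VE) y)" by (auto simp: surjs_def)
    qed
    show "\<forall>VE\<in>subs S K y. \<forall>VE'\<in>subs S K y. VE \<noteq> VE' \<longrightarrow> surjs F x (?K VE) y \<inter> surjs F x (?K VE') y = {}"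
      by (auto simp: surjs_def)
  qed
  finally show ?thesis by (simp add: case_prod_unfold)
qed

lemma card_surjs_eq:
  fixes K :: "('g, 'u) hgraph"
  assumes F: "finhyp S F" "set x \<subseteq> verts F" and F': "finhyp S F'" "set x' \<subseteq> verts F'"
    and eq: "\<And>(K :: ('g, 'u) hgraph) y. finhyp S K \<Longrightarrow> set y \<subseteq> verts K \<Longrightarrow> length y = n \<Longrightarrow> card (homs F x K y) = card (homs F' x' K y)"
  shows "finhyp S K \<Longrightarrow> set y \<subseteq> verts K \<Longrightarrow> length y = n \<Longrightarrow> card (surjs F x K y) = card (surjs F' x' K y)"
proof (induction "card (verts K) + card (edges K)" arbitrary: K rule: less_induct)
  case less
  let ?K = "\<lambda>(V, E). K\<lparr>verts := V, edges := E\<rparr>"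
  \<comment> \<open>\<open>?top\<close> stands for \<open>K\<close> itself; all other summands agree
    by induction, so equality of the sums isolates this one.\<close>
  let ?top = "(verts K, edges K)"
  have top: "?K ?top = K" by simp
  have "subs S K y \<subseteq> Pow (verts K) \<times> Pow (edges K)" by (auto simp: subs_def)
  then have fin: "finite (subs S K y)" using less.prems by (rule_tac finite_subset) (auto simp: finhyp_def)
  have inT: "?top \<in> subs S K y" using less.prems top by (simp add: subs_def finhyp_def)
  have "(\<Sum>VE\<in>subs S K y. card (surjs F x (?K VE) y)) = (\<Sum>VE\<in>subs S K y. card (surjs F' x' (?K VE) y))"
    using eq[OF less.prems] card_homs_surjs[OF F less.prems(1), of y] card_homs_surjs[OF F' less.prems(1), of y]
    by (simp add: case_prod_unfold)
  moreover have "card (surjs F x (?K VE) y) = card (surjs F' x' (?K VE) y)" if VE: "VE \<in> subs S K y - {?top}" for VE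
  proof (rule less.hyps)
    obtain V E where e: "VE = (V, E)" by force
    have sub: "V \<subseteq> verts K" "E \<subseteq> edges K" "set y \<subseteq> V" "hypergraph S (?K VE)" using VE e by (auto simp: subs_def)
    have fK: "finite (verts K)" "finite (edges K)" using less.prems by (auto simp: finhyp_def)
    have "V \<subset> verts K \<or> E \<subset> edges K" using VE e sub by auto
    then have "card V + card E < card (verts K) + card (edges K)"
      using psubset_card_mono[OF fK(1), of V] psubset_card_mono[OF fK(2), of E] card_mono[OF fK(1) sub(1)] card_mono[OF fK(2) sub(2)]
      by linarith
    then show "card (verts (?K VE)) + card (edges (?K VE)) < card (verts K) + card (edges K)"
      by (simp add: e)
    show "finhyp S (?K VE)" using sub fK e finite_subset by (auto simp: finhyp_def)
    show "set y \<subseteq> verts (?K VE)" "length y = n" using sub e less.prems by auto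
  qed
  then have "(\<Sum>VE\<in>subs S K y - {?top}. card (surjs F x (?K VE) y)) = (\<Sum>VE\<in>subs S K y - {?top}. card (surjs F' x' (?K VE) y))"
    by (rule sum.cong[OF refl])
  ultimately have "card (surjs F x (?K ?top) y) = card (surjs F' x' (?K ?top) y)"
    using sum.remove[OF fin inT, of "\<lambda>VE. card (surjs F x (?K VE) y)"] sum.remove[OF fin inT, of "\<lambda>VE. card (surjs F' x' (?K VE) y)"]
    by simp
  then show ?case by simp
qed

lemma surjs_id: "finhyp S F \<Longrightarrow> set x \<subseteq> verts F \<Longrightarrow> restr F (id, id) \<in> surjs F x F x"
  using homs_restr[of S F x "(id, id)" F x] hmor_id[of F] by (simp add: surjs_def finhyp_def) (simp add: restr_def)

theorem lovasz:
  fixes F F' :: "('g, 'u) hgraph"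
  assumes F: "finhyp S F" "set x \<subseteq> verts F" and F': "finhyp S F'" "set x' \<subseteq> verts F'" and len: "length x = n" "length x' = n"
    and eq: "\<And>(K :: ('g, 'u) hgraph) y. finhyp S K \<Longrightarrow> set y \<subseteq> verts K \<Longrightarrow> length y = n \<Longrightarrow> card (homs F x K y) = card (homs F' x' K y)"
  obtains h where "iso F F' h" "map (fst h) x = x'"
proof -
  have f: "finite (verts F)" "finite (edges F)" "finite (verts F')" "finite (edges F')"
    using F F' by (auto simp: finhyp_def)
  have fs: "finite (surjs G z K y)" if "finhyp S G" "finhyp S K" for G K :: "('g, 'u) hgraph" and z y
    using finite_homs[OF that(1), of K z y] that(2) by (auto simp: surjs_def finhyp_def)
  \<comment> \<open>With \<open>F'\<close> as target, the identity shows that the count for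
    \<open>F'\<close> is nonzero; equality of the counts then produces a surjection from
    \<open>F\<close>.\<close>
  have "card (surjs F x F' x') \<noteq> 0"
    using card_surjs_eq[OF F F' eq F'(1,2) len(2)] surjs_id[OF F'] fs[OF F'(1) F'(1)] by (metis card_0_eq empty_iff)
  then have "surjs F x F' x' \<noteq> {}" by auto
  then obtain h where h: "h \<in> surjs F x F' x'" by blast
  have "card (surjs F' x' F x) \<noteq> 0"
    using card_surjs_eq[OF F F' eq F(1,2) len(1)] surjs_id[OF F] fs[OF F(1) F(1)] by (metis card_0_eq empty_iff)
  then have "surjs F' x' F x \<noteq> {}" by auto
  then obtain h' where h': "h' \<in> surjs F' x' F x" by blast
  have s: "fst h ` verts F = verts F'" "snd h ` edges F = edges F'" "fst h' ` verts F' = verts F" "snd h' ` edges F' = edges F"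
    using h h' by (auto simp: surjs_def)
  have "card (verts F) = card (verts F')" "card (edges F) = card (edges F')"
    using f s by (metis card_image_le le_antisym)+
  then have "inj_on (fst h) (verts F)" "inj_on (snd h) (edges F)"
    using f s eq_card_imp_inj_on by metis+
  then have "iso F F' h" using s h by (auto simp: iso_def bij_betw_def surjs_def homs_def)
  then show ?thesis using that h by (auto simp: surjs_def homs_def)
qed

lemma represents_iso:
  fixes F F' :: "('g, 'u) hgraph"
  assumes "represents S m n t (F, f, g)" "represents S m n t' (F', f', g')"
    and "\<And>(K :: ('g, 'u) hgraph) x y. finhyp S K \<Longrightarrow> x \<in> tuples K m \<Longrightarrow> y \<in> tuples K n \<Longrightarrow> cnt S K t x y = cnt S K t' x y"
  obtains h where "iso F F' h" "map (fst h) f = f'" "map (fst h) g = g'"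
proof -
  have F: "finhyp S F" "f \<in> tuples F m" "g \<in> tuples F n" and F': "finhyp S F'" "f' \<in> tuples F' m" "g' \<in> tuples F' n"
    using assms(1,2) by (auto simp: represents_def)
  have "card (homs F (f @ g) K z) = card (homs F' (f' @ g') K z)"
    if K: "finhyp S K" "set z \<subseteq> verts K" "length z = m + n" for z and K :: "('g, 'u) hgraph"
  proof -
    have "z \<in> tuples K (m + n)" using K by (simp add: tuples_def)
    then obtain x y where z: "z = x @ y" "x \<in> tuples K m" "y \<in> tuples K n" by (rule tuples_addE)
    then show ?thesis using assms K by (simp add: represents_def)
  qed
  note eq = this
  have s: "set (f @ g) \<subseteq> verts F" "set (f' @ g') \<subseteq> verts F'" "length (f @ g) = m + n" "length (f' @ g') = m + n"
    using F F' by (auto simp: tuples_def)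
  obtain h where h: "iso F F' h" "map (fst h) (f @ g) = f' @ g'"
    using lovasz[OF F(1) s(1) F'(1) s(2-4) eq] .
  moreover have "length f = length f'" using F F' tuples_length by metis
  ultimately show ?thesis using that by simp
qed

lemma discrete_iso: "discrete_on F vs \<Longrightarrow> iso F F' h \<Longrightarrow> discrete_on F' (map (fst h) vs)"
  by (auto simp: discrete_on_def iso_def bij_betw_def distinct_map)

text \<open>Every clause of \<open>interp\<close> admits arbitrary representatives; for composites
  and tensors it is the apex that moves, and the structure maps are composed with
  \<open>h\<close>.\<close>

lemma interp_iso:
  assumes c: "(F, f, g) \<in> interp S t" and i: "iso F F' h"
  shows "(F', map (fst h) f, map (fst h) g) \<in> interp S t"
proof -
  have m: "hmor F F' h" and bv: "bij_betw (fst h) (verts F) (verts F')" and be: "bij_betw (snd h) (edges F) (edges F')"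
    using i by (auto simp: iso_def)
  show ?thesis
  proof (cases t)
    case (FGen \<phi>)
    then obtain e where F: "hypergraph S F" "distinct (f @ g)" "verts F = set (f @ g)" "edges F = {e}" "lab F e = \<phi>" "src F e = f" "tgt F e = g"
      using c by (auto simp: csp_gen_def)
    have "distinct (map (fst h) (f @ g))" unfolding distinct_map using F bv by (auto simp: bij_betw_def)
    moreover have "verts F' = set (map (fst h) (f @ g))" using F bv by (auto simp: bij_betw_def)
    moreover have "edges F' = {snd h e}" using F be by (auto simp: bij_betw_def)
    moreover have "lab F' (snd h e) = \<phi> \<and> src F' (snd h e) = map (fst h) f \<and> tgt F' (snd h e) = map (fst h) g"
      using m F by (auto simp: hmor_def)
    ultimately show ?thesis using FGen iso_hypergraph[OF F(1) i] by (auto simp: csp_gen_def)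
  next
    case (FSeq s u)
    then obtain p p' G f' g' G' f'' g'' where e: "f = map (fst p) f'" "g = map (fst p') g''"
      and G: "(G, f', g') \<in> interp S s" "(G', f'', g'') \<in> interp S u" and po: "is_pushout S (length g') g' f'' G G' F p p'"
      using c by (auto simp: csp_seq_def)
    have "is_pushout S (length g') g' f'' G G' F' (hcomp h p) (hcomp h p')" by (rule pushout_transfer[OF po i])
    moreover have "map (fst h) f = map (fst (hcomp h p)) f'" "map (fst h) g = map (fst (hcomp h p')) g''" using e by auto
    ultimately show ?thesis using G FSeq unfolding interp.simps csp_seq_def FSeq by blast
  next
    case (FTens s u)
    then obtain p p' G f' g' G' f'' g'' where e: "f = map (fst p) f' @ map (fst p') f''" "g = map (fst p) g' @ map (fst p') g''"
      and G: "(G, f', g') \<in> interp S s" "(G', f'', g'') \<in> interp S u" and du: "is_disjoint_union G G' F p p'" and hF: "hypergraph S F"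
      using c by (auto simp: csp_tens_def)
    have c1: "case_sum (fst (hcomp h p)) (fst (hcomp h p')) = fst h \<circ> case_sum (fst p) (fst p')"
      "case_sum (snd (hcomp h p)) (snd (hcomp h p')) = snd h \<circ> case_sum (snd p) (snd p')"
      by (auto simp: fun_eq_iff split: sum.splits)
    have "is_disjoint_union G G' F' (hcomp h p) (hcomp h p')"
      unfolding is_disjoint_union_def c1
    proof (intro conjI)
      have "hmor G F p" "hmor G' F p'" using du by (auto simp: is_disjoint_union_def)
      then show "hmor G F' (hcomp h p)" "hmor G' F' (hcomp h p')"
        using m unfolding hmor_def hcomp_def by (auto simp: image_subset_iff)
      show "bij_betw (fst h \<circ> case_sum (fst p) (fst p')) (verts G <+> verts G') (verts F')"
        using du bv by (auto simp: is_disjoint_union_def intro: bij_betw_trans)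
      show "bij_betw (snd h \<circ> case_sum (snd p) (snd p')) (edges G <+> edges G') (edges F')"
        using du be by (auto simp: is_disjoint_union_def intro: bij_betw_trans)
    qed
    moreover have "map (fst h) f = map (fst (hcomp h p)) f' @ map (fst (hcomp h p')) f''"
      "map (fst h) g = map (fst (hcomp h p)) g' @ map (fst (hcomp h p')) g''" using e by auto
    ultimately show ?thesis using G iso_hypergraph[OF hF i] unfolding FTens interp.simps csp_tens_def by blast
  qed (use c discrete_iso[OF _ i] in \<open>fastforce+\<close>)
qed

lemma ex_distinct_list: "\<exists>vs :: 'u::infinite list. distinct vs \<and> length vs = n"
proof -
  obtain B :: "'u set" where "finite B" "card B = n"
    using infinite_arbitrarily_large[OF infinite_UNIV] by metis
  then show ?thesis using finite_distinct_list[of B] distinct_card by metis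
qed

lemma ex_discrete: "\<exists>F vs. discrete_on (F :: ('g, 'u::infinite) hgraph) vs \<and> length vs = n"
proof -
  obtain vs :: "'u list" where vs: "distinct vs" "length vs = n" using ex_distinct_list by blast
  then have "discrete_on \<lparr>verts = set vs, edges = {}, lab = undefined, src = undefined, tgt = undefined\<rparr> vs" by (simp add: discrete_on_def)
  then show ?thesis using vs by blast
qed

lemma disjoint_union_exists:
  fixes F F' :: "('g, 'u::infinite) hgraph"
  assumes "hypergraph S F" "hypergraph S F'"
  shows "\<exists>H p p'. hypergraph S H \<and> is_disjoint_union F F' H p p'"
proof -
  obtain emb :: "'u + 'u \<Rightarrow> 'u" where emb: "inj emb" using ex_emb by blast
  define i where "i = inv emb"
  have i [simp]: "i (emb x) = x" for x using emb by (simp add: i_def)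
  let ?p = "(emb \<circ> Inl, emb \<circ> Inl)" and ?q = "(emb \<circ> Inr, emb \<circ> Inr)"
  define H :: "('g, 'u) hgraph" where "H = \<lparr>verts = emb ` (verts F <+> verts F'), edges = emb ` (edges F <+> edges F'),
     lab = case_sum (lab F) (lab F') \<circ> i, src = case_sum (map (emb \<circ> Inl) \<circ> src F) (map (emb \<circ> Inr) \<circ> src F') \<circ> i,
     tgt = case_sum (map (emb \<circ> Inl) \<circ> tgt F) (map (emb \<circ> Inr) \<circ> tgt F') \<circ> i\<rparr>"
  have c: "case_sum (emb \<circ> Inl) (emb \<circ> Inr) = emb" by (auto simp: fun_eq_iff split: sum.splits)
  have "hmor F H ?p" "hmor F' H ?q" by (auto simp: hmor_def H_def)
  moreover have "bij_betw emb (verts F <+> verts F') (verts H)" "bij_betw emb (edges F <+> edges F') (edges H)"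
    using emb by (auto simp: bij_betw_def H_def inj_on_def)
  ultimately have "is_disjoint_union F F' H ?p ?q" by (simp add: is_disjoint_union_def c)
  moreover have "hypergraph S H" unfolding hypergraph_def
  proof
    fix e assume "e \<in> edges H"
    then consider d where "d \<in> edges F" "e = emb (Inl d)" | d where "d \<in> edges F'" "e = emb (Inr d)" by (auto simp: H_def)
    then show "lab H e \<in> gens S \<and> length (src H e) = arity S (lab H e) \<and> set (src H e) \<subseteq> verts H \<and>
       length (tgt H e) = coarity S (lab H e) \<and> set (tgt H e) \<subseteq> verts H"
      using assms by cases (force simp: H_def hypergraph_def)+
  qed
  ultimately show ?thesis by blast
qed

lemma interp_nonempty: "ftyped S t m n \<Longrightarrow> \<exists>F f g. (F, f, g) \<in> (interp S t :: ('g, 'u::infinite) cospan set)"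
proof (induction t arbitrary: m n)
  case (FGen \<phi>)
  obtain vs :: "'u list" where vs: "distinct vs" "length vs = arity S \<phi> + coarity S \<phi>" using ex_distinct_list by blast
  let ?f = "take (arity S \<phi>) vs" and ?g = "drop (arity S \<phi>) vs"
  have "(\<lparr>verts = set vs, edges = {undefined}, lab = \<lambda>_. \<phi>, src = \<lambda>_. ?f, tgt = \<lambda>_. ?g\<rparr>, ?f, ?g) \<in> csp_gen S \<phi>"
    using vs FGen set_take_subset[of "arity S \<phi>" vs] set_drop_subset[of "arity S \<phi>" vs]
    by (simp add: csp_gen_def hypergraph_def flip: set_append distinct_append)
  then show ?case by auto
next
  case (FId k)
  obtain F :: "('g, 'u) hgraph" and vs where "discrete_on F vs" "length vs = k" using ex_discrete by blast
  then show ?case by auto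
next
  case (FSym k l)
  obtain F :: "('g, 'u) hgraph" and vs where F: "discrete_on F vs" "length vs = k + l" using ex_discrete by blast
  then have "discrete_on F (take k vs @ drop k vs)" "length (take k vs) = k" "length (drop k vs) = l" by auto
  then show ?case unfolding interp.simps by blast
next
  case (FSeq s t)
  then obtain k where k: "ftyped S s m k" "ftyped S t k n" by auto
  obtain F f g F' f' g' where F: "(F, f, g) \<in> (interp S s :: ('g, 'u) cospan set)" "(F', f', g') \<in> (interp S t :: ('g, 'u) cospan set)"
    using FSeq k by metis
  then have r: "represents S m k s (F, f, g)" "represents S k n t (F', f', g')" using interp_represents k by blast+
  then have h: "hypergraph S F" "hypergraph S F'" "discrete_mor k F g" "discrete_mor k F' f'" "length g = k"
    by (auto simp: represents_def finhyp_def tuples_def discrete_mor_def)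
  obtain H p q where "is_pushout S k g f' F F' H p q" using pushout_exists[OF h(1-4)] by metis
  then have "(H, map (fst p) f, map (fst q) g') \<in> interp S (s ;\<^sub>F t)"
    unfolding interp.simps csp_seq_def using F h(5) by blast
  then show ?case by blast
next
  case (FTens s t)
  then obtain m1 n1 m2 n2 where k: "ftyped S s m1 n1" "ftyped S t m2 n2" by auto
  obtain F f g F' f' g' where F: "(F, f, g) \<in> (interp S s :: ('g, 'u) cospan set)" "(F', f', g') \<in> (interp S t :: ('g, 'u) cospan set)"
    using FTens k by metis
  then have r: "represents S m1 n1 s (F, f, g)" "represents S m2 n2 t (F', f', g')" using interp_represents k by blast+
  then have h: "hypergraph S F" "hypergraph S F'" by (auto simp: represents_def finhyp_def)
  obtain H p p' where "hypergraph S H" "is_disjoint_union F F' H p p'" using disjoint_union_exists[OF h] by blast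
  then have "(H, map (fst p) f @ map (fst p') f', map (fst p) g @ map (fst p') g') \<in> interp S (s \<otimes>\<^sub>F t)"
    unfolding interp.simps csp_tens_def using F by blast
  then show ?case by blast
qed (use ex_discrete[of 1] in \<open>auto simp: length_Suc_conv\<close>)

text \<open>The counts fix a finite cospan up to isomorphism, while \<open>interp\<close> is
  nonempty and closed under isomorphism, so the numerical condition is exact.\<close>

lemma interp_iff:
  fixes F :: "('g, 'u::infinite) hgraph"
  assumes t: "ftyped S t m n"
  shows "(F, f, g) \<in> interp S t \<longleftrightarrow> represents S m n t (F, f, g)"
proof
  assume r: "represents S m n t (F, f, g)"
  obtain F' f' g' where F': "(F', f', g') \<in> (interp S t :: ('g, 'u) cospan set)" using interp_nonempty[OF t] by blast
  obtain h where "iso F' F h" "map (fst h) f' = f" "map (fst h) g' = g"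
    using represents_iso[OF interp_represents[OF t F'] r] by auto
  then show "(F, f, g) \<in> interp S t" using interp_iso[OF F'] by blast
qed (rule interp_represents[OF t])

text \<open>Equal terms have equal matrices, so the union over the class adds no cospans.\<close>

lemma sem_iff:
  fixes F :: "('g, 'u::infinite) hgraph"
  assumes t: "ftyped S t m n"
  shows "(F, f, g) \<in> sem S (fmorphism S m n t) \<longleftrightarrow> represents S m n t (F, f, g)"
proof -
  have "represents S m n t' (F, f, g) \<longleftrightarrow> represents S m n t (F, f, g)" if "feq S m n t t'" for t'
  proof -
    have "cnt S K t' x y = cnt S K t x y" if "finhyp S K" "x \<in> tuples K m" "y \<in> tuples K n" for x y and K :: "('g, 'u) hgraph"
      by (rule feq_cnt[OF _ \<open>feq S m n t t'\<close>, symmetric]) (use that in \<open>simp_all add: finhyp_def\<close>)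
    then show ?thesis by (auto simp: represents_def)
  qed
  note eq = this
  show ?thesis
  proof
    assume "(F, f, g) \<in> sem S (fmorphism S m n t)"
    then obtain t' where t': "feq S m n t t'" "(F, f, g) \<in> interp S t'" by (auto simp: sem_def fmorphism_def)
    then have "ftyped S t' m n" using feq_typed by blast
    then show "represents S m n t (F, f, g)" using interp_represents t' eq by blast
  next
    assume "represents S m n t (F, f, g)"
    then have "(F, f, g) \<in> interp S t" using interp_iff[OF t] by blast
    then show "(F, f, g) \<in> sem S (fmorphism S m n t)" using feq_refl[OF t] by (auto simp: sem_def fmorphism_def)
  qed
qed

section \<open>Counting semantics of normal forms\<close>

context signature begin

text \<open>The matrix entry is taken at the chosen representative; \<open>mor_cnt_cls\<close> shows
  that every term of the class gives the same value.\<close>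

definition mor_cnt :: "('g, 'u) hgraph \<Rightarrow> 'g mor \<Rightarrow> 'u list \<Rightarrow> 'u list \<Rightarrow> nat" where
  "mor_cnt K f a b = cnt S K (IC (rep f)) a b"

context
  fixes K :: "('g, 'u) hgraph"
  assumes fin [simp]: "finite (verts K)"
begin

lemma mor_cnt_cls: "ttyped S t m n \<Longrightarrow> a \<in> tuples K m \<Longrightarrow> b \<in> tuples K n \<Longrightarrow> mor_cnt K (cls m n t) a b = cnt S K (IC t) a b"
  unfolding mor_cnt_def using teq_cnt[OF fin rep_cls] by metis

lemma rep_dom: "arr f \<Longrightarrow> fdom S (IC (rep f)) = dom f \<and> fcod S (IC (rep f)) = cod f"
  using IC_dom rep_typed by blast

lemma mor_cnt_comp:
  assumes "arr f" "arr g" "cod f = dom g" "a \<in> tuples K (dom f)" "b \<in> tuples K (cod g)"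
  shows "mor_cnt K (f \<cdot> g) a b = (\<Sum>z\<in>tuples K (cod f). mor_cnt K f a z * mor_cnt K g z b)"
proof -
  have "ttyped S (rep f ;\<^sub>T rep g) (dom f) (cod g)" using assms rep_typed by (metis ttyped.intros(4))
  then have "mor_cnt K (f \<cdot> g) a b = cnt S K (IC (rep f ;\<^sub>T rep g)) a b"
    unfolding comp_def using mor_cnt_cls assms by blast
  then show ?thesis using rep_dom assms by (simp add: mor_cnt_def)
qed

lemma mor_cnt_tens:
  assumes "arr f" "arr g" "a \<in> tuples K (dom f)" "b \<in> tuples K (cod f)" "a' \<in> tuples K (dom g)" "b' \<in> tuples K (cod g)"
  shows "mor_cnt K (f \<otimes> g) (a @ a') (b @ b') = mor_cnt K f a b * mor_cnt K g a' b'"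
proof -
  have "ttyped S (rep f \<otimes>\<^sub>T rep g) (dom f + dom g) (cod f + cod g)" using assms rep_typed by (metis ttyped.intros(5))
  then have "mor_cnt K (f \<otimes> g) (a @ a') (b @ b') = cnt S K (IC (rep f \<otimes>\<^sub>T rep g)) (a @ a') (b @ b')"
    unfolding tens_def using mor_cnt_cls assms tuples_append by metis
  then show ?thesis using rep_dom[OF assms(1)] assms by (simp add: mor_cnt_def tuples_length)
qed

lemma mor_cnt_Tr:
  assumes "arr f" "dom f = x + m" "cod f = x + n" "a \<in> tuples K m" "b \<in> tuples K n"
  shows "mor_cnt K (Tr x f) a b = (\<Sum>z\<in>tuples K x. mor_cnt K f (z @ a) (z @ b))"
proof -
  have "ttyped S (TTr x m n (rep f)) m n" using assms rep_typed by (metis ttyped.intros(6))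
  then have "mor_cnt K (Tr x f) a b = cnt S K (IC (TTr x m n (rep f))) a b"
    unfolding Tr_def using mor_cnt_cls assms by simp
  also have "\<dots> = (\<Sum>z\<in>tuples K x. cnt S K (IC (rep f)) (z @ a) (z @ b))"
    unfolding IC.simps by (rule cnt_trace) (use rep_dom assms in auto)
  finally show ?thesis by (simp add: mor_cnt_def)
qed

lemma mor_cnt_Idn: "a \<in> tuples K n \<Longrightarrow> b \<in> tuples K n \<Longrightarrow> mor_cnt K (Idn n) a b = of_bool (a = b)"
  unfolding Idn_def by (subst mor_cnt_cls) auto

lemma mor_cnt_Sym: "a \<in> tuples K m \<Longrightarrow> b \<in> tuples K n \<Longrightarrow> c \<in> tuples K (n + m) \<Longrightarrow> mor_cnt K (Sym m n) (a @ b) c = of_bool (c = b @ a)"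
  unfolding Sym_def by (subst mor_cnt_cls) (auto simp: tuples_append tuples_length)

lemma mor_cnt_Copy: "v \<in> verts K \<Longrightarrow> b \<in> tuples K 2 \<Longrightarrow> mor_cnt K Copy [v] b = of_bool (b = [v, v])"
  unfolding Copy_def by (subst mor_cnt_cls) (auto simp: tuples_append tuples_length)

lemma mor_cnt_Disc: "v \<in> verts K \<Longrightarrow> mor_cnt K Disc [v] [] = 1"
  unfolding Disc_def by (subst mor_cnt_cls) auto

lemma mor_cnt_Gen: "\<phi> \<in> gens S \<Longrightarrow> a \<in> tuples K (arity S \<phi>) \<Longrightarrow> b \<in> tuples K (coarity S \<phi>) \<Longrightarrow>
   mor_cnt K (Gen \<phi>) a b = card {e \<in> edges K. lab K e = \<phi> \<and> src K e = a \<and> tgt K e = b}"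
  unfolding Gen_def by (subst mor_cnt_cls) auto

lemma mor_cnt_dsc: "a \<in> tuples K n \<Longrightarrow> mor_cnt K (dsc n) a [] = 1"
proof (induct n arbitrary: a)
  case 0 then show ?case by (simp add: mor_cnt_Idn)
next
  case (Suc n)
  obtain v a' where a: "a = v # a'" "v \<in> verts K" "a' \<in> tuples K n" using Suc.prems by (rule tuples_SucE)
  have "mor_cnt K (Disc \<otimes> dsc n) ([v] @ a') ([] @ []) = 1"
    by (subst mor_cnt_tens) (use a Suc in \<open>simp_all add: mor_cnt_Disc\<close>)
  then show ?case using a by simp
qed

lemma mor_cnt_cpy: "a \<in> tuples K n \<Longrightarrow> b \<in> tuples K n \<Longrightarrow> c \<in> tuples K n \<Longrightarrow> mor_cnt K (cpy n) a (b @ c) = of_bool (b = a \<and> c = a)"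
proof (induct n arbitrary: a b c)
  case 0 then show ?case by (simp add: mor_cnt_Idn)
next
  case (Suc n)
  obtain v a' where a: "a = v # a'" "v \<in> verts K" "a' \<in> tuples K n" using Suc.prems(1) by (rule tuples_SucE)
  obtain w b' where b: "b = w # b'" "w \<in> verts K" "b' \<in> tuples K n" using Suc.prems(2) by (rule tuples_SucE)
  obtain u c' where c: "c = u # c'" "u \<in> verts K" "c' \<in> tuples K n" using Suc.prems(3) by (rule tuples_SucE)
  have "mor_cnt K (cpy (Suc n)) a (b @ c) = (\<Sum>z\<in>tuples K (2 + (n + n)). mor_cnt K (Copy \<otimes> cpy n) a z * mor_cnt K (Idn 1 \<otimes> (Sym 1 n \<otimes> Idn n)) z (b @ c))"
    unfolding cpy.simps
    by (subst mor_cnt_comp) (use Suc.prems in \<open>auto intro: tuples_append[of _ _ "Suc n" _ "Suc n", simplified]\<close>)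
  also have "\<dots> = mor_cnt K (Copy \<otimes> cpy n) a ([w, u] @ (b' @ c'))"
  proof (rule sum_delta_on(2))
    fix z assume "z \<in> tuples K (2 + (n + n))"
    then obtain z1 z2 z3 where z: "z = z1 @ z2 @ z3" "z1 \<in> tuples K 2" "z2 \<in> tuples K n" "z3 \<in> tuples K n" by (metis tuples_addE)
    obtain p q where z1: "z1 = [p, q]" "p \<in> verts K" "q \<in> verts K" using z(2) by (auto elim!: tuples_SucE simp: numeral_2_eq_2)
    have "mor_cnt K (Idn 1 \<otimes> (Sym 1 n \<otimes> Idn n)) ([p] @ (([q] @ z2) @ z3)) ([w] @ ((b' @ [u]) @ c')) = of_bool (p = w \<and> b' @ [u] = z2 @ [q] \<and> z3 = c')"
    proof -
      have "b' @ [u] \<in> tuples K (n + 1)" "[q] @ z2 \<in> tuples K (1 + n)" using b c z z1 by (auto simp: tuples_def)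
      then have "mor_cnt K (Sym 1 n \<otimes> Idn n) (([q] @ z2) @ z3) ((b' @ [u]) @ c') = mor_cnt K (Sym 1 n) ([q] @ z2) (b' @ [u]) * mor_cnt K (Idn n) z3 c'"
        using z c by (intro mor_cnt_tens) simp_all
      moreover have "mor_cnt K (Idn 1 \<otimes> (Sym 1 n \<otimes> Idn n)) ([p] @ (([q] @ z2) @ z3)) ([w] @ ((b' @ [u]) @ c')) =
        mor_cnt K (Idn 1) [p] [w] * mor_cnt K (Sym 1 n \<otimes> Idn n) (([q] @ z2) @ z3) ((b' @ [u]) @ c')"
        using z z1 b c by (intro mor_cnt_tens) (simp_all, auto simp: tuples_def)
      ultimately have "mor_cnt K (Idn 1 \<otimes> (Sym 1 n \<otimes> Idn n)) ([p] @ (([q] @ z2) @ z3)) ([w] @ ((b' @ [u]) @ c')) =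
        mor_cnt K (Idn 1) [p] [w] * (mor_cnt K (Sym 1 n) ([q] @ z2) (b' @ [u]) * mor_cnt K (Idn n) z3 c')"
        by (simp only:)
      also have "mor_cnt K (Sym 1 n) ([q] @ z2) (b' @ [u]) = of_bool (b' @ [u] = z2 @ [q])"
        by (rule mor_cnt_Sym) (use b c z z1 in \<open>auto simp: tuples_def\<close>)
      finally show ?thesis using z z1 b c by (simp add: mor_cnt_Idn)
    qed
    then show "mor_cnt K (Idn 1 \<otimes> (Sym 1 n \<otimes> Idn n)) z (b @ c) = of_bool (z = [w, u] @ (b' @ c'))"
      using z z1 b c by (auto simp: tuples_length)
  qed (use b c in \<open>auto simp: tuples_append\<close>)
  also have "\<dots> = mor_cnt K Copy [v] [w, u] * mor_cnt K (cpy n) a' (b' @ c')"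
    using mor_cnt_tens[of Copy "cpy n" "[v]" "[w, u]" a' "b' @ c'"] a b c by (simp add: tuples_append)
  finally show ?case using Suc.hyps[OF a(3) b(3) c(3)] a b c by (auto simp: mor_cnt_Copy)
qed

lemma mor_cnt_pair:
  assumes "arr f" "arr g" "dom f = dom g" "a \<in> tuples K (dom f)" "b \<in> tuples K (cod f)" "c \<in> tuples K (cod g)"
  shows "mor_cnt K (pair f g) a (b @ c) = mor_cnt K f a b * mor_cnt K g a c"
proof -
  have "mor_cnt K (pair f g) a (b @ c) = (\<Sum>z\<in>tuples K (dom f + dom f). mor_cnt K (cpy (dom f)) a z * mor_cnt K (f \<otimes> g) z (b @ c))"
    unfolding pair_def by (subst mor_cnt_comp) (use assms in \<open>simp_all add: tuples_append\<close>)
  also have "\<dots> = mor_cnt K (f \<otimes> g) (a @ a) (b @ c)"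
  proof (rule sum_delta_on(1))
    fix z assume "z \<in> tuples K (dom f + dom f)"
    then obtain z1 z2 where "z = z1 @ z2" "z1 \<in> tuples K (dom f)" "z2 \<in> tuples K (dom f)" by (rule tuples_addE)
    then show "mor_cnt K (cpy (dom f)) a z = of_bool (z = a @ a)" using assms(4) by (auto simp: mor_cnt_cpy tuples_length)
  qed (use assms in \<open>simp_all add: tuples_append\<close>)
  finally show ?thesis using mor_cnt_tens assms by simp
qed

lemma mor_cnt_pr: "k < m \<Longrightarrow> a \<in> tuples K m \<Longrightarrow> v \<in> verts K \<Longrightarrow> mor_cnt K (proj m k) a [v] = of_bool (a ! k = v)"
proof -
  assume k: "k < m" and a: "a \<in> tuples K m" and v: "v \<in> verts K"
  have "m = k + (1 + (m - Suc k))" using k by simp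
  then obtain a1 a2 a3 where e: "a = a1 @ a2 @ a3" "a1 \<in> tuples K k" "a2 \<in> tuples K 1" "a3 \<in> tuples K (m - Suc k)"
    using a tuples_addE by metis
  then obtain w where w: "a2 = [w]" "w \<in> verts K" by (auto elim: tuples_SucE)
  have "mor_cnt K (Idn 1 \<otimes> dsc (m - Suc k)) ([w] @ a3) ([v] @ []) = mor_cnt K (Idn 1) [w] [v] * mor_cnt K (dsc (m - Suc k)) a3 []"
    using e w v by (intro mor_cnt_tens) simp_all
  moreover have "mor_cnt K (proj m k) (a1 @ ([w] @ a3)) ([] @ ([v] @ [])) = mor_cnt K (dsc k) a1 [] * mor_cnt K (Idn 1 \<otimes> dsc (m - Suc k)) ([w] @ a3) ([v] @ [])"
    unfolding proj_def using e w v by (intro mor_cnt_tens) simp_all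
  ultimately have "mor_cnt K (proj m k) (a1 @ ([w] @ a3)) ([] @ ([v] @ [])) = of_bool (w = v)"
    using e w v by (simp add: mor_cnt_dsc mor_cnt_Idn)
  then show ?thesis using e w by (simp add: nth_append tuples_length)
qed

lemma mor_cnt_W: "\<forall>k \<in> set ks. k < m \<Longrightarrow> a \<in> tuples K m \<Longrightarrow> b \<in> tuples K (length ks) \<Longrightarrow> mor_cnt K (W m ks) a b = of_bool (map ((!) a) ks = b)"
proof (induct ks arbitrary: b)
  case Nil then show ?case by (simp add: mor_cnt_dsc)
next
  case (Cons k ks)
  obtain v b' where b: "b = v # b'" "v \<in> verts K" "b' \<in> tuples K (length ks)" using Cons.prems(3) by (auto elim: tuples_SucE)
  have "mor_cnt K (W m (k # ks)) a ([v] @ b') = mor_cnt K (proj m k) a [v] * mor_cnt K (W m ks) a b'"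
    unfolding W.simps by (rule mor_cnt_pair) (use Cons.prems b in simp_all)
  then show ?case using Cons b by (simp add: mor_cnt_pr)
qed

lemma mor_cnt_wire:
  assumes "set Y \<subseteq> set X" "a \<in> tuples K (length X)" "b \<in> tuples K (length Y)"
  shows "mor_cnt K (wire X Y) a b = of_bool (map (sub X a) Y = b)"
proof -
  have "mor_cnt K (wire X Y) a b = of_bool (map ((!) a) (map (pos X) Y) = b)"
    unfolding wire_def by (rule mor_cnt_W) (use assms in auto)
  also have "map ((!) a) (map (pos X) Y) = map (sub X a) Y" by (simp add: sub_def)
  finally show ?thesis .
qed

text \<open>The number of ways to place a block over a valuation \<open>\<eta>\<close> of its wires.
  A vertex without producer imposes no condition, hence the value \<open>1\<close>.\<close>

fun blk_cnt :: "('v \<Rightarrow> 'u) \<Rightarrow> 'g option \<times> 'v list \<times> 'v list \<Rightarrow> nat" where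
  "blk_cnt \<eta> (None, i, o') = 1"
| "blk_cnt \<eta> (Some \<phi>, i, o') = card {e \<in> edges K. lab K e = \<phi> \<and> src K e = map \<eta> i \<and> tgt K e = map \<eta> o'}"

lemma mor_cnt_blk:
  assumes "wf_blk d" "\<eta> ` (set (fst (snd d)) \<union> set (snd (snd d))) \<subseteq> verts K"
  shows "mor_cnt K (blk (fst d)) (map \<eta> (fst (snd d))) (map \<eta> (snd (snd d))) = blk_cnt \<eta> d"
proof (cases d rule: wf_blk.cases)
  case (1 i o')
  then obtain u where u: "o' = [u]" "i = []" "\<eta> u \<in> verts K" using assms by (auto simp: length_Suc_conv)
  have "mor_cnt K (Tr 1 Copy) [] [\<eta> u] = (\<Sum>z\<in>tuples K 1. mor_cnt K Copy (z @ []) (z @ [\<eta> u]))"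
    by (rule mor_cnt_Tr) (use u in auto)
  \<comment> \<open>Copying forces the loop value to equal the output, so one summand
    survives.\<close>
  also have "\<dots> = (\<Sum>z\<in>tuples K 1. of_bool (z = [\<eta> u]) * 1)"
  proof (rule sum.cong[OF refl])
    fix z assume "z \<in> tuples K 1"
    then obtain w where "z = [w]" "w \<in> verts K" by (auto elim: tuples_SucE)
    then show "mor_cnt K Copy (z @ []) (z @ [\<eta> u]) = of_bool (z = [\<eta> u]) * 1" using u by (simp add: mor_cnt_Copy)
  qed
  also have "\<dots> = 1" using u by (subst sum_delta_bool) auto
  finally show ?thesis using 1 u by simp
next
  case (2 \<phi> i o')
  then show ?thesis using assms by (simp, subst mor_cnt_Gen) (auto simp: tuples_def)
qed

lemma mor_cnt_box:
  assumes "\<forall>d \<in> set D. wf_blk d" "\<eta> ` (set (ins D) \<union> set (outs D)) \<subseteq> verts K"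
  shows "mor_cnt K (box D) (map \<eta> (ins D)) (map \<eta> (outs D)) = prod_list (map (blk_cnt \<eta>) D)"
  using assms
proof (induct D)
  case Nil then show ?case by (simp add: mor_cnt_Idn)
next
  case (Cons d D)
  have "mor_cnt K (box (d # D)) (map \<eta> (fst (snd d)) @ map \<eta> (ins D)) (map \<eta> (snd (snd d)) @ map \<eta> (outs D)) =
    mor_cnt K (blk (fst d)) (map \<eta> (fst (snd d))) (map \<eta> (snd (snd d))) * mor_cnt K (box D) (map \<eta> (ins D)) (map \<eta> (outs D))"
    unfolding box.simps
    by (rule mor_cnt_tens) (use Cons.prems blk_simps[of d] in \<open>auto simp: tuples_def\<close>)
  also have "mor_cnt K (blk (fst d)) (map \<eta> (fst (snd d))) (map \<eta> (snd (snd d))) = blk_cnt \<eta> d"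
    by (rule mor_cnt_blk) (use Cons.prems in auto)
  also have "mor_cnt K (box D) (map \<eta> (ins D)) (map \<eta> (outs D)) = prod_list (map (blk_cnt \<eta>) D)"
    by (rule Cons.hyps) (use Cons.prems in auto)
  finally show ?case by simp
qed

text \<open>The sum over loop values disappears, because the wiring forces them to be the valuation
  of the sources. What remains is a sum over values \<open>o'\<close> of the wires produced by
  blocks, extended by \<open>a\<close> on the inputs.\<close>

lemma mor_cnt_nf:
  assumes v: "valid D f g" and a: "a \<in> tuples K (length f)" and b: "b \<in> tuples K (length g)"
  defines "\<eta> \<equiv> \<lambda>o'. sub (outs D @ f) (o' @ a)"
  shows "mor_cnt K (nf D f g) a b = (\<Sum>o'\<in>tuples K (length (outs D)). prod_list (map (blk_cnt (\<eta> o')) D) * of_bool (map (\<eta> o') g = b))"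
proof -
  have w: "\<forall>d \<in> set D. wf_blk d" and d: "distinct (outs D @ f)" and s: "set (ins D @ g) \<subseteq> set (outs D @ f)"
    using v by (auto simp: valid_def)
  let ?A = "length (ins D)" and ?B = "length (outs D)" and ?m = "length f" and ?n = "length g"
  let ?w = "wire (outs D @ f) (ins D @ g)"
  have [simp]: "arr ?w" "dom ?w = ?B + ?m" "cod ?w = ?A + ?n" using s by auto
  note [simp] = box_simps[OF w]
  have la: "length a = ?m" "length b = ?n" using a b tuples_length by auto
  have 1: "mor_cnt K ((box D \<otimes> Idn ?m) \<cdot> ?w) (z @ a) (z @ b) = (\<Sum>o'\<in>tuples K ?B. mor_cnt K (box D) z o' * (of_bool (z = map (\<eta> o') (ins D)) * of_bool (map (\<eta> o') g = b)))"
    if z: "z \<in> tuples K ?A" for z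
  proof -
    have "mor_cnt K ((box D \<otimes> Idn ?m) \<cdot> ?w) (z @ a) (z @ b) = (\<Sum>q\<in>tuples K (?B + ?m). mor_cnt K (box D \<otimes> Idn ?m) (z @ a) q * mor_cnt K ?w q (z @ b))"
      by (subst mor_cnt_comp) (use z a b in \<open>auto simp: tuples_append\<close>)
    also have "\<dots> = (\<Sum>o'\<in>tuples K ?B. \<Sum>c\<in>tuples K ?m. of_bool (a = c) * (mor_cnt K (box D) z o' * mor_cnt K ?w (o' @ c) (z @ b)))"
      unfolding sum_tuples_add[OF fin]
      by (rule sum.cong[OF refl], rule sum.cong[OF refl], subst mor_cnt_tens) (use z a in \<open>simp_all add: mor_cnt_Idn\<close>)
    also have "\<dots> = (\<Sum>o'\<in>tuples K ?B. mor_cnt K (box D) z o' * mor_cnt K ?w (o' @ a) (z @ b))"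
      using a by (intro sum.cong refl) (subst sum_delta_bool, auto)
    also have "\<dots> = (\<Sum>o'\<in>tuples K ?B. mor_cnt K (box D) z o' * (of_bool (z = map (\<eta> o') (ins D)) * of_bool (map (\<eta> o') g = b)))"
    proof (rule sum.cong[OF refl])
      fix o' assume o': "o' \<in> tuples K ?B"
      have "mor_cnt K ?w (o' @ a) (z @ b) = of_bool (map (\<eta> o') (ins D @ g) = z @ b)"
        unfolding \<eta>_def by (rule mor_cnt_wire) (use s o' a z b in \<open>auto simp: tuples_append\<close>)
      then show "mor_cnt K (box D) z o' * mor_cnt K ?w (o' @ a) (z @ b) = mor_cnt K (box D) z o' * (of_bool (z = map (\<eta> o') (ins D)) * of_bool (map (\<eta> o') g = b))"
        using tuples_length[OF z] by auto
    qed
    finally show ?thesis .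
  qed
  have "mor_cnt K (nf D f g) a b = (\<Sum>z\<in>tuples K ?A. mor_cnt K ((box D \<otimes> Idn ?m) \<cdot> ?w) (z @ a) (z @ b))"
    unfolding nf_def by (rule mor_cnt_Tr) (use a b in auto)
  also have "\<dots> = (\<Sum>z\<in>tuples K ?A. \<Sum>o'\<in>tuples K ?B. mor_cnt K (box D) z o' * (of_bool (z = map (\<eta> o') (ins D)) * of_bool (map (\<eta> o') g = b)))"
    by (rule sum.cong[OF refl]) (rule 1)
  also have "\<dots> = (\<Sum>o'\<in>tuples K ?B. \<Sum>z\<in>tuples K ?A. mor_cnt K (box D) z o' * (of_bool (z = map (\<eta> o') (ins D)) * of_bool (map (\<eta> o') g = b)))"
    by (rule sum.swap)
  also have "\<dots> = (\<Sum>o'\<in>tuples K ?B. prod_list (map (blk_cnt (\<eta> o')) D) * of_bool (map (\<eta> o') g = b))"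
  proof (rule sum.cong[OF refl])
    fix o' assume o': "o' \<in> tuples K ?B"
    have len: "length (outs D @ f) = length (o' @ a)" using o' la tuples_length by fastforce
    have "\<eta> o' ` set (outs D @ f) \<subseteq> set (o' @ a)" unfolding \<eta>_def using sub_in[OF _ len] by blast
    then have V: "\<eta> o' ` set (outs D @ f) \<subseteq> verts K" using o' a by (auto simp: tuples_def)
    have "map (\<eta> o') (outs D @ f) = o' @ a" unfolding \<eta>_def by (rule map_sub_self[OF d len])
    then have O: "map (\<eta> o') (outs D) = o'" using tuples_length[OF o'] by auto
    have I: "map (\<eta> o') (ins D) \<in> tuples K ?A" using V s unfolding tuples_def by auto
    have "(\<Sum>z\<in>tuples K ?A. mor_cnt K (box D) z o' * (of_bool (z = map (\<eta> o') (ins D)) * of_bool (map (\<eta> o') g = b))) =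
      mor_cnt K (box D) (map (\<eta> o') (ins D)) o' * of_bool (map (\<eta> o') g = b)"
      using I by (subst sum_delta_bool'(2)) auto
    also have "mor_cnt K (box D) (map (\<eta> o') (ins D)) o' = prod_list (map (blk_cnt (\<eta> o')) D)"
    proof -
      have "\<eta> o' ` (set (ins D) \<union> set (outs D)) \<subseteq> verts K" using V s by auto
      from mor_cnt_box[OF w this] show ?thesis unfolding O .
    qed
    finally show "(\<Sum>z\<in>tuples K ?A. mor_cnt K (box D) z o' * (of_bool (z = map (\<eta> o') (ins D)) * of_bool (map (\<eta> o') g = b))) =
      prod_list (map (blk_cnt (\<eta> o')) D) * of_bool (map (\<eta> o') g = b)" .
  qed
  finally show ?thesis .
qed

end
end

section \<open>Partial left-monogamous cospans as normal forms\<close>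

text \<open>Vertices serve as wire names, so no naming has to be chosen; for \<open>es\<close> and
  \<open>us\<close> enumerating the hyperedges and producerless vertices, only their orders are
  arbitrary.\<close>

definition diagram_of :: "('g, 'u) hgraph \<Rightarrow> 'u list \<Rightarrow> 'u list \<Rightarrow> ('g, 'u) diagram" where
  "diagram_of C es us = map (\<lambda>e. (Some (lab C e), src C e, tgt C e)) es @ map (\<lambda>u. (None, [], [u])) us"

lemma diagram_of_simps [simp]:
  "ins (diagram_of C es us) = concat (map (src C) es)" "outs (diagram_of C es us) = concat (map (tgt C) es) @ us"
  by (auto simp: diagram_of_def ins_def outs_def comp_def)

lemma distinct_concat_map:
  "distinct xs \<Longrightarrow> distinct (concat (map t xs)) \<longleftrightarrow>
    (\<forall>x \<in> set xs. distinct (t x)) \<and> (\<forall>x \<in> set xs. \<forall>y \<in> set xs. x \<noteq> y \<longrightarrow> set (t x) \<inter> set (t y) = {})"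
  by (induct xs) (auto, (metis disjoint_iff)+)

lemma mset_concat_map: "mset (concat (map t xs)) = (\<Sum>x\<in>#mset xs. mset (t x))"
  by (induct xs) auto

definition tgt_at :: "('g, 'u) hgraph \<Rightarrow> 'u \<Rightarrow> ('u \<times> nat) set" where
  "tgt_at F v = {(e, j). e \<in> edges F \<and> j < length (tgt F e) \<and> v = tgt F e ! j}"

lemma finite_tgt_at: "finite (edges F) \<Longrightarrow> finite (tgt_at F v)"
  by (rule finite_subset[of _ "Sigma (edges F) (\<lambda>e. {..<length (tgt F e)})"]) (auto simp: tgt_at_def)

text \<open>For finitely many hyperedges the degree bounds become statements about pairs of target
  positions, free of cardinalities.\<close>

lemma in_degree_iff:
  assumes "finite (edges F)"
  shows "in_degree F v = 0 \<longleftrightarrow> tgt_at F v = {}"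
    "in_degree F v \<in> {0, 1} \<longleftrightarrow> (\<forall>p \<in> tgt_at F v. \<forall>q \<in> tgt_at F v. p = q)"
proof -
  have d: "in_degree F v = enat (card (tgt_at F v))"
    using finite_tgt_at[OF assms, of v] unfolding in_degree_def tgt_at_def by (simp add: Let_def)
  show "in_degree F v = 0 \<longleftrightarrow> tgt_at F v = {}"
    unfolding d using finite_tgt_at[OF assms, of v] by (simp add: zero_enat_def)
  have "in_degree F v \<in> {0, 1} \<longleftrightarrow> card (tgt_at F v) \<le> Suc 0"
    unfolding d by (auto simp: zero_enat_def one_enat_def)
  then show "in_degree F v \<in> {0, 1} \<longleftrightarrow> (\<forall>p \<in> tgt_at F v. \<forall>q \<in> tgt_at F v. p = q)"
    using card_le_Suc0_iff_eq[OF finite_tgt_at[OF assms, of v]] by simp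
qed

context signature begin

definition enum :: "('g, 'u) hgraph \<Rightarrow> 'u list \<Rightarrow> 'u list \<Rightarrow> 'u list \<Rightarrow> 'u list \<Rightarrow> bool" where
  "enum C f g es us \<longleftrightarrow> distinct es \<and> set es = edges C \<and> valid (diagram_of C es us) f g \<and> set (outs (diagram_of C es us) @ f) = verts C"

lemma enum_finhyp:
  assumes "enum C f g es us"
  shows "finhyp S C" "f \<in> tuples C (length f)" "g \<in> tuples C (length g)"
proof -
  have e: "set es = edges C" and v: "\<forall>d \<in> set (diagram_of C es us). wf_blk d" "set (ins (diagram_of C es us) @ g) \<subseteq> set (outs (diagram_of C es us) @ f)"
    and V: "set (outs (diagram_of C es us) @ f) = verts C" using assms unfolding enum_def valid_def by blast+
  have "hypergraph S C" unfolding hypergraph_def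
  proof
    fix d assume d: "d \<in> edges C"
    then have "wf_blk (Some (lab C d), src C d, tgt C d)" using v(1) e by (auto simp: diagram_of_def simp del: wf_blk.simps)
    moreover have "set (src C d) \<subseteq> verts C" using d e v(2) V by (auto simp: subset_eq)
    moreover have "set (tgt C d) \<subseteq> verts C" using d e V by auto
    ultimately show "lab C d \<in> gens S \<and> length (src C d) = arity S (lab C d) \<and> set (src C d) \<subseteq> verts C \<and>
       length (tgt C d) = coarity S (lab C d) \<and> set (tgt C d) \<subseteq> verts C" by simp
  qed
  then show "finhyp S C" using e V unfolding finhyp_def by (metis List.finite_set)
  show "f \<in> tuples C (length f)" "g \<in> tuples C (length g)" using v(2) V by (auto simp: tuples_def)
qed

text \<open>A vertex occurring twice as a target, or both as a target and as an input, would repeat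
  in the distinct list of produced wires.\<close>

lemma enum_plm:
  assumes "enum C f g es us"
  shows "partial_left_monogamous (C, f, g)"
proof -
  have e: "set es = edges C" "distinct es" and "distinct (outs (diagram_of C es us) @ f)"
    using assms unfolding enum_def valid_def by blast+
  then have d: "distinct (concat (map (tgt C) es) @ us @ f)" by simp
  have fin: "finite (edges C)" using e by (metis List.finite_set)
  have "tgt_at C v = {}" if "v \<in> set f" for v
  proof -
    have "v \<notin> set (tgt C x)" if "x \<in> edges C" for x using that e d \<open>v \<in> set f\<close> by auto
    then show ?thesis unfolding tgt_at_def by (auto dest: nth_mem)
  qed
  moreover have "p = q" if p: "p \<in> tgt_at C v" "q \<in> tgt_at C v" for p q v
  proof -
    obtain x k y l where pq: "p = (x, k)" "q = (y, l)" by (metis surj_pair)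
    have a: "x \<in> edges C" "y \<in> edges C" "k < length (tgt C x)" "l < length (tgt C y)" "tgt C x ! k = v" "tgt C y ! l = v"
      using p pq by (auto simp: tgt_at_def)
    then have "v \<in> set (tgt C x)" "v \<in> set (tgt C y)" by (metis nth_mem)+
    moreover have c: "(\<forall>x \<in> set es. distinct (tgt C x)) \<and> (\<forall>x \<in> set es. \<forall>y \<in> set es. x \<noteq> y \<longrightarrow> set (tgt C x) \<inter> set (tgt C y) = {})"
    proof -
      have "distinct (concat (map (tgt C) es))" using d by simp
      then show ?thesis by (rule iffD1[OF distinct_concat_map[OF e(2)]])
    qed
    ultimately have "x = y" using a e by blast
    then show ?thesis using pq a c e nth_eq_iff_index_eq by metis
  qed
  ultimately show ?thesis using d in_degree_iff[OF fin] by auto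
qed

text \<open>Two occurrences of a vertex among the targets would be two elements of
  \<open>tgt_at\<close>, so the degree bounds give distinctness. The list \<open>us\<close> takes up
  exactly the vertices that are neither inputs nor targets.\<close>

lemma plm_enum:
  assumes C: "finhyp S C" and f: "f \<in> tuples C m" and g: "g \<in> tuples C n" and p: "partial_left_monogamous (C, f, g)"
  shows "\<exists>es us. enum C f g es us"
proof -
  have fin: "finite (edges C)" "finite (verts C)" and h: "hypergraph S C" using C by (auto simp: finhyp_def)
  obtain es where es: "set es = edges C" "distinct es" using finite_distinct_list[OF fin(1)] by blast
  obtain us where us: "set us = verts C - set f - set (concat (map (tgt C) es))" "distinct us"
    using finite_distinct_list[of "verts C - set f - set (concat (map (tgt C) es))"] fin by blast
  have T: "set (concat (map (tgt C) es)) \<subseteq> verts C" "set (concat (map (src C) es)) \<subseteq> verts C"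
    using h es by (auto simp: hypergraph_def)
  have A: "tgt_at C v = {}" if "v \<in> set f" for v
  proof -
    have "v \<in> verts C" using that f by (auto simp: tuples_def)
    then have "in_degree C v = 0" using p that by simp
    then show ?thesis using in_degree_iff(1)[OF fin(1)] by blast
  qed
  have B: "x = y" if "x \<in> tgt_at C v" "y \<in> tgt_at C v" "v \<in> verts C" for x y v
  proof -
    have "in_degree C v \<in> {0, 1}" using p that(3) by (cases "v \<in> set f") auto
    then show ?thesis using in_degree_iff(2)[OF fin(1)] that by blast
  qed
  have "distinct (concat (map (tgt C) es))"
    unfolding distinct_concat_map[OF es(2)]
  proof (intro conjI ballI impI)
    fix e assume e: "e \<in> set es"
    have "k = l" if "k < length (tgt C e)" "l < length (tgt C e)" "tgt C e ! k = tgt C e ! l" for k l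
    proof -
      have "(e, k) \<in> tgt_at C (tgt C e ! k)" "(e, l) \<in> tgt_at C (tgt C e ! k)" using that e es by (auto simp: tgt_at_def)
      moreover have "tgt C e ! k \<in> verts C" using T(1) e nth_mem[OF that(1)] by auto
      ultimately show ?thesis using B by blast
    qed
    then show "distinct (tgt C e)" by (auto simp: distinct_conv_nth)
  next
    fix e e' assume e: "e \<in> set es" "e' \<in> set es" "e \<noteq> e'"
    show "set (tgt C e) \<inter> set (tgt C e') = {}"
    proof (rule ccontr)
      assume "set (tgt C e) \<inter> set (tgt C e') \<noteq> {}"
      then obtain v where v: "v \<in> set (tgt C e)" "v \<in> set (tgt C e')" by blast
      obtain k where "k < length (tgt C e)" "tgt C e ! k = v" using v(1) by (metis in_set_conv_nth)
      then have "(e, k) \<in> tgt_at C v" using e es by (simp add: tgt_at_def)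
      moreover obtain l where "l < length (tgt C e')" "tgt C e' ! l = v" using v(2) by (metis in_set_conv_nth)
      then have "(e', l) \<in> tgt_at C v" using e es by (simp add: tgt_at_def)
      moreover have "v \<in> verts C" using T(1) e v by auto
      ultimately show False using B e by blast
    qed
  qed
  moreover have "set (concat (map (tgt C) es)) \<inter> set f = {}"
  proof (rule ccontr)
    assume "set (concat (map (tgt C) es)) \<inter> set f \<noteq> {}"
    then obtain v e where v: "v \<in> set f" "e \<in> set es" "v \<in> set (tgt C e)" by auto
    then obtain l where "l < length (tgt C e)" "tgt C e ! l = v" by (metis in_set_conv_nth)
    then have "(e, l) \<in> tgt_at C v" using v(2) es by (simp add: tgt_at_def)
    then show False using A v by blast
  qed
  moreover have "distinct f" using p by simp
  ultimately have D: "distinct (outs (diagram_of C es us) @ f)" using us by auto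
  have V: "set (outs (diagram_of C es us) @ f) = verts C" using us T f by (auto simp: tuples_def)
  have "\<forall>d \<in> set (diagram_of C es us). wf_blk d" using h es by (auto simp: diagram_of_def hypergraph_def)
  moreover have "set (ins (diagram_of C es us) @ g) \<subseteq> set (outs (diagram_of C es us) @ f)" unfolding V using T g by (auto simp: tuples_def)
  ultimately have "valid (diagram_of C es us) f g" using D by (simp add: valid_def)
  then show ?thesis using es V unfolding enum_def by blast
qed

text \<open>A morphism from \<open>C\<close> is a valuation of the vertices together with
  independent choices of a compatible image for each hyperedge. With the inputs prescribed, the
  valuation is given by its values on \<open>outs\<close>, which matches the sum in
  \<open>mor_cnt_nf\<close> term by term.\<close>

lemma enum_card:
  fixes K :: "('g, 'u) hgraph"
  assumes en: "enum C f g es us" and K: "finhyp S K" and a: "a \<in> tuples K (length f)" and b: "b \<in> tuples K (length g)"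
  shows "mor_cnt K (nf (diagram_of C es us) f g) a b = card (homs C (f @ g) K (a @ b))"
proof -
  let ?D = "diagram_of C es us"
  let ?X = "outs ?D @ f"
  have es: "set es = edges C" "distinct es" and v: "valid ?D f g" and V: "set ?X = verts C"
    using en by (auto simp: enum_def)
  have dX: "distinct ?X" using v by (simp add: valid_def)
  have hC: "hypergraph S C" "finite (edges C)" "set f \<subseteq> verts C" "set g \<subseteq> verts C"
    using enum_finhyp[OF en] by (auto simp: finhyp_def tuples_def)
  have fK: "finite (verts K)" "finite (edges K)" using K by (auto simp: finhyp_def)
  define \<eta> where "\<eta> = (\<lambda>o'. sub ?X (o' @ a))"
  \<comment> \<open>The admissible images of the hyperedge \<open>e\<close> once the vertices are
    mapped by the valuation.\<close>
  define T where "T = (\<lambda>\<eta> e. {e' \<in> edges K. lab K e' = lab C e \<and> src K e' = map \<eta> (src C e) \<and> tgt K e' = map \<eta> (tgt C e)})"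
  let ?O = "tuples K (length (outs ?D)) \<inter> {o'. map (\<eta> o') g = b}"
  let ?P = "\<lambda>o'. {restrict (\<eta> o') (verts C)} \<times> (\<Pi>\<^sub>E e\<in>edges C. T (\<eta> o') e)"
  have len: "length ?X = length (o' @ a)" if "o' \<in> tuples K (length (outs ?D))" for o'
    using tuples_length[OF that] tuples_length[OF a] by simp
  have mapX: "map (\<eta> o') ?X = o' @ a" if "o' \<in> tuples K (length (outs ?D))" for o'
    unfolding \<eta>_def by (rule map_sub_self[OF dX len[OF that]])
  have map_o: "map (\<eta> o') (outs ?D) = o'" "map (\<eta> o') f = a" if "o' \<in> tuples K (length (outs ?D))" for o'
    using mapX[OF that] tuples_length[OF that] by (auto simp del: diagram_of_simps)
  have in_K: "\<eta> o' v \<in> verts K" if "o' \<in> tuples K (length (outs ?D))" "v \<in> verts C" for o' v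
  proof -
    have "\<eta> o' v \<in> set (o' @ a)" unfolding \<eta>_def by (rule sub_in[OF _ len[OF that(1)]]) (use that V in auto)
    then show ?thesis using that(1) a by (auto simp: tuples_def)
  qed
  have prod: "prod_list (map (blk_cnt K \<mu>) ?D) = card (\<Pi>\<^sub>E e\<in>edges C. T \<mu> e)" for \<mu>
  proof -
    have "prod_list (map (blk_cnt K \<mu>) ?D) = prod_list (map (\<lambda>e. card (T \<mu> e)) es)"
      by (simp add: diagram_of_def T_def comp_def blk_cnt.simps[OF fK(1)]) (induct us, auto simp: blk_cnt.simps[OF fK(1)])
    also have "\<dots> = (\<Prod>e\<in>edges C. card (T \<mu> e))"
      using prod.distinct_set_conv_list[OF es(2), of "\<lambda>e. card (T \<mu> e)"] es by simp
    also have "\<dots> = card (\<Pi>\<^sub>E e\<in>edges C. T \<mu> e)" using hC by (simp add: card_PiE)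
    finally show ?thesis .
  qed
  have "homs C (f @ g) K (a @ b) = (\<Union>o'\<in>?O. ?P o')"
  proof (intro set_eqI iffI)
    fix h assume "h \<in> homs C (f @ g) K (a @ b)"
    then have h: "restr C h = h" "hmor C K h" "map (fst h) f = a" "map (fst h) g = b"
      using tuples_length[OF a] by (auto simp: homs_append)
    let ?o = "map (fst h) (outs ?D)"
    have "\<eta> ?o v = fst h v" if "v \<in> verts C" for v
    proof -
      have "?o @ a = map (fst h) ?X" using h by simp
      then show ?thesis unfolding \<eta>_def sub_def using that V by (metis nth_map nth_pos pos_less)
    qed
    note eq = this
    have mapeq: "map (\<eta> ?o) xs = map (fst h) xs" if "set xs \<subseteq> verts C" for xs using that eq by (auto simp del: diagram_of_simps)
    have "?o \<in> tuples K (length (outs ?D))" using h(2) V by (auto simp: tuples_def hmor_def)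
    moreover have "map (\<eta> ?o) g = b" using mapeq[OF hC(4)] h(4) by simp
    moreover have "fst h = restrict (\<eta> ?o) (verts C)"
    proof -
      have "fst h = restrict (fst h) (verts C)" using h(1) by (metis fst_conv restr_def)
      also have "\<dots> = restrict (\<eta> ?o) (verts C)" using eq by (intro restrict_ext) simp
      finally show ?thesis .
    qed
    moreover have "snd h \<in> (\<Pi>\<^sub>E e\<in>edges C. T (\<eta> ?o) e)"
    proof (rule PiE_I)
      fix e assume e: "e \<in> edges C"
      then have "set (src C e) \<subseteq> verts C" "set (tgt C e) \<subseteq> verts C" using hC(1) by (auto simp: hypergraph_def)
      then show "snd h e \<in> T (\<eta> ?o) e" unfolding T_def using h(2) e mapeq by (simp add: hmor_def image_subset_iff del: diagram_of_simps)
    next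
      fix e assume "e \<notin> edges C"
      moreover have "snd h = restrict (snd h) (edges C)" using h(1) by (metis restr_def snd_conv)
      ultimately show "snd h e = undefined" by (metis restrict_apply)
    qed
    ultimately show "h \<in> (\<Union>o'\<in>?O. ?P o')" by (auto simp: mem_Times_iff simp del: diagram_of_simps)
  next
    fix h assume "h \<in> (\<Union>o'\<in>?O. ?P o')"
    then obtain o' where o': "o' \<in> tuples K (length (outs ?D))" "map (\<eta> o') g = b"
      and h: "fst h = restrict (\<eta> o') (verts C)" "snd h \<in> (\<Pi>\<^sub>E e\<in>edges C. T (\<eta> o') e)" by (auto simp: mem_Times_iff)
    have mapeq: "map (fst h) xs = map (\<eta> o') xs" if "set xs \<subseteq> verts C" for xs using that h(1) by auto
    have "restr C h = h" using h by (auto simp: restr_def prod_eq_iff fun_eq_iff PiE_iff extensional_def)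
    moreover have "hmor C K h" unfolding hmor_def
    proof (intro conjI ballI)
      show "fst h ` verts C \<subseteq> verts K" using h(1) in_K[OF o'(1)] by auto
      show "snd h ` edges C \<subseteq> edges K" using h(2) by (auto simp: PiE_iff T_def)
      fix e assume e: "e \<in> edges C"
      then have s: "set (src C e) \<subseteq> verts C" "set (tgt C e) \<subseteq> verts C" using hC(1) by (auto simp: hypergraph_def)
      have "snd h e \<in> T (\<eta> o') e" using h(2) e by (auto simp: PiE_iff)
      then show "lab K (snd h e) = lab C e" "src K (snd h e) = map (fst h) (src C e)" "tgt K (snd h e) = map (fst h) (tgt C e)"
        unfolding mapeq[OF s(1)] mapeq[OF s(2)] T_def by auto
    qed
    moreover have "map (fst h) f = a" "map (fst h) g = b"
      using mapeq[OF hC(3)] mapeq[OF hC(4)] map_o[OF o'(1)] o'(2) by simp_all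
    ultimately show "h \<in> homs C (f @ g) K (a @ b)" by (auto simp: homs_def)
  qed
  also have "card \<dots> = (\<Sum>o'\<in>?O. card (?P o'))"
  proof (rule card_UN_disjoint)
    show "finite ?O" using fK by simp
    have "finite (T \<mu> e)" for \<mu> e unfolding T_def using fK by simp
    then show "\<forall>o'\<in>?O. finite (?P o')" using hC by (auto intro!: finite_PiE)
    show "\<forall>x\<in>?O. \<forall>y\<in>?O. x \<noteq> y \<longrightarrow> ?P x \<inter> ?P y = {}"
    proof (intro ballI impI)
      fix x y assume x: "x \<in> ?O" "y \<in> ?O" "x \<noteq> y"
      have "restrict (\<eta> x) (verts C) \<noteq> restrict (\<eta> y) (verts C)"
      proof
        assume "restrict (\<eta> x) (verts C) = restrict (\<eta> y) (verts C)"
        then have "map (\<eta> x) (outs ?D) = map (\<eta> y) (outs ?D)" using V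
          by (metis (no_types, lifting) Un_iff map_cong restrict_apply' set_append)
        then show False using x map_o(1) by (metis IntD1)
      qed
      then show "?P x \<inter> ?P y = {}" by auto
    qed
  qed
  also have "\<dots> = (\<Sum>o'\<in>?O. prod_list (map (blk_cnt K (\<eta> o')) ?D))"
    by (rule sum.cong[OF refl]) (simp add: prod card_cartesian_product)
  also have "\<dots> = mor_cnt K (nf ?D f g) a b"
    using mor_cnt_nf[OF fK(1) v a b] fK unfolding \<eta>_def by simp
  finally show ?thesis ..
qed

lemma diagram_of_iso:
  assumes "hmor C C' h" "set es \<subseteq> edges C"
  shows "map_diag (fst h) (diagram_of C es us) = diagram_of C' (map (snd h) es) (map (fst h) us)"
  using assms by (auto simp: diagram_of_def map_diag_def hmor_def)

text \<open>Renaming along \<open>h\<close> leaves one hypergraph with two enumerations; these agree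
  as multisets of blocks, so \<open>nf_mset\<close> applies.\<close>

lemma nf_iso:
  assumes e: "enum C f g es us" and e': "enum C' (map (fst h) f) (map (fst h) g) es' us'" and h: "iso C C' h"
  shows "nf (diagram_of C' es' us') (map (fst h) f) (map (fst h) g) = nf (diagram_of C es us) f g"
proof -
  have es: "set es = edges C" "distinct es" and v: "valid (diagram_of C es us) f g" and V: "set (outs (diagram_of C es us) @ f) = verts C"
    using e unfolding enum_def by blast+
  have es': "set es' = edges C'" "distinct es'" and v': "valid (diagram_of C' es' us') (map (fst h) f) (map (fst h) g)"
    and V': "set (outs (diagram_of C' es' us') @ map (fst h) f) = verts C'"
    using e' unfolding enum_def by blast+
  have m: "hmor C C' h" and bv: "bij_betw (fst h) (verts C) (verts C')" and be: "bij_betw (snd h) (edges C) (edges C')"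
    using h by (auto simp: iso_def)
  have inj: "inj_on (fst h) (set (outs (diagram_of C es us) @ f))" unfolding V using bv by (simp add: bij_betw_def)
  note n = nf_map[OF inj v, unfolded diagram_of_iso[OF m equalityD1[OF es(1)]]]
  let ?D = "diagram_of C' (map (snd h) es) (map (fst h) us)"
  have "distinct (map (snd h) es)" "set (map (snd h) es) = edges C'"
    using es be by (auto simp: distinct_map bij_betw_def)
  then have 1: "mset (map (snd h) es) = mset es'" using es' set_eq_iff_mset_eq_distinct by metis
  have d: "distinct (outs ?D @ map (fst h) f)" "distinct (outs (diagram_of C' es' us') @ map (fst h) f)"
    using n(2) v' unfolding valid_def by blast+
  have "set (outs ?D @ map (fst h) f) = verts C'"
  proof -
    have "outs ?D @ map (fst h) f = map (fst h) (outs (diagram_of C es us) @ f)"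
      unfolding diagram_of_iso[OF m equalityD1[OF es(1)], symmetric] by (simp del: diagram_of_simps)
    then show ?thesis using V bv by (metis bij_betw_imp_surj_on set_map)
  qed
  then have "set (outs ?D @ map (fst h) f) = set (outs (diagram_of C' es' us') @ map (fst h) f)" using V' by simp
  then have "mset (outs ?D @ map (fst h) f) = mset (outs (diagram_of C' es' us') @ map (fst h) f)"
    using d set_eq_iff_mset_eq_distinct by blast
  moreover have "mset (concat (map (tgt C') (map (snd h) es))) = mset (concat (map (tgt C') es'))"
    unfolding mset_concat_map 1 ..
  \<comment> \<open>Both lists of produced wires enumerate the same vertices; cancelling targets and
    inputs leaves the vertices without producer.\<close>
  ultimately have 2: "mset (map (fst h) us) = mset us'" by simp
  have "mset ?D = mset (diagram_of C' es' us')"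
    using 1 2 unfolding diagram_of_def mset_append mset_map by metis
  then show ?thesis using nf_mset[OF _ n(2)] n(1) by metis
qed

text \<open>Generator blocks are moved in front of the others, since \<open>diagram_of\<close> has
  this shape; then wires become vertices and block positions become hyperedges.\<close>

lemma diagram_enum:
  assumes v: "valid D f (g :: nat list)"
  shows "\<exists>(C :: ('g, 'u::infinite) hgraph) f' g' es us. enum C f' g' es us \<and> nf (diagram_of C es us) f' g' = nf D f g"
proof -
  obtain \<iota> :: "nat \<Rightarrow> 'u" where \<iota>: "inj \<iota>" using infinite_countable_subset[OF infinite_UNIV] by blast
  define i where "i = inv \<iota>"
  have [simp]: "i (\<iota> x) = x" for x using \<iota> by (simp add: i_def)
  define D1 where "D1 = filter (\<lambda>d. fst d \<noteq> None) D"
  define D2 where "D2 = filter (\<lambda>d. fst d = None) D"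
  have "mset D = mset (D1 @ D2)" unfolding D1_def D2_def mset_append mset_filter
    using multiset_partition[of "mset D" "\<lambda>d. fst d \<noteq> None"] by simp
  note n = nf_mset[OF this v]
  have some: "fst d \<noteq> None" if "d \<in> set D1" for d using that by (simp add: D1_def)
  have none: "fst d = None" if "d \<in> set D2" for d using that by (simp add: D2_def)
  let ?D = "D1 @ D2"
  have wf: "\<forall>d \<in> set ?D. wf_blk d" using n(2) by (simp add: valid_def)
  \<comment> \<open>Hyperedges are images of positions in \<open>D1\<close>, so that equal blocks
    remain distinct. They may coincide with vertices as elements of \<open>'u\<close>, which is
    harmless because the two sets are separate components.\<close>
  define C :: "('g, 'u) hgraph" where "C = \<lparr>verts = \<iota> ` set (outs ?D @ f), edges = \<iota> ` {..<length D1},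
     lab = (\<lambda>e. the (fst (D1 ! i e))), src = (\<lambda>e. map \<iota> (fst (snd (D1 ! i e)))), tgt = (\<lambda>e. map \<iota> (snd (snd (D1 ! i e))))\<rparr>"
  let ?es = "map \<iota> [0..<length D1]" and ?us = "map \<iota> (outs D2)"
  have 1: "map (\<lambda>e. (Some (lab C e), src C e, tgt C e)) ?es = map_diag \<iota> D1"
  proof (rule nth_equalityI)
    fix k assume "k < length (map (\<lambda>e. (Some (lab C e), src C e, tgt C e)) ?es)"
    then have k: "k < length D1" by simp
    obtain b x y where e: "D1 ! k = (b, x, y)" by (metis prod_cases3)
    then have "b \<noteq> None" using some[OF nth_mem[OF k]] by simp
    then show "map (\<lambda>e. (Some (lab C e), src C e, tgt C e)) ?es ! k = map_diag \<iota> D1 ! k"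
      using k e by (simp add: C_def map_diag_def)
  qed (simp add: map_diag_def)
  have 2: "map (\<lambda>u. (None, [], [u])) ?us = map_diag \<iota> D2"
  proof -
    have "map (\<lambda>u. (None, [], [u])) (map \<iota> (outs E)) = map_diag \<iota> E" if "\<forall>d\<in>set E. wf_blk d \<and> fst d = None" for E :: "('g, nat) diagram"
      using that
    proof (induct E)
      case (Cons d E)
      then obtain u where "d = (None, [], [u])" by (cases d rule: wf_blk.cases) (auto simp: length_Suc_conv)
      then show ?case using Cons by simp
    qed simp
    then show ?thesis using wf none by simp
  qed
  have D: "diagram_of C ?es ?us = map_diag \<iota> ?D" unfolding diagram_of_def 1 2 by (simp add: map_diag_def)
  have inj: "inj_on \<iota> (set (outs ?D @ f))" using \<iota> by (rule inj_on_subset) simp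
  note m = nf_map[OF inj n(2)]
  have "enum C (map \<iota> f) (map \<iota> g) ?es ?us"
    unfolding enum_def D
  proof (intro conjI m(2))
    show "distinct ?es" using \<iota> by (simp add: distinct_map inj_on_def)
    show "set ?es = edges C" by (auto simp: C_def)
    show "set (outs (map_diag \<iota> ?D) @ map \<iota> f) = verts C" by (simp add: C_def image_Un)
  qed
  then show ?thesis using m(1) n(1) D by metis
qed

text \<open>Links a cospan to a traced term by an equation of morphisms, whereas
  \<open>represents\<close> only compares counts.\<close>

definition presents :: "('g, 'u) cospan \<Rightarrow> nat \<Rightarrow> nat \<Rightarrow> 'g tterm \<Rightarrow> bool" where
  "presents = (\<lambda>(C, f, g) m n t. length f = m \<and> length g = n \<and> ttyped S t m n \<and> (\<exists>es us. enum C f g es us \<and> nf (diagram_of C es us) f g = cls m n t))"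

lemma presents_represents:
  fixes C :: "('g, 'u) hgraph"
  assumes "presents (C, f, g) m n t"
  shows "represents S m n (IC t) (C, f, g)"
proof -
  obtain es us where e: "length f = m" "length g = n" "ttyped S t m n" "enum C f g es us" "nf (diagram_of C es us) f g = cls m n t"
    using assms by (auto simp: presents_def)
  have "card (homs C (f @ g) K (x @ y)) = cnt S K (IC t) x y" if "finhyp S K" "x \<in> tuples K m" "y \<in> tuples K n" for x y and K :: "('g, 'u) hgraph"
    using enum_card[OF e(4) that(1), of x y] mor_cnt_cls[OF _ e(3), of K x y] that e by (simp add: finhyp_def)
  then show ?thesis using enum_finhyp[OF e(4)] e by (simp add: represents_def)
qed

lemma ex_presents: "ttyped S t m n \<Longrightarrow> \<exists>(C :: ('g, 'u::infinite) hgraph) f g. presents (C, f, g) m n t"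
proof -
  assume t: "ttyped S t m n"
  obtain D f and g :: "nat list" where v: "valid D f g" "cls m n t = nf D f g" using NF_cls[OF t] by (auto simp: NF_def)
  obtain C :: "('g, 'u) hgraph" and f' g' es us where e: "enum C f' g' es us" "nf (diagram_of C es us) f' g' = nf D f g"
    using diagram_enum[OF v(1)] by blast
  have "valid (diagram_of C es us) f' g'" using e by (simp add: enum_def)
  from nf_simps(2,3)[OF this] have "length f' = m" "length g' = n" using v e by (metis dom_cls cod_cls)+
  then show ?thesis using e v t unfolding presents_def by (simp, metis)
qed

text \<open>Faithfulness of the interpretation on traced terms: a common cospan forces equal
  matrices, so the cospans presenting \<open>t\<close> and \<open>t'\<close> are isomorphic, and
  \<open>nf_iso\<close> turns this isomorphism into an equation.\<close>

theorem completeness: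
  assumes "represents S m n (IC t) (F :: ('g, 'u::infinite) hgraph, f, g)" "represents S m n (IC t') (F, f, g)" "ttyped S t m n" "ttyped S t' m n"
  shows "teq S m n t t'"
proof -
  obtain C :: "('g, 'u) hgraph" and x y where p: "presents (C, x, y) m n t" using ex_presents assms by blast
  obtain C' :: "('g, 'u) hgraph" and x' y' where p': "presents (C', x', y') m n t'" using ex_presents assms by blast
  have "cnt S K (IC t) a b = cnt S K (IC t') a b" if "finhyp S K" "a \<in> tuples K m" "b \<in> tuples K n" for a b and K :: "('g, 'u) hgraph"
    using assms(1,2) that by (simp add: represents_def)
  then obtain h where h: "iso C C' h" "map (fst h) x = x'" "map (fst h) y = y'"
    using represents_iso[OF presents_represents[OF p] presents_represents[OF p']] by blast
  obtain es us where e: "enum C x y es us" "nf (diagram_of C es us) x y = cls m n t" using p by (auto simp: presents_def)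
  obtain es' us' where e': "enum C' x' y' es' us'" "nf (diagram_of C' es' us') x' y' = cls m n t'" using p' by (auto simp: presents_def)
  have "cls m n t' = cls m n t" using nf_iso[OF e(1) _ h(1)] e e' h by metis
  then show ?thesis using cls_eqD assms by metis
qed

text \<open>An enumeration of the cospan yields a normal form, and a representative of its class is
  the required term.\<close>

lemma fullness:
  assumes "finhyp S C" "f \<in> tuples C m" "g \<in> tuples C n" "partial_left_monogamous (C, f, g)"
  shows "\<exists>t. presents (C, f, g) m n t"
proof -
  obtain es us where e: "enum C f g es us" using plm_enum[OF assms] by blast
  have v: "valid (diagram_of C es us) f g" using e by (simp add: enum_def)
  have l: "length f = m" "length g = n" using assms tuples_length by metis+
  let ?h = "nf (diagram_of C es us) f g"
  have "ttyped S (rep ?h) m n" "?h = cls m n (rep ?h)" using rep_typed[of ?h] cls_rep[of ?h] nf_simps[OF v] l by auto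
  then show ?thesis using e l unfolding presents_def by (simp, metis)
qed

end

section \<open>Term rewriting and double-pushout rewriting\<close>

lemma represents_cong:
  fixes G :: "('g, 'u) hgraph"
  assumes "\<And>(K :: ('g, 'u) hgraph) x y. finite (verts K) \<Longrightarrow> x \<in> tuples K m \<Longrightarrow> y \<in> tuples K n \<Longrightarrow> cnt S K t x y = cnt S K t' x y"
  shows "represents S m n t (G, d1, d2) \<longleftrightarrow> represents S m n t' (G, d1, d2)"
  using assms by (auto simp: represents_def finhyp_def)

text \<open>Folding moves the input leg to the output side without touching the hypergraph, and by
  \<open>cnt_fold\<close> the matrix is merely reindexed accordingly.\<close>

lemma represents_fold:
  fixes G :: "('g, 'u) hgraph"
  assumes t: "ftyped S t m n" and len: "length d1 = m" "length d2 = n"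
  shows "represents S 0 (m + n) (fold_term m t) (G, [], d1 @ d2) \<longleftrightarrow> represents S m n t (G, d1, d2)"
proof -
  note e = ftyped_dom[OF t]
  have 1: "cnt S K (fold_term m t) [] (u @ v) = cnt S K t u v"
    if "finhyp S K" "u \<in> tuples K m" "v \<in> tuples K n" for u v and K :: "('g, 'u) hgraph"
    by (rule cnt_fold) (use that e in \<open>auto simp: finhyp_def\<close>)
  have 2: "d1 @ d2 \<in> tuples G (m + n) \<longleftrightarrow> d1 \<in> tuples G m \<and> d2 \<in> tuples G n"
    using tuples_append_iff[OF len(1)] .
  have 3: "(\<forall>x y. finhyp S K \<and> x \<in> tuples K 0 \<and> y \<in> tuples K (m + n) \<longrightarrow> card (homs G ([] @ d1 @ d2) K (x @ y)) = cnt S K (fold_term m t) x y) \<longleftrightarrow>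
     (\<forall>x y. finhyp S K \<and> x \<in> tuples K m \<and> y \<in> tuples K n \<longrightarrow> card (homs G (d1 @ d2) K (x @ y)) = cnt S K t x y)" for K :: "('g, 'u) hgraph"
  proof (intro iffI allI impI)
    fix x y
    assume a: "\<forall>x y. finhyp S K \<and> x \<in> tuples K 0 \<and> y \<in> tuples K (m + n) \<longrightarrow> card (homs G ([] @ d1 @ d2) K (x @ y)) = cnt S K (fold_term m t) x y"
      and b: "finhyp S K \<and> x \<in> tuples K m \<and> y \<in> tuples K n"
    then show "card (homs G (d1 @ d2) K (x @ y)) = cnt S K t x y"
      using a[rule_format, of "[]" "x @ y"] 1 by (simp add: tuples_append)
  next
    fix x y
    assume a: "\<forall>x y. finhyp S K \<and> x \<in> tuples K m \<and> y \<in> tuples K n \<longrightarrow> card (homs G (d1 @ d2) K (x @ y)) = cnt S K t x y"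
      and b: "finhyp S K \<and> x \<in> tuples K 0 \<and> y \<in> tuples K (m + n)"
    then obtain u v where "y = u @ v" "u \<in> tuples K m" "v \<in> tuples K n" by (auto elim: tuples_addE)
    then show "card (homs G ([] @ d1 @ d2) K (x @ y)) = cnt S K (fold_term m t) x y"
      using a b 1 by simp
  qed
  show ?thesis unfolding represents_def split using 2 3 by auto
qed

lemma folded_iff:
  fixes G :: "('g, 'u::infinite) hgraph"
  assumes t: "ftyped S t m n" and len: "length d1 = m" "length d2 = n"
  shows "(G, d1 @ d2) \<in> folded S m n t \<longleftrightarrow> represents S m n t (G, d1, d2)"
  unfolding folded_def using sem_iff[OF ftyped_fold[OF t]] represents_fold[OF t len] by auto

text \<open>Counting morphisms out of the pushout sums over the images \<open>x\<close> of
  \<open>i\<close> and \<open>y\<close> of \<open>j\<close>. The factor of \<open>L\<close> is the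
  matrix of \<open>l\<close>, that of \<open>C\<close> the matrix of \<open>c\<close> with its legs
  regrouped; summing over \<open>y\<close> composes them and summing over \<open>x\<close> is the
  partial trace.\<close>

lemma pushout_trace:
  fixes L C G :: "('g, 'u::infinite) hgraph"
  assumes l: "ttyped S l i j" and c: "ttyped S c (j + m) (i + n)"
    and L: "represents S i j (IC l) (L, a1, a2)"
    and C: "represents S (j + m) (i + n) (IC c) (C, c2 @ d1, c1 @ d2)"
    and len: "length c1 = i" "length c2 = j" "length d1 = m" "length d2 = n"
    and po: "is_pushout S (i + j) (a1 @ a2) (c1 @ c2) L C G p q"
  shows "represents S m n (IC (TTr i m n ((l \<otimes>\<^sub>T TId m) ;\<^sub>T c))) (G, map (fst q) d1, map (fst q) d2)"
proof -
  have fL: "finhyp S L" "a1 \<in> tuples L i" "a2 \<in> tuples L j" and fC: "finhyp S C" "c2 @ d1 \<in> tuples C (j + m)" "c1 @ d2 \<in> tuples C (i + n)"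
    using L C by (auto simp: represents_def)
  have d: "d1 \<in> tuples C m" "d2 \<in> tuples C n" using fC len by (auto simp: tuples_def)
  have q: "hmor C G q" using po by (simp add: is_pushout_def)
  note e = IC_dom[OF l] IC_dom[OF c]
  have "card (homs G (map (fst q) d1 @ map (fst q) d2) K (u @ v)) = cnt S K (IC (TTr i m n ((l \<otimes>\<^sub>T TId m) ;\<^sub>T c))) u v"
    if K: "finhyp S K" "u \<in> tuples K m" "v \<in> tuples K n" for K :: "('g, 'u) hgraph" and u v
  proof -
    have fK: "finite (verts K)" using K by (simp add: finhyp_def)
    \<comment> \<open>The marked vertices of \<open>G\<close> all come from \<open>C\<close>, so the
      list taken from \<open>L\<close> is empty.\<close>
    have "card (homs G (map (fst p) [] @ map (fst q) (d1 @ d2)) K ([] @ (u @ v))) =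
      (\<Sum>z\<in>tuples K (i + j). card (homs L ([] @ (a1 @ a2)) K ([] @ z)) * card (homs C ((c1 @ c2) @ (d1 @ d2)) K (z @ (u @ v))))"
      by (rule card_homs_pushout[OF po fL(1) fC(1) K(1)]) (use d K in \<open>auto simp: tuples_def\<close>)
    also have "\<dots> = (\<Sum>x\<in>tuples K i. \<Sum>y\<in>tuples K j. card (homs L (a1 @ a2) K (x @ y)) * card (homs C ((c1 @ c2) @ (d1 @ d2)) K ((x @ y) @ (u @ v))))"
      by (simp add: sum_tuples_add[OF fK])
    also have "\<dots> = (\<Sum>x\<in>tuples K i. \<Sum>y\<in>tuples K j. cnt S K (IC l) x y * cnt S K (IC c) (y @ u) (x @ v))"
    proof (intro sum.cong refl)
      fix x y assume x: "x \<in> tuples K i" and y: "y \<in> tuples K j"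
      have "homs C ((c1 @ c2) @ (d1 @ d2)) K ((x @ y) @ (u @ v)) = homs C ((c2 @ d1) @ (c1 @ d2)) K ((y @ u) @ (x @ v))"
        using len tuples_length[OF x] tuples_length[OF y] tuples_length[OF K(2)] tuples_length[OF K(3)]
        by (auto simp: homs_def)
      also have "card \<dots> = cnt S K (IC c) (y @ u) (x @ v)"
        using C K x y by (simp add: represents_def tuples_append del: append_assoc)
      finally show "card (homs L (a1 @ a2) K (x @ y)) * card (homs C ((c1 @ c2) @ (d1 @ d2)) K ((x @ y) @ (u @ v))) =
         cnt S K (IC l) x y * cnt S K (IC c) (y @ u) (x @ v)"
        using L K x y by (simp add: represents_def del: append_assoc)
    qed
    also have "\<dots> = (\<Sum>x\<in>tuples K i. cnt S K ((IC l \<otimes>\<^sub>F FId m) ;\<^sub>F IC c) (x @ u) (x @ v))"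
      by (rule sum.cong[OF refl], subst cnt_whisker_left) (use fK K e in \<open>auto simp: tuples_length\<close>)
    also have "\<dots> = cnt S K (IC (TTr i m n ((l \<otimes>\<^sub>T TId m) ;\<^sub>T c))) u v"
      unfolding IC.simps by (rule cnt_trace[symmetric]) (use fK K e in auto)
    finally show ?thesis by simp
  qed
  then show ?thesis using pushout_finhyp[OF po fL(1) fC(1)] hmor_tuples[OF q] d by (simp add: represents_def)
qed

lemma ttyped_context:
  "ttyped S l i j \<Longrightarrow> ttyped S c (j + m) (i + n) \<Longrightarrow> ttyped S (TTr i m n ((l \<otimes>\<^sub>T TId m) ;\<^sub>T c)) m n"
  by (rule ttyped.intros(6)[OF ttyped.intros(4)[OF ttyped.intros(5)[OF _ ttyped.intros(2)]]])

theorem theorem5p25: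
  fixes S :: "'g msig"
    and \<R> :: "('g tterm \<times> 'g tterm) set"
    and m n :: nat
    and g h :: "'g tterm"
  assumes "rewriting_system S \<R>"
    and "ttyped S g m n"
    and "ttyped S h m n"
  shows "term_rewrite S \<R> m n g h \<longleftrightarrow>
    dpo_rewrite S (dpo_rules S \<R> :: ('g, 'u::infinite) dpo_rule set) m n
      (folded S m n (IC g)) (folded S m n (IC h))"
proof
  assume "term_rewrite S \<R> m n g h"
  then obtain l r i j c where lr: "(l, r) \<in> \<R>" and l: "ttyped S l i j" and r: "ttyped S r i j" and c: "ttyped S c (j + m) (i + n)"
    and g: "teq S m n g (TTr i m n ((l \<otimes>\<^sub>T TId m) ;\<^sub>T c))" and h: "teq S m n h (TTr i m n ((r \<otimes>\<^sub>T TId m) ;\<^sub>T c))"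
    unfolding term_rewrite_def by blast
  \<comment> \<open>The context term is realised as a hypergraph, which serves as the pushout
    complement.\<close>
  obtain C :: "('g, 'u) hgraph" and x y where C: "signature.presents S (C, x, y) (j + m) (i + n) c"
    using signature.ex_presents[OF c] by blast
  note rC = signature.presents_represents[OF C]
  have plm: "partial_left_monogamous (C, x, y)" using C signature.enum_plm unfolding signature.presents_def split by blast
  have xy: "x \<in> tuples C (j + m)" "y \<in> tuples C (i + n)" "finhyp S C" using rC by (auto simp: represents_def)
  obtain c2 d1 where x: "x = c2 @ d1" "c2 \<in> tuples C j" "d1 \<in> tuples C m" using tuples_addE[OF xy(1)] .
  obtain c1 d2 where y: "y = c1 @ d2" "c1 \<in> tuples C i" "d2 \<in> tuples C n" using tuples_addE[OF xy(2)] .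
  note len = tuples_length[OF y(2)] tuples_length[OF x(2)] tuples_length[OF x(3)] tuples_length[OF y(3)]
  obtain L :: "('g, 'u) hgraph" and a1 a2 where L: "represents S i j (IC l) (L, a1, a2)"
    using interp_nonempty[OF ttyped_IC[OF l]] interp_represents[OF ttyped_IC[OF l]] by metis
  obtain R :: "('g, 'u) hgraph" and b1 b2 where R: "represents S i j (IC r) (R, b1, b2)"
    using interp_nonempty[OF ttyped_IC[OF r]] interp_represents[OF ttyped_IC[OF r]] by metis
  have "(L, a1, a2) \<in> sem S (fmorphism S i j (IC l))" "(R, b1, b2) \<in> sem S (fmorphism S i j (IC r))"
    using iffD2[OF sem_iff[OF ttyped_IC[OF l]] L] iffD2[OF sem_iff[OF ttyped_IC[OF r]] R] .
  then have rule: "(i, j, L, a1 @ a2, b1 @ b2, R) \<in> dpo_rules S \<R>"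
    unfolding dpo_rules_def using lr l r by blast
  have h': "hypergraph S L" "hypergraph S R" "hypergraph S C" "discrete_mor (i + j) L (a1 @ a2)" "discrete_mor (i + j) R (b1 @ b2)"
    "discrete_mor (i + j) C (c1 @ c2)"
    using L R xy x y by (auto simp: represents_def finhyp_def discrete_mor_def tuples_def)
  \<comment> \<open>The same \<open>C\<close>, with the same interface, is glued to both sides of
    the rule.\<close>
  obtain G p q where po: "is_pushout S (i + j) (a1 @ a2) (c1 @ c2) L C G p q"
    using pushout_exists[OF h'(1,3,4,6)] by metis
  obtain H p' q' where po': "is_pushout S (i + j) (b1 @ b2) (c1 @ c2) R C H p' q'"
    using pushout_exists[OF h'(2,3,5,6)] by metis
  have "represents S m n (IC g) (G, map (fst q) d1, map (fst q) d2)"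
    using pushout_trace[OF l c L rC[unfolded x(1) y(1)] len po] represents_cong[OF teq_cnt[OF _ g]] by blast
  then have G: "(G, map (fst q) d1 @ map (fst q) d2) \<in> folded S m n (IC g)"
    by (intro iffD2[OF folded_iff[OF ttyped_IC[OF assms(2)]]]) (simp_all add: len)
  have "represents S m n (IC h) (H, map (fst q') d1, map (fst q') d2)"
    using pushout_trace[OF r c R rC[unfolded x(1) y(1)] len po'] represents_cong[OF teq_cnt[OF _ h]] by blast
  then have H: "(H, map (fst q') d1 @ map (fst q') d2) \<in> folded S m n (IC h)"
    by (intro iffD2[OF folded_iff[OF ttyped_IC[OF assms(3)]]]) (simp_all add: len)
  have dm: "discrete_mor i C c1" "discrete_mor j C c2" "discrete_mor m C d1" "discrete_mor n C d2" "distinct c2"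
    "partial_left_monogamous (C, c2 @ d1, c1 @ d2)"
    using x y plm by (auto simp: discrete_mor_def tuples_def)
  have "dpo_step S (dpo_rules S \<R>) m n (G, map (fst q) d1 @ map (fst q) d2) (H, map (fst q') d1 @ map (fst q') d2)"
    unfolding dpo_step.simps
    by (intro exI conjI, rule rule, rule dm(1), rule dm(2), rule dm(3), rule dm(4), rule po, rule po') (use dm in auto)
  then show "dpo_rewrite S (dpo_rules S \<R> :: ('g, 'u) dpo_rule set) m n (folded S m n (IC g)) (folded S m n (IC h))"
    unfolding dpo_rewrite_def using G H by blast
next
  assume "dpo_rewrite S (dpo_rules S \<R> :: ('g, 'u) dpo_rule set) m n (folded S m n (IC g)) (folded S m n (IC h))"
  then obtain G x H y where GH: "(G, x) \<in> folded S m n (IC g)" "(H, y) \<in> folded S m n (IC h)"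
    and st: "dpo_step S (dpo_rules S \<R> :: ('g, 'u) dpo_rule set) m n (G, x) (H, y)"
    unfolding dpo_rewrite_def by auto
  obtain i j L a b R C c1 c2 d1 d2 p q p' q' where rule: "(i, j, L, a, b, R) \<in> (dpo_rules S \<R> :: ('g, 'u) dpo_rule set)"
    and dm: "discrete_mor i C c1" "discrete_mor j C c2" "discrete_mor m C d1" "discrete_mor n C d2"
    and po: "is_pushout S (i + j) a (c1 @ c2) L C G p q" and po': "is_pushout S (i + j) b (c1 @ c2) R C H p' q'"
    and xy: "x = map (fst q) (d1 @ d2)" "y = map (fst q') (d1 @ d2)"
    and plm: "partial_left_monogamous (C, c2 @ d1, c1 @ d2)"
    using st unfolding dpo_step.simps by blast
  obtain l r a1 a2 b1 b2 where lr: "(l, r) \<in> \<R>" and l: "ttyped S l i j" and r: "ttyped S r i j"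
    and ab: "a = a1 @ a2" "b = b1 @ b2"
    and LR: "(L, a1, a2) \<in> sem S (fmorphism S i j (IC l))" "(R, b1, b2) \<in> sem S (fmorphism S i j (IC r))"
    using rule unfolding dpo_rules_def by blast
  have L: "represents S i j (IC l) (L, a1, a2)" and R: "represents S i j (IC r) (R, b1, b2)"
    using iffD1[OF sem_iff[OF ttyped_IC[OF l]] LR(1)] iffD1[OF sem_iff[OF ttyped_IC[OF r]] LR(2)] .
  have len: "length c1 = i" "length c2 = j" "length d1 = m" "length d2 = n" using dm by (auto simp: discrete_mor_def)
  have G: "represents S m n (IC g) (G, map (fst q) d1, map (fst q) d2)"
    by (rule iffD1[OF folded_iff[OF ttyped_IC[OF assms(2)]]]) (use GH(1) len xy in simp_all)
  have H: "represents S m n (IC h) (H, map (fst q') d1, map (fst q') d2)"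
    by (rule iffD1[OF folded_iff[OF ttyped_IC[OF assms(3)]]]) (use GH(2) len xy in simp_all)
  \<comment> \<open>\<open>G\<close> is finite as an interpretation of \<open>g\<close>, hence so is
    the complement, and fullness reads the complement as a context term \<open>c\<close>.\<close>
  have "finhyp S G" using G by (simp add: represents_def)
  then have "finhyp S C" using pushout_complement_finhyp[OF po] by blast
  moreover have "c2 @ d1 \<in> tuples C (j + m)" "c1 @ d2 \<in> tuples C (i + n)" using dm by (auto simp: discrete_mor_def tuples_def)
  ultimately obtain c where c: "signature.presents S (C, c2 @ d1, c1 @ d2) (j + m) (i + n) c"
    using signature.fullness plm by blast
  note rC = signature.presents_represents[OF c]
  have ct: "ttyped S c (j + m) (i + n)" using c by (simp add: signature.presents_def)
  have "represents S m n (IC (TTr i m n ((l \<otimes>\<^sub>T TId m) ;\<^sub>T c))) (G, map (fst q) d1, map (fst q) d2)"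
    by (rule pushout_trace[OF l ct L rC len po[unfolded ab]])
  \<comment> \<open>The cospan on \<open>G\<close> represents both \<open>g\<close> and the left
    side placed in the context, so completeness equates the two terms.\<close>
  then have "teq S m n g (TTr i m n ((l \<otimes>\<^sub>T TId m) ;\<^sub>T c))"
    using signature.completeness[OF G _ assms(2) ttyped_context[OF l ct]] by blast
  moreover have "represents S m n (IC (TTr i m n ((r \<otimes>\<^sub>T TId m) ;\<^sub>T c))) (H, map (fst q') d1, map (fst q') d2)"
    by (rule pushout_trace[OF r ct R rC len po'[unfolded ab]])
  then have "teq S m n h (TTr i m n ((r \<otimes>\<^sub>T TId m) ;\<^sub>T c))"
    using signature.completeness[OF H _ assms(3) ttyped_context[OF r ct]] by blast
  ultimately show "term_rewrite S \<R> m n g h" unfolding term_rewrite_def using lr l r ct by blast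
qed

end
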